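(* Let $\Gamma$ be a finitely generated word-hyperbolic group such that $\partial\Gamma$ is homeomorphic to a sphere of dimension $r-1$, and let $\rho:\Gamma\to\mathrm{PGL}_d(\mathbb R)$ be a $(1,1,r)$-hyperconvex representation. Then $\xi^1(\partial\Gamma)$ is a $C^1$ submanifold of $\mathbb P(\mathbb R^d)$, and for every $x\in\partial\Gamma$, $$\mathsf T_{\xi^1(x)}\,\xi^1(\partial\Gamma)=\mathsf T_{\xi^1(x)}\,\mathbb P(\xi^r(x)).$$
   Context: Fix an inner product on $\mathbb R^d$; $\sigma_1(g)\ge\dots\ge\sigma_d(g)$ are the singular values of $g$ (ratios are well defined on $\mathrm{PGL}_d(\mathbb R)$). $|\cdot|$ is the word length on $\Gamma$ for a fixed finite symmetric generating set; $\partial\Gamma$ is the Gromov boundary. $\rho$ is $\{\mathsf a_p\}$-Anosov if there are $c,\mu>0$ with $\frac{\sigma_{p+1}}{\sigma_p}(\rho(\gamma))\le ce^{-\mu|\gamma|}$ for all $\gamma\in\Gamma$. It then has continuous $\rho$-equivariant boundary maps $\xi^k:\partial\Gamma\to\mathcal G_k(\mathbb R^d)$, $k\in\{p,d-p\}$, with $\xi^p(x)\oplus\xi^{d-p}(y)=\mathbb R^d$ for $x\ne y$; explicitly $\xi^k(x)=\lim_nU_k(\rho(\gamma_n))$ for any geodesic ray $\gamma_n\to x$, where $U_k(g)$ is the span of the $k$ longest axes of the ellipsoid $\{gv:\|v\|=1\}$. For $2\le r\le d-1$, $\rho$ is $(1,1,r)$-hyperconvex if it is $\{\mathsf a_1\}$-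 and $\{\mathsf a_r\}$-Anosov and $(\xi^1(x)\oplus\xi^1(y))\cap\xi^{d-r}(z)=\{0\}$ for all pairwise distinct $x,y,z\in\partial\Gamma$. *)

theory Defs
  imports "HOL-Analysis.Analysis" "HOL-Algebra.Algebra"
begin

section \<open>Word metrics, hyperbolicity and the Gromov boundary\<close>

definition symmetric_generating_set :: "('g, 'b) monoid_scheme \<Rightarrow> 'g set \<Rightarrow> bool" where
  "symmetric_generating_set G S \<longleftrightarrow>
     finite S \<and> S \<subseteq> carrier G \<and> (\<forall>s\<in>S. inv\<^bsub>G\<^esub> s \<in> S) \<and> generate G S = carrier G"

definition word_length :: "('g, 'b) monoid_scheme \<Rightarrow> 'g set \<Rightarrow> 'g \<Rightarrow> nat" where
  "word_length G S g =
     (LEAST n. \<exists>w. set w \<subseteq> S \<and> length w = n \<and> foldr (\<otimes>\<^bsub>G\<^esub>) w \<one>\<^bsub>G\<^esub> = g)"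

definition word_dist :: "('g, 'b) monoid_scheme \<Rightarrow> 'g set \<Rightarrow> 'g \<Rightarrow> 'g \<Rightarrow> real" where
  "word_dist G S g h = real (word_length G S (inv\<^bsub>G\<^esub> g \<otimes>\<^bsub>G\<^esub> h))"

definition gromov_product ::
  "('g, 'b) monoid_scheme \<Rightarrow> 'g set \<Rightarrow> 'g \<Rightarrow> 'g \<Rightarrow> 'g \<Rightarrow> real" where
  "gromov_product G S o' g h =
     (word_dist G S o' g + word_dist G S o' h - word_dist G S g h) / 2"

text \<open>Gromov's four-point condition for the word metric.\<close>

definition word_hyperbolic :: "('g, 'b) monoid_scheme \<Rightarrow> 'g set \<Rightarrow> bool" where
  "word_hyperbolic G S \<longleftrightarrow>
     (\<exists>\<delta>. \<forall>o'\<in>carrier G. \<forall>x\<in>carrier G. \<forall>y\<in>carrier G. \<forall>z\<in>carrier G.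
        min (gromov_product G S o' x y) (gromov_product G S o' y z) - \<delta>
          \<le> gromov_product G S o' x z)"

definition geodesic_ray :: "('g, 'b) monoid_scheme \<Rightarrow> 'g set \<Rightarrow> (nat \<Rightarrow> 'g) \<Rightarrow> bool" where
  "geodesic_ray G S \<gamma> \<longleftrightarrow>
     (\<forall>n. \<gamma> n \<in> carrier G) \<and> (\<forall>m n. word_dist G S (\<gamma> m) (\<gamma> n) = \<bar>real m - real n\<bar>)"

definition ray_endpoint ::
  "('g, 'b) monoid_scheme \<Rightarrow> 'g set \<Rightarrow> (nat \<Rightarrow> 'g) \<Rightarrow> (nat \<Rightarrow> 'g) set" where
  "ray_endpoint G S \<gamma> =
     {\<gamma>'. geodesic_ray G S \<gamma>' \<and> (\<exists>C. \<forall>n. word_dist G S (\<gamma> n) (\<gamma>' n) \<le> C)}"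

text \<open>A boundary point is the class of all geodesic rays, with any starting point, that
  converge to it.\<close>

definition boundary_points :: "('g, 'b) monoid_scheme \<Rightarrow> 'g set \<Rightarrow> (nat \<Rightarrow> 'g) set set" where
  "boundary_points G S = ray_endpoint G S ` {\<gamma>. geodesic_ray G S \<gamma>}"

text \<open>The rays issuing from the identity carry the topology of pointwise convergence (that is, the
  compact-open topology on rays in the Cayley graph), and the boundary the quotient topology.\<close>

definition based_rays :: "('g, 'b) monoid_scheme \<Rightarrow> 'g set \<Rightarrow> (nat \<Rightarrow> 'g) topology" where
  "based_rays G S =
     subtopology (product_topology (\<lambda>_. discrete_topology (carrier G)) UNIV)
       {\<gamma>. geodesic_ray G S \<gamma> \<and> \<gamma> 0 = \<one>\<^bsub>G\<^esub>}"

definition gromov_boundary :: "('g, 'b) monoid_scheme \<Rightarrow> 'g set \<Rightarrow> (nat \<Rightarrow> 'g) set topology" where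
  "gromov_boundary G S =
     topology (\<lambda>U. U \<subseteq> boundary_points G S \<and>
       openin (based_rays G S) {\<gamma> \<in> topspace (based_rays G S). ray_endpoint G S \<gamma> \<in> U})"

lemma openin_gromov_boundary:
  "openin (gromov_boundary G S) U \<longleftrightarrow> U \<subseteq> boundary_points G S \<and>
     openin (based_rays G S) {\<gamma> \<in> topspace (based_rays G S). ray_endpoint G S \<gamma> \<in> U}"
proof -
  let ?X = "based_rays G S"
  let ?pre = "\<lambda>U. {\<gamma> \<in> topspace ?X. ray_endpoint G S \<gamma> \<in> U}"
  have int: "?pre (A \<inter> B) = ?pre A \<inter> ?pre B" for A B by blast
  have un: "?pre (\<Union>K) = \<Union>(?pre ` K)" for K by blast
  have "istopology (\<lambda>U. U \<subseteq> boundary_points G S \<and> openin ?X (?pre U))"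
    unfolding istopology_def
  proof (intro conjI allI impI)
    fix A B
    assume A: "A \<subseteq> boundary_points G S \<and> openin ?X (?pre A)"
      and B: "B \<subseteq> boundary_points G S \<and> openin ?X (?pre B)"
    show "A \<inter> B \<subseteq> boundary_points G S" using A by blast
    show "openin ?X (?pre (A \<inter> B))" unfolding int using A B by blast
  next
    fix K
    assume K: "\<forall>U\<in>K. U \<subseteq> boundary_points G S \<and> openin ?X (?pre U)"
    show "\<Union>K \<subseteq> boundary_points G S" using K by blast
    show "openin ?X (?pre (\<Union>K))" unfolding un using K by blast
  qed
  then show ?thesis
    unfolding gromov_boundary_def by (simp add: topology_inverse')
qed

lemma topspace_gromov_boundary: "topspace (gromov_boundary G S) = boundary_points G S"
proof
  show "topspace (gromov_boundary G S) \<subseteq> boundary_points G S"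
    by (meson openin_gromov_boundary openin_topspace)
  have "{\<gamma> \<in> topspace (based_rays G S). ray_endpoint G S \<gamma> \<in> boundary_points G S}
      = topspace (based_rays G S)"
    by (auto simp: based_rays_def boundary_points_def)
  then have "openin (gromov_boundary G S) (boundary_points G S)"
    by (simp add: openin_gromov_boundary)
  then show "boundary_points G S \<subseteq> topspace (gromov_boundary G S)"
    by (rule openin_subset)
qed

section \<open>The projective linear group and singular values\<close>

text \<open>The Euclidean space \<^typ>\<open>'v\<close> is \<open>\<real>\<^sup>d\<close> with its fixed inner product, \<open>d = DIM('v)\<close>.\<close>

definition GL :: "('v::euclidean_space \<Rightarrow> 'v) monoid" where
  "GL = \<lparr>carrier = {g. linear g \<and> bij g}, mult = (\<circ>), one = id\<rparr>"

definition homotheties :: "('v::euclidean_space \<Rightarrow> 'v) set" where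
  "homotheties = {h. \<exists>c. c \<noteq> 0 \<and> h = (\<lambda>v. c *\<^sub>R v)}"

definition PGL :: "('v::euclidean_space \<Rightarrow> 'v) set monoid" where
  "PGL = GL Mod homotheties"

lemma group_GL: "group (GL :: ('v::euclidean_space \<Rightarrow> 'v) monoid)"
proof (rule groupI)
  fix g :: "'v \<Rightarrow> 'v"
  assume "g \<in> carrier GL"
  then have g: "linear g" "bij g" by (auto simp: GL_def)
  then have "linear (inv_into UNIV g)" "bij (inv_into UNIV g)"
    by (simp_all add: inj_linear_imp_inv_linear bij_is_inj bij_imp_bij_inv)
  then show "\<exists>h\<in>carrier GL. h \<otimes>\<^bsub>GL\<^esub> g = \<one>\<^bsub>GL\<^esub>"
    using g by (intro bexI[of _ "inv_into UNIV g"]) (auto simp: GL_def bij_is_inj)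
qed (auto simp: GL_def linear_compose bij_comp comp_assoc linear_id)

lemma homotheties_normal: "normal homotheties (GL :: ('v::euclidean_space \<Rightarrow> 'v) monoid)"
proof -
  interpret group "GL :: ('v \<Rightarrow> 'v) monoid" by (rule group_GL)
  have car: "(\<lambda>v::'v. c *\<^sub>R v) \<in> carrier GL" if "c \<noteq> 0" for c
  proof -
    have "bij (\<lambda>v::'v. c *\<^sub>R v)"
      by (rule o_bij[of "\<lambda>v. (1/c) *\<^sub>R v"]) (use that in \<open>auto simp: fun_eq_iff\<close>)
    then show ?thesis by (simp add: GL_def linear_scale_self)
  qed
  have sub: "subgroup homotheties (GL :: ('v \<Rightarrow> 'v) monoid)"
  proof (rule subgroupI)
    show "homotheties \<subseteq> carrier (GL :: ('v \<Rightarrow> 'v) monoid)"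
      using car by (auto simp: homotheties_def)
    show "(homotheties :: ('v \<Rightarrow> 'v) set) \<noteq> {}"
      by (auto simp: homotheties_def intro!: exI[of _ "1::real"])
    fix h :: "'v \<Rightarrow> 'v"
    assume "h \<in> homotheties"
    then obtain c where c: "c \<noteq> 0" "h = (\<lambda>v. c *\<^sub>R v)" by (auto simp: homotheties_def)
    have "inv\<^bsub>GL\<^esub> h = (\<lambda>v. (1/c) *\<^sub>R v)"
    proof (rule inv_equality)
      show "(\<lambda>v::'v. (1/c) *\<^sub>R v) \<otimes>\<^bsub>GL\<^esub> h = \<one>\<^bsub>GL\<^esub>"
        using c by (auto simp: GL_def fun_eq_iff)
      show "h \<in> carrier GL" "(\<lambda>v::'v. (1/c) *\<^sub>R v) \<in> carrier GL"
        using car[of c] car[of "1/c"] c by simp_all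
    qed
    then show "inv\<^bsub>GL\<^esub> h \<in> homotheties"
      using c by (auto simp: homotheties_def intro!: exI[of _ "1/c"])
    fix h' :: "'v \<Rightarrow> 'v"
    assume "h' \<in> homotheties"
    then obtain c' where c': "c' \<noteq> 0" "h' = (\<lambda>v. c' *\<^sub>R v)" by (auto simp: homotheties_def)
    then show "h \<otimes>\<^bsub>GL\<^esub> h' \<in> homotheties"
      using c by (auto simp: homotheties_def GL_def fun_eq_iff intro!: exI[of _ "c * c'"])
  qed
  show ?thesis
  proof (rule normalI[OF sub], rule ballI)
    fix g :: "'v \<Rightarrow> 'v"
    assume "g \<in> carrier GL"
    then have "h \<circ> g = g \<circ> h" if "h \<in> homotheties" for h
      using that by (auto simp: GL_def homotheties_def fun_eq_iff linear_scale)
    then show "homotheties #>\<^bsub>GL\<^esub> g = g <#\<^bsub>GL\<^esub> homotheties"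
      by (auto simp: r_coset_def l_coset_def GL_def)
  qed
qed

text \<open>The singular values in decreasing order: the square roots of the eigenvalues of
  \<open>g\<^sup>*g\<close>, repeated according to multiplicity.\<close>

definition singular_values :: "('v::euclidean_space \<Rightarrow> 'v) \<Rightarrow> real list" where
  "singular_values g =
     (THE xs. sorted (rev xs) \<and>
        (\<forall>s. count_list xs s = (if 0 \<le> s then dim {v. adjoint g (g v) = s\<^sup>2 *\<^sub>R v} else 0)))"

text \<open>Indexed from \<open>1\<close> to \<open>d\<close>.\<close>

definition sigma :: "nat \<Rightarrow> ('v::euclidean_space \<Rightarrow> 'v) \<Rightarrow> real" where
  "sigma k g = singular_values g ! (k - 1)"

text \<open>The span of the \<open>k\<close> longest axes of the ellipsoid \<open>{g v | norm v = 1}\<close>. Its axes of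
  half-length \<open>s\<close> are directed by the eigenvectors of \<open>gg\<^sup>*\<close> for the eigenvalue \<open>s\<^sup>2\<close>.
  The span has dimension \<open>k\<close> exactly when \<open>sigma k g > sigma (k + 1) g\<close> (for \<open>1 \<le> k < d\<close>),
  the only case in which the \<open>k\<close> longest axes are unambiguous.\<close>

definition axes_span :: "nat \<Rightarrow> ('v::euclidean_space \<Rightarrow> 'v) \<Rightarrow> 'v set" where
  "axes_span k g = span {w. \<exists>s \<ge> sigma k g. g (adjoint g w) = s\<^sup>2 *\<^sub>R w}"

section \<open>Anosov and hyperconvex representations\<close>

text \<open>A point of \<^const>\<open>PGL\<close> is the set of its linear representatives.\<close>

definition anosov ::
  "('g, 'b) monoid_scheme \<Rightarrow> 'g set \<Rightarrow> ('g \<Rightarrow> ('v::euclidean_space \<Rightarrow> 'v) set) \<Rightarrow> nat \<Rightarrow> bool" where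
  "anosov G S \<rho> p \<longleftrightarrow>
     (\<exists>c>0. \<exists>\<mu>>0. \<forall>\<gamma>\<in>carrier G. \<forall>g\<in>\<rho> \<gamma>.
        sigma (p + 1) g / sigma p g \<le> c * exp (- \<mu> * real (word_length G S \<gamma>)))"

definition grassmannian :: "nat \<Rightarrow> 'v::euclidean_space set set" where
  "grassmannian k = {W. subspace W \<and> dim W = k}"

text \<open>The operator norm distance between orthogonal projections, which metrizes the
  Grassmannians; the orthogonal projection to \<open>W\<close> is \<^term>\<open>closest_point W\<close>.\<close>

definition gap :: "'v::euclidean_space set \<Rightarrow> 'v set \<Rightarrow> real" where
  "gap W W' = onorm (\<lambda>v. closest_point W v - closest_point W' v)"

text \<open>The boundary map \<open>\<xi>\<^sup>k\<close>.\<close>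

definition boundary_map ::
  "('g \<Rightarrow> ('v::euclidean_space \<Rightarrow> 'v) set) \<Rightarrow> nat \<Rightarrow> (nat \<Rightarrow> 'g) set \<Rightarrow> 'v set" where
  "boundary_map \<rho> k x =
     (THE W. W \<in> grassmannian k \<and>
        (\<forall>\<gamma>\<in>x. \<forall>g. (\<forall>n. g n \<in> \<rho> (\<gamma> n)) \<longrightarrow> (\<lambda>n. gap (axes_span k (g n)) W) \<longlonglongrightarrow> 0))"

text \<open>\<open>(1,1,r)\<close>-hyperconvexity, for \<open>2 \<le> r \<le> d - 1\<close>.\<close>

definition hyperconvex ::
  "('g, 'b) monoid_scheme \<Rightarrow> 'g set \<Rightarrow> ('g \<Rightarrow> ('v::euclidean_space \<Rightarrow> 'v) set) \<Rightarrow> nat \<Rightarrow> bool" where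
  "hyperconvex G S \<rho> r \<longleftrightarrow>
     anosov G S \<rho> 1 \<and> anosov G S \<rho> r \<and>
     (\<forall>x\<in>boundary_points G S. \<forall>y\<in>boundary_points G S. \<forall>z\<in>boundary_points G S.
        x \<noteq> y \<and> y \<noteq> z \<and> x \<noteq> z \<longrightarrow>
        {u + v |u v. u \<in> boundary_map \<rho> 1 x \<and> v \<in> boundary_map \<rho> 1 y}
          \<inter> boundary_map \<rho> (DIM('v) - r) z = {0})"

section \<open>Submanifolds of projective space and their tangent spaces\<close>

definition proj_space :: "'v::euclidean_space set \<Rightarrow> 'v set set" where
  "proj_space W = {l \<in> grassmannian 1. l \<subseteq> W}"

text \<open>The affine chart defined by the linear form \<open>v \<mapsto> a \<bullet> v\<close>, with values in the affine
  hyperplane \<open>{v. a \<bullet> v = 1}\<close>. These charts form a smooth atlas of the projective space.\<close>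

definition chart_domain :: "'v::euclidean_space \<Rightarrow> 'v set set" where
  "chart_domain a = {l \<in> proj_space UNIV. \<exists>v\<in>l. a \<bullet> v \<noteq> 0}"

definition affine_chart :: "'v::euclidean_space \<Rightarrow> 'v set \<Rightarrow> 'v" where
  "affine_chart a l = (THE v. v \<in> l \<and> a \<bullet> v = 1)"

text \<open>A \<open>C\<^sup>1\<close> immersion on a relatively open subset \<open>D\<close> of the linear subspace \<open>L\<close>.\<close>

definition C1_immersion_on :: "'v::euclidean_space set \<Rightarrow> 'v set \<Rightarrow> ('v \<Rightarrow> 'v) \<Rightarrow> bool" where
  "C1_immersion_on L D f \<longleftrightarrow>
     (\<exists>f' :: 'v \<Rightarrow> 'v \<Rightarrow>\<^sub>L 'v.
        (\<forall>u\<in>D. (f has_derivative blinfun_apply (f' u)) (at u within L) \<and>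
                inj_on (blinfun_apply (f' u)) L) \<and>
        continuous_on D f')"

text \<open>Embedded submanifolds, through local parametrizations; a linear subspace \<open>L\<close> of
  dimension \<open>m\<close> stands for \<open>\<real>\<^sup>m\<close>. For a set contained in an affine subspace it is
  the same to be a submanifold of that subspace or of the whole space.\<close>

definition C1_submanifold_euclidean :: "nat \<Rightarrow> 'v::euclidean_space set \<Rightarrow> bool" where
  "C1_submanifold_euclidean m N \<longleftrightarrow>
     (\<forall>q\<in>N. \<exists>L D f f_inv. subspace L \<and> dim L = m \<and> openin (top_of_set L) D \<and>
        C1_immersion_on L D f \<and> homeomorphism D (f ` D) f f_inv \<and>
        q \<in> f ` D \<and> openin (top_of_set N) (f ` D))"

definition C1_submanifold_proj :: "'v::euclidean_space set set \<Rightarrow> bool" where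
  "C1_submanifold_proj M \<longleftrightarrow>
     M \<subseteq> proj_space UNIV \<and>
     (\<exists>m. \<forall>a. C1_submanifold_euclidean m (affine_chart a ` (M \<inter> chart_domain a)))"

definition C1_curve_in :: "'v::euclidean_space set set \<Rightarrow> (real \<Rightarrow> 'v set) \<Rightarrow> bool" where
  "C1_curve_in M c \<longleftrightarrow>
     c 0 \<in> M \<and>
     (\<forall>a. c 0 \<in> chart_domain a \<longrightarrow>
        (\<exists>e>0. c ` {-e<..<e} \<subseteq> M \<inter> chart_domain a \<and>
               (affine_chart a \<circ> c) C1_differentiable_on {-e<..<e}))"

text \<open>A tangent vector of the projective space is the family of its coordinates in all the
  charts around its base point (and \<open>0\<close> in the other charts).\<close>

definition curve_velocity :: "(real \<Rightarrow> 'v::euclidean_space set) \<Rightarrow> 'v \<Rightarrow> 'v" where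
  "curve_velocity c =
     (\<lambda>a. if c 0 \<in> chart_domain a then vector_derivative (affine_chart a \<circ> c) (at 0) else 0)"

definition tangent_space :: "'v::euclidean_space set set \<Rightarrow> 'v set \<Rightarrow> ('v \<Rightarrow> 'v) set" where
  "tangent_space M l = {curve_velocity c |c. C1_curve_in M c \<and> c 0 = l}"

end

theory Submission
  imports Defs "HOL-Library.Diagonal_Subsequence"
begin

text \<open>Attracting spaces converge exponentially fast along geodesic paths, which gives boundary maps
  depending continuously on the endpoint. Let two rays from the identity to \<open>x\<close> and \<open>y\<close> separate at
  time \<open>T\<close>, at the group element \<open>\<gamma>\<close>. Seen from \<open>\<gamma>\<close>, the two rays and the way back to the identity
  subconverge to rays with three distinct endpoints, so hyperconvexity keeps the plane
  \<open>\<gamma>\<^sup>-\<^sup>1 (\<xi>\<^sup>1 x + \<xi>\<^sup>1 y)\<close> at a definite angle from the repelling space of \<open>\<gamma>\<close>, and \<open>\<gamma>\<close> maps it into an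
  \<open>exp (- \<mu> T)\<close>-neighbourhood of \<open>\<xi>\<^sup>r x\<close>. Hence all secants of the limit set near \<open>\<xi>\<^sup>1 x\<close> are nearly
  tangent to \<open>P(\<xi>\<^sup>r x)\<close>. In an affine chart, the orthogonal projection to this tangent space is therefore
  injective on the limit set near \<open>\<xi>\<^sup>1 x\<close>; it is open by invariance of domain, since the boundary is a
  sphere of the same dimension \<open>r - 1\<close>, and its inverse is a \<open>C\<^sup>1\<close> parametrisation.\<close>

section \<open>Orthogonal projections and the gap\<close>

text \<open>Only singular value gaps are given at the start; equivariance of the boundary maps has
  to be derived from them. Hyperconvexity does not separate the limit lines either: two equal lines
  would satisfy its condition as long as they avoid the third space. Injectivity of the map to lines
  is therefore proved by a separate growth argument, and only then do two limit lines span a plane.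
  Repelling spaces are treated as attracting spaces of inverses, of dimension \<open>d - r\<close>;
  they converge because inversion turns the gap at \<open>r\<close> into a gap at
  \<open>d - r\<close> with the same constants. The sphere hypothesis serves three purposes:
  invariance of domain, compactness and separation of the boundary, and the absence of isolated
  points, which for the given quotient topology forces every boundary point to be the end of a ray
  from the identity. The secant estimate concerns any two points near the base point, not only pairs
  containing it. In this strict form it makes the inverse of the projection Lipschitz and its
  derivative continuous.\<close>

lemma closest_point_subspace_eqI:
  fixes W :: "'v::euclidean_space set"
  assumes "subspace W" "p \<in> W" "\<And>w. w \<in> W \<Longrightarrow> (v - p) \<bullet> w = 0"
  shows "closest_point W v = p"
proof (rule closest_point_unique[symmetric])
  show "convex W" "closed W" using assms(1) by (simp_all add: subspace_imp_convex closed_subspace)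
  show "p \<in> W" by fact
  show "\<forall>z\<in>W. dist v p \<le> dist v z"
  proof
    fix z assume z: "z \<in> W"
    have "(v - p) \<bullet> (p - z) = 0" using assms z by (simp add: subspace_diff)
    then have "norm (v - z) ^ 2 = norm (v - p) ^ 2 + norm (p - z) ^ 2"
      unfolding power2_norm_eq_inner by (simp add: inner_diff_left inner_diff_right inner_commute)
    then show "dist v p \<le> dist v z"
      unfolding dist_norm by (metis le_add_same_cancel1 norm_ge_zero power2_le_imp_le zero_le_power2)
  qed
qed

text \<open>Bundled as a bounded linear map, so that the gap of two subspaces becomes a distance in
  the complete normed space of operators.\<close>

definition oproj :: "'v::euclidean_space set \<Rightarrow> 'v \<Rightarrow>\<^sub>L 'v" where
  "oproj W = Blinfun (closest_point W)"

context
  fixes W :: "'v::euclidean_space set"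
  assumes W: "subspace W"
begin

lemma closest_point_orthogonal: "w \<in> W \<Longrightarrow> (v - closest_point W v) \<bullet> w = 0"
proof -
  assume w: "w \<in> W"
  have sp: "span W = W" using W by simp
  obtain y z where yz: "y \<in> span W" "\<And>w. w \<in> span W \<Longrightarrow> orthogonal z w" "v = y + z"
    using orthogonal_subspace_decomp_exists[of W v] by blast
  then have "closest_point W v = y"
    by (intro closest_point_subspace_eqI[OF W]) (auto simp: sp orthogonal_def)
  then show ?thesis using yz w by (auto simp: sp orthogonal_def)
qed

lemma closest_point_mem: "closest_point W v \<in> W"
  using closed_subspace[OF W] subspace_0[OF W] by (intro closest_point_in_set) auto

lemma norm_closest_point_le: "norm (closest_point W v) \<le> norm v"
proof -
  have "(v - closest_point W v) \<bullet> closest_point W v = 0"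
    by (rule closest_point_orthogonal[OF closest_point_mem])
  then have "norm (closest_point W v) ^ 2 = v \<bullet> closest_point W v"
    by (simp add: power2_norm_eq_inner inner_diff_left)
  also have "\<dots> \<le> norm v * norm (closest_point W v)" by (rule norm_cauchy_schwarz)
  finally show ?thesis
    by (metis mult_right_le_imp_le norm_ge_zero norm_le_zero_iff not_le order_trans power2_eq_square)
qed

lemma bounded_linear_closest_point: "bounded_linear (closest_point W)"
proof (rule bounded_linear_intro[where K = 1])
  fix x y :: 'v and c :: real
  show "closest_point W (x + y) = closest_point W x + closest_point W y"
  proof (rule closest_point_subspace_eqI[OF W])
    show "closest_point W x + closest_point W y \<in> W"
      by (intro subspace_add[OF W] closest_point_mem)
    fix w assume "w \<in> W"
    then show "(x + y - (closest_point W x + closest_point W y)) \<bullet> w = 0"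
      using closest_point_orthogonal[of w x] closest_point_orthogonal[of w y]
      by (simp add: inner_diff_left inner_add_left)
  qed
  show "closest_point W (c *\<^sub>R x) = c *\<^sub>R closest_point W x"
  proof (rule closest_point_subspace_eqI[OF W])
    show "c *\<^sub>R closest_point W x \<in> W" by (intro subspace_scale[OF W] closest_point_mem)
    fix w assume "w \<in> W"
    then show "(c *\<^sub>R x - c *\<^sub>R closest_point W x) \<bullet> w = 0"
      using closest_point_orthogonal[of w x] by (simp add: inner_diff_left)
  qed
  show "norm (closest_point W x) \<le> norm x * 1" using norm_closest_point_le by simp
qed

lemma oproj_apply: "blinfun_apply (oproj W) = closest_point W"
  by (simp add: oproj_def bounded_linear_Blinfun_apply bounded_linear_closest_point)

lemma oproj_mem: "oproj W v \<in> W" by (simp add: oproj_apply closest_point_mem)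

lemma oproj_orthogonal: "w \<in> W \<Longrightarrow> (v - oproj W v) \<bullet> w = 0"
  by (simp add: oproj_apply closest_point_orthogonal)

lemma norm_oproj_le: "norm (oproj W v) \<le> norm v"
  by (simp add: oproj_apply norm_closest_point_le)

lemma oproj_eqI: "p \<in> W \<Longrightarrow> (\<And>w. w \<in> W \<Longrightarrow> (v - p) \<bullet> w = 0) \<Longrightarrow> oproj W v = p"
  by (simp add: oproj_apply closest_point_subspace_eqI W)

lemma oproj_id: "w \<in> W \<Longrightarrow> oproj W w = w" by (rule oproj_eqI) auto

lemma oproj_fixed_iff: "oproj W w = w \<longleftrightarrow> w \<in> W"
  using oproj_id oproj_mem by metis

lemma inner_oproj: "oproj W v \<bullet> w = v \<bullet> oproj W w"
  using oproj_orthogonal[OF oproj_mem, of v w] oproj_orthogonal[OF oproj_mem, of w v]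
  by (simp add: inner_diff_right inner_diff_left inner_commute)

lemma oproj_idem: "oproj W (oproj W v) = oproj W v" by (simp add: oproj_id oproj_mem)

lemma norm_diff_oproj_le: "w \<in> W \<Longrightarrow> norm (v - oproj W v) \<le> norm (v - w)"
  using W by (simp add: oproj_apply flip: dist_norm)
     (simp add: closest_point_le closed_subspace)

lemma norm_diff_oproj_le_norm: "norm (v - oproj W v) \<le> norm v"
  using norm_diff_oproj_le[of 0 v] W by (simp add: subspace_0)

lemma norm_oproj_le_1: "norm (oproj W) \<le> 1"
  by (rule norm_blinfun_bound) (auto simp: norm_oproj_le)

end

lemma gap_eq_dist:
  fixes W W' :: "'v::euclidean_space set"
  assumes "subspace W" "subspace W'"
  shows "gap W W' = dist (oproj W) (oproj W')"
proof -
  have "(\<lambda>v. closest_point W v - closest_point W' v) = blinfun_apply (oproj W - oproj W')"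
    using assms by (auto simp: fun_eq_iff oproj_apply minus_blinfun.rep_eq)
  then show ?thesis by (simp add: gap_def dist_norm norm_blinfun.rep_eq)
qed

lemma dist_oproj_le_2:
  fixes W W' :: "'v::euclidean_space set"
  assumes "subspace W" "subspace W'"
  shows "dist (oproj W) (oproj W') \<le> 2"
  using norm_oproj_le_1[OF assms(1)] norm_oproj_le_1[OF assms(2)]
    norm_triangle_ineq4[of "oproj W" "oproj W'"] by (simp add: dist_norm)

lemma norm_diff_oproj_le_dist:
  fixes W W' :: "'v::euclidean_space set"
  assumes "subspace W" "w \<in> W"
  shows "norm (w - oproj W' w) \<le> dist (oproj W) (oproj W') * norm w"
proof -
  have "w - oproj W' w = (oproj W - oproj W') w"
    using assms by (simp add: minus_blinfun.rep_eq oproj_id)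
  then show ?thesis by (simp add: dist_norm norm_blinfun)
qed

lemma inj_on_oproj:
  fixes W W' :: "'v::euclidean_space set"
  assumes W: "subspace W" and "\<And>w. w \<in> W \<Longrightarrow> w \<noteq> 0 \<Longrightarrow> norm (w - oproj W' w) < norm w"
  shows "inj_on (oproj W') W"
proof (rule inj_onI)
  fix x y assume xy: "x \<in> W" "y \<in> W" "oproj W' x = oproj W' y"
  then have "oproj W' (x - y) = 0" by (simp add: blinfun.diff_right)
  then show "x = y" using assms(2)[of "x - y"] subspace_diff[OF W xy(1,2)] by force
qed

lemma dim_le_of_inj_oproj:
  fixes W W' :: "'v::euclidean_space set"
  assumes W: "subspace W" "subspace W'" and inj: "inj_on (oproj W') W"
  shows "dim W \<le> dim W'"
proof -
  have "dim (oproj W' ` W) = dim W"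
    using inj W(1) by (intro dim_image_eq)
      (auto simp: span_eq_iff[THEN iffD2] bounded_linear.linear[OF blinfun.bounded_linear_right])
  moreover have "oproj W' ` W \<subseteq> W'" using oproj_mem[OF W(2)] by auto
  ultimately show ?thesis by (metis dim_subset)
qed

text \<open>A nonzero vector of \<open>W\<close> killed by the projection to \<open>W'\<close> would
  be moved by its full norm, which the strict bound forbids. Dimension is thus locally constant in
  the gap, and limits of attracting spaces keep theirs.\<close>

lemma dim_le_of_gap_less_1:
  fixes W W' :: "'v::euclidean_space set"
  assumes W: "subspace W" "subspace W'" and "dist (oproj W) (oproj W') < 1"
  shows "dim W \<le> dim W'"
proof (rule dim_le_of_inj_oproj[OF W], rule inj_on_oproj[OF W(1)])
  fix w assume "w \<in> W" "w \<noteq> 0"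
  then show "norm (w - oproj W' w) < norm w"
    using norm_diff_oproj_le_dist[OF W(1), of w W'] assms(3)
    by (smt (verit) mult_less_cancel_right2 zero_less_norm_iff)
qed

lemma dim_eq_of_gap_less_1:
  fixes W W' :: "'v::euclidean_space set"
  assumes W: "subspace W" "subspace W'" and "dist (oproj W) (oproj W') < 1"
  shows "dim W = dim W'"
  using dim_le_of_gap_less_1[OF W assms(3)] dim_le_of_gap_less_1[OF W(2,1)] assms(3)
  by (simp add: dist_commute)

text \<open>The difference of the projections is \<open>(1 - P') P - P' (1 - P)\<close>, and the second summand is
  the adjoint of \<open>(1 - P) P'\<close>, which equality of dimensions bounds in terms of the first.\<close>

lemma gap_le_of_one_sided:
  fixes W W' :: "'v::euclidean_space set"
  assumes W: "subspace W" "subspace W'" and dim: "dim W = dim W'" and "0 \<le> \<delta>"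
    and le: "\<And>w. w \<in> W \<Longrightarrow> norm (w - oproj W' w) \<le> \<delta> * norm w"
  shows "dist (oproj W) (oproj W') \<le> 4 * \<delta>"
proof (cases "\<delta> \<le> 1/2")
  case False
  then show ?thesis using dist_oproj_le_2[OF W] by simp
next
  case True
  have inj: "inj_on (oproj W') W"
  proof (rule inj_on_oproj[OF W(1)])
    fix w assume "w \<in> W" "w \<noteq> 0"
    then show "norm (w - oproj W' w) < norm w"
      using le[of w] True by (smt (verit) divide_less_eq_1_pos mult_right_mono norm_ge_zero 
        zero_less_norm_iff mult_less_cancel_right2)
  qed
  have lin: "linear (blinfun_apply (oproj W'))"
    by (rule bounded_linear.linear[OF blinfun.bounded_linear_right])
  \<comment> \<open>Equal dimensions turn the injective projection of \<open>W\<close> into a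
    bijection onto \<open>W'\<close>; this makes the one-sided bound reversible.\<close>
  have "oproj W' ` W = W'"
  proof (rule subspace_dim_equal)
    show "subspace (oproj W' ` W)" using lin W(1) by (rule linear_subspace_image)
    show "oproj W' ` W \<subseteq> W'" using oproj_mem[OF W(2)] by auto
    have "dim (oproj W' ` W) = dim W"
      using inj W(1) by (intro dim_image_eq[OF lin]) (simp add: span_eq_iff[THEN iffD2])
    then show "dim W' \<le> dim (oproj W' ` W)" using dim by simp
  qed (fact W(2))
  have rev: "norm (w' - oproj W w') \<le> 2 * \<delta> * norm w'" if w': "w' \<in> W'" for w'
  proof -
    obtain w where w: "w \<in> W" "w' = oproj W' w" using \<open>oproj W' ` W = W'\<close> w' by blast
    have "norm (w' - oproj W w') \<le> norm (w' - w)" by (rule norm_diff_oproj_le[OF W(1) w(1)])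
    also have "\<dots> \<le> \<delta> * norm w" using le[OF w(1)] w(2) by (simp add: norm_minus_commute)
    finally have 1: "norm (w' - oproj W w') \<le> \<delta> * norm w" .
    have "norm w \<le> norm w' + norm (w - w')" by (metis add.commute diff_add_cancel norm_triangle_ineq)
    moreover have "norm (w - w') \<le> 1/2 * norm w"
      using le[OF w(1)] w(2) True by (meson dual_order.trans mult_right_mono norm_ge_zero)
    ultimately have "norm w \<le> 2 * norm w'" by simp
    then show ?thesis using 1 mult_left_mono[of "norm w" "2 * norm w'" \<delta>] \<open>0 \<le> \<delta>\<close> by simp
  qed
  have "norm ((oproj W - oproj W') v) \<le> (4 * \<delta>) * norm v" for v
  proof -
    let ?a = "oproj W v - oproj W' (oproj W v)" and ?b = "oproj W' (v - oproj W v)"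
    have "norm ?a \<le> \<delta> * norm (oproj W v)" by (rule le[OF oproj_mem[OF W(1)]])
    also have "\<dots> \<le> \<delta> * norm v" by (intro mult_left_mono norm_oproj_le W \<open>0 \<le> \<delta>\<close>)
    finally have a: "norm ?a \<le> \<delta> * norm v" .
    \<comment> \<open>Self-adjointness of both projections moves the estimate to
      \<open>?b - oproj W ?b\<close>, where the reversed bound applies since \<open>?b\<close> lies
      in \<open>W'\<close>. One factor \<open>norm ?b\<close> then cancels.\<close>
    have "(norm ?b)\<^sup>2 = ?b \<bullet> (v - oproj W v)"
      unfolding power2_norm_eq_inner by (subst inner_oproj[OF W(2), symmetric]) (simp add: oproj_idem W)
    also have "\<dots> = (?b - oproj W ?b) \<bullet> v"
      by (simp add: inner_diff_right inner_diff_left inner_oproj[OF W(1)])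
    also have "\<dots> \<le> norm (?b - oproj W ?b) * norm v" by (rule norm_cauchy_schwarz)
    also have "\<dots> \<le> (2 * \<delta> * norm ?b) * norm v"
      by (intro mult_right_mono rev oproj_mem W) auto
    finally have "norm ?b * norm ?b \<le> norm ?b * (2 * \<delta> * norm v)"
      by (simp add: power2_eq_square algebra_simps)
    then have b: "norm ?b \<le> 2 * \<delta> * norm v"
      by (cases "norm ?b = 0") (use \<open>0 \<le> \<delta>\<close> in \<open>auto simp: mult_le_cancel_left\<close>)
    have "(oproj W - oproj W') v = ?a - ?b"
      by (simp add: minus_blinfun.rep_eq blinfun.diff_right)
    then have "norm ((oproj W - oproj W') v) \<le> \<delta> * norm v + 2 * \<delta> * norm v"
      using a b norm_triangle_ineq4[of ?a ?b] by simp
    also have "\<dots> \<le> (4 * \<delta>) * norm v" using \<open>0 \<le> \<delta>\<close> by (simp add: algebra_simps mult_right_mono)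
    finally show ?thesis .
  qed
  then show ?thesis unfolding dist_norm using \<open>0 \<le> \<delta>\<close> by (intro norm_blinfun_bound) auto
qed

text \<open>Being idempotent and self-adjoint are closed conditions, so the limit operator is the
  orthogonal projection onto its own range.\<close>

lemma Cauchy_oproj_limit:
  fixes W :: "nat \<Rightarrow> 'v::euclidean_space set"
  assumes W: "\<And>n. subspace (W n)" and C: "Cauchy (\<lambda>n. oproj (W n))"
  obtains W' where "subspace W'" "(\<lambda>n. oproj (W n)) \<longlonglongrightarrow> oproj W'"
proof -
  obtain P where P: "(\<lambda>n. oproj (W n)) \<longlonglongrightarrow> P"
    using C Cauchy_convergent_iff convergent_def by blast
  define W' where "W' = range (blinfun_apply P)"
  have lin: "linear (blinfun_apply P)"
    by (rule bounded_linear.linear[OF blinfun.bounded_linear_right])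
  have sub: "subspace W'" unfolding W'_def using lin by (simp add: linear_subspace_image)
  have lim: "(\<lambda>n. oproj (W n) v) \<longlonglongrightarrow> P v" for v
    by (intro tendsto_intros P)
  have idem: "P (P v) = P v" for v
  proof -
    have "(\<lambda>n. oproj (W n) (oproj (W n) v)) \<longlonglongrightarrow> P (P v)" by (intro tendsto_intros P)
    then show ?thesis using lim[of v] by (simp add: oproj_idem W LIMSEQ_unique)
  qed
  have sa: "P v \<bullet> w = v \<bullet> P w" for v w
  proof -
    have "(\<lambda>n. oproj (W n) v \<bullet> w) \<longlonglongrightarrow> P v \<bullet> w" by (intro tendsto_intros P)
    moreover have "(\<lambda>n. v \<bullet> oproj (W n) w) \<longlonglongrightarrow> v \<bullet> P w" by (intro tendsto_intros P)
    ultimately show ?thesis by (simp add: inner_oproj W LIMSEQ_unique)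
  qed
  have "oproj W' = P"
  proof (rule blinfun_eqI)
    fix v show "oproj W' v = P v"
    proof (rule oproj_eqI[OF sub])
      show "P v \<in> W'" by (simp add: W'_def)
      fix w assume "w \<in> W'"
      then have "P w = w" by (auto simp: W'_def idem)
      then show "(v - P v) \<bullet> w = 0" using sa[of v w] by (simp add: inner_diff_left)
    qed
  qed
  then show ?thesis using that[OF sub] P by simp
qed

lemma oproj_inject:
  assumes "subspace W" "subspace W'" "oproj W = oproj W'" shows "W = W'"
  using oproj_fixed_iff[OF assms(1)] oproj_fixed_iff[OF assms(2)] assms(3) by auto

section \<open>Singular value decompositions\<close>

definition orthonormal_seq :: "nat \<Rightarrow> (nat \<Rightarrow> 'v::euclidean_space) \<Rightarrow> bool" where
  "orthonormal_seq n e \<longleftrightarrow> (\<forall>i<n. \<forall>j<n. e i \<bullet> e j = (if i = j then 1 else 0))"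

lemma orthonormal_seqD:
  "orthonormal_seq n e \<Longrightarrow> i < n \<Longrightarrow> j < n \<Longrightarrow> e i \<bullet> e j = (if i = j then 1 else 0)"
  by (simp add: orthonormal_seq_def)

lemma orthonormal_seq_inj: "orthonormal_seq n e \<Longrightarrow> inj_on e {..<n}"
  by (rule inj_onI) (metis orthonormal_seqD lessThan_iff zero_neq_one)

lemma orthonormal_seq_independent:
  assumes "orthonormal_seq n e" "I \<subseteq> {..<n}"
  shows "independent (e ` I)"
proof (rule pairwise_orthogonal_independent)
  show "pairwise orthogonal (e ` I)"
    using assms by (auto simp: pairwise_def orthogonal_def orthonormal_seq_def subset_iff)
  have "e i \<bullet> e i = 1" if "i \<in> I" for i
    using assms that by (auto simp: orthonormal_seq_def subset_iff)
  then show "0 \<notin> e ` I" by force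
qed

lemma dim_span_orthonormal_seq:
  assumes "orthonormal_seq n e" "I \<subseteq> {..<n}"
  shows "dim (span (e ` I)) = card I"
  using orthonormal_seq_independent[OF assms] card_image[OF inj_on_subset[OF orthonormal_seq_inj[OF assms(1)] assms(2)]]
  by (simp add: dim_span dim_eq_card_independent)

lemma inner_sum_orthonormal_seq:
  assumes "orthonormal_seq n e" "I \<subseteq> {..<n}" "j < n"
  shows "(\<Sum>i\<in>I. c i *\<^sub>R e i) \<bullet> e j = (if j \<in> I then c j else 0)"
proof -
  have fin: "finite I" using assms(2) finite_subset by blast
  have "(\<Sum>i\<in>I. c i *\<^sub>R e i) \<bullet> e j = (\<Sum>i\<in>I. if i = j then c i else 0)"
    unfolding inner_sum_left using assms
    by (intro sum.cong) (auto simp: orthonormal_seq_def subset_iff)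
  then show ?thesis using fin by simp
qed

lemma norm_sum_orthonormal_seq:
  assumes "orthonormal_seq n e" "I \<subseteq> {..<n}"
  shows "(norm (\<Sum>i\<in>I. c i *\<^sub>R e i))\<^sup>2 = (\<Sum>i\<in>I. (c i)\<^sup>2)"
  unfolding power2_norm_eq_inner inner_sum_right
proof (rule sum.cong)
  fix j assume "j \<in> I"
  then show "(\<Sum>i\<in>I. c i *\<^sub>R e i) \<bullet> c j *\<^sub>R e j = (c j)\<^sup>2"
    using inner_sum_orthonormal_seq[OF assms, of j c] assms(2)
    by (auto simp: subset_iff power2_eq_square)
qed simp

lemma orthonormal_seq_expansion:
  fixes e :: "nat \<Rightarrow> 'v::euclidean_space"
  assumes e: "orthonormal_seq DIM('v) e"
  shows "x = (\<Sum>i<DIM('v). (x \<bullet> e i) *\<^sub>R e i)"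
proof -
  let ?y = "\<Sum>i<DIM('v). (x \<bullet> e i) *\<^sub>R e i"
  have ind: "independent (e ` {..<DIM('v)})" by (rule orthonormal_seq_independent[OF e]) simp
  have "card (e ` {..<DIM('v)}) = DIM('v)" by (simp add: card_image orthonormal_seq_inj[OF e])
  then have "span (e ` {..<DIM('v)}) = UNIV"
    using card_eq_dim[of "e ` {..<DIM('v)}" UNIV] ind by auto
  then have "x - ?y \<in> span (e ` {..<DIM('v)})" by simp
  moreover have "orthogonal (x - ?y) z" if "z \<in> e ` {..<DIM('v)}" for z
    using that inner_sum_orthonormal_seq[OF e, of "{..<DIM('v)}"]
    by (auto simp: orthogonal_def inner_diff_left)
  ultimately have "orthogonal (x - ?y) (x - ?y)" by (rule orthogonal_to_span)
  then show ?thesis by (simp add: orthogonal_self)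
qed

lemma span_orthonormal_seq_iff:
  fixes e :: "nat \<Rightarrow> 'v::euclidean_space"
  assumes e: "orthonormal_seq DIM('v) e" and I: "I \<subseteq> {..<DIM('v)}"
  shows "x \<in> span (e ` I) \<longleftrightarrow> (\<forall>i<DIM('v). i \<notin> I \<longrightarrow> x \<bullet> e i = 0)"
proof
  assume "x \<in> span (e ` I)"
  then show "\<forall>i<DIM('v). i \<notin> I \<longrightarrow> x \<bullet> e i = 0"
  proof (intro allI impI)
    fix i assume i: "i < DIM('v)" "i \<notin> I" and x: "x \<in> span (e ` I)"
    have "orthogonal (e i) y" if "y \<in> e ` I" for y
      using that i e I by (auto simp: orthogonal_def orthonormal_seq_def subset_iff)
    then have "orthogonal (e i) x" using x by (rule orthogonal_to_span[rotated])
    then show "x \<bullet> e i = 0" by (simp add: orthogonal_def inner_commute)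
  qed
next
  assume *: "\<forall>i<DIM('v). i \<notin> I \<longrightarrow> x \<bullet> e i = 0"
  have "x = (\<Sum>i<DIM('v). (x \<bullet> e i) *\<^sub>R e i)" by (rule orthonormal_seq_expansion[OF e])
  also have "\<dots> = (\<Sum>i\<in>I. (x \<bullet> e i) *\<^sub>R e i)"
    using I * by (intro sum.mono_neutral_right) auto
  also have "\<dots> \<in> span (e ` I)" by (intro span_sum span_scale span_base) auto
  finally show "x \<in> span (e ` I)" .
qed

lemma norm_orthonormal_seq:
  fixes e :: "nat \<Rightarrow> 'v::euclidean_space"
  assumes e: "orthonormal_seq DIM('v) e"
  shows "(norm x)\<^sup>2 = (\<Sum>i<DIM('v). (x \<bullet> e i)\<^sup>2)"
  by (subst orthonormal_seq_expansion[OF e, of x], subst norm_sum_orthonormal_seq[OF e]) auto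

text \<open>Singular values are indexed from \<open>0\<close> here: \<^term>\<open>sigma k g\<close> is \<open>s (k - 1)\<close>.\<close>

definition svd ::
  "('v::euclidean_space \<Rightarrow> 'v) \<Rightarrow> (nat \<Rightarrow> 'v) \<Rightarrow> (nat \<Rightarrow> 'v) \<Rightarrow> (nat \<Rightarrow> real) \<Rightarrow> bool" where
  "svd g v u s \<longleftrightarrow> linear g \<and> orthonormal_seq DIM('v) v \<and> orthonormal_seq DIM('v) u \<and>
     (\<forall>i<DIM('v). g (v i) = s i *\<^sub>R u i \<and> 0 < s i) \<and>
     (\<forall>i j. i \<le> j \<and> j < DIM('v) \<longrightarrow> s j \<le> s i)"

text \<open>First-order condition at a maximum of the stretch factor: along
  \<open>x + t *\<^sub>R w\<close> the difference of the two squared sides has derivative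
  \<open>2 * (g x \<bullet> g w)\<close> at \<open>t = 0\<close>, which has to vanish.\<close>

lemma maximal_stretch_orthogonal:
  fixes g :: "'v::euclidean_space \<Rightarrow> 'v"
  assumes g: "linear g" and x: "norm x = 1" "x \<bullet> w = 0"
    and max: "\<And>t. norm (g (x + t *\<^sub>R w)) \<le> norm (g x) * norm (x + t *\<^sub>R w)"
    and w: "norm (g w) \<le> norm (g x) * norm w"
  shows "g x \<bullet> g w = 0"
proof -
  define b where "b = g x \<bullet> g w"
  define K where "K = (norm (g x) * norm w)\<^sup>2 - (norm (g w))\<^sup>2"
  have K: "0 \<le> K" using w by (simp add: K_def power_mono)
  have *: "2 * t * b \<le> t\<^sup>2 * K" for t
  proof -
    have "(norm (g (x + t *\<^sub>R w)))\<^sup>2 \<le> (norm (g x))\<^sup>2 * (norm (x + t *\<^sub>R w))\<^sup>2"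
      using power_mono[OF max[of t], of 2] by (simp add: power_mult_distrib)
    moreover have "(norm (x + t *\<^sub>R w))\<^sup>2 = 1 + t\<^sup>2 * (norm w)\<^sup>2"
      unfolding norm_add_Pythagorean using x norm_add_Pythagorean[of x "t *\<^sub>R w"]
      by (simp add: orthogonal_def power_mult_distrib)
    moreover have "(norm (g (x + t *\<^sub>R w)))\<^sup>2 = (norm (g x))\<^sup>2 + 2 * t * b + t\<^sup>2 * (norm (g w))\<^sup>2"
      unfolding power2_norm_eq_inner
      by (simp add: linear_add[OF g] linear_scale[OF g] inner_add_left
          inner_add_right inner_commute[of "g w" "g x"] b_def algebra_simps power2_eq_square)
    ultimately show ?thesis by (simp add: K_def algebra_simps power_mult_distrib)
  qed
  \<comment> \<open>With this \<open>t\<close> the inequality for \<open>2 * t * b\<close> turns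
    into nonpositivity of the square of \<open>t\<close> times \<open>K + 2\<close>; adding
    \<open>1\<close> keeps the denominator positive when \<open>K = 0\<close>.\<close>
  define t where "t = b / (K + 1)"
  have b: "b = t * (K + 1)" using K by (simp add: t_def)
  have "t\<^sup>2 * (K + 2) \<le> 0" using *[of t] unfolding b by (simp add: power2_eq_square algebra_simps)
  then have "t = 0" using K by (smt (verit) mult_pos_pos zero_less_power2)
  then have "b = 0" using b by simp
  then show ?thesis by (simp add: b_def)
qed

text \<open>Greedy construction: the next vector maximises \<open>norm (g x)\<close> on the unit
  sphere of the orthogonal complement of the previous ones. The invariant speaks of all
  \<open>w\<close> orthogonal to the earlier vectors and hence survives later choices.\<close>

lemma stretch_basis_exists:
  fixes g :: "'v::euclidean_space \<Rightarrow> 'v"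
  assumes g: "linear g" and "k \<le> DIM('v)"
  shows "\<exists>v. orthonormal_seq k v \<and> (\<forall>i<k. \<forall>w. (\<forall>j<i. w \<bullet> v j = 0) \<longrightarrow>
    norm (g w) \<le> norm (g (v i)) * norm w \<and> (w \<bullet> v i = 0 \<longrightarrow> g (v i) \<bullet> g w = 0))"
  using \<open>k \<le> DIM('v)\<close>
proof (induction k)
  case 0
  show ?case by (auto simp: orthonormal_seq_def)
next
  case (Suc k)
  then obtain v where on: "orthonormal_seq k v"
    and v: "\<forall>i<k. \<forall>w. (\<forall>j<i. w \<bullet> v j = 0) \<longrightarrow>
      norm (g w) \<le> norm (g (v i)) * norm w \<and> (w \<bullet> v i = 0 \<longrightarrow> g (v i) \<bullet> g w = 0)" by auto
  define Y where "Y = {w. \<forall>j<k. w \<bullet> v j = 0}"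
  have Y: "subspace Y" by (auto simp: Y_def subspace_def inner_add_left)
  have "dim (span (v ` {..<k})) < DIM('v)"
    using dim_span_orthonormal_seq[OF on, of "{..<k}"] Suc.prems by simp
  then obtain w0 where w0: "w0 \<noteq> 0" "\<And>y. y \<in> span (v ` {..<k}) \<Longrightarrow> orthogonal w0 y"
    by (metis dim_span orthogonal_to_subspace_exists)
  have "w0 \<in> Y" using w0(2) by (auto simp: Y_def orthogonal_def span_base)
  let ?K = "Y \<inter> sphere 0 1"
  have "compact ?K" using Y by (simp add: closed_Int_compact closed_subspace)
  moreover have "(1 / norm w0) *\<^sub>R w0 \<in> ?K" using w0 \<open>w0 \<in> Y\<close> Y by (simp add: subspace_scale)
  moreover have "continuous_on ?K (\<lambda>x. norm (g x))"
    using linear_continuous_on[OF linear_conv_bounded_linear[THEN iffD1, OF g]]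
    by (intro continuous_intros) 
  ultimately obtain x where x: "x \<in> ?K" "\<And>y. y \<in> ?K \<Longrightarrow> norm (g y) \<le> norm (g x)"
    using continuous_attains_sup[of ?K "\<lambda>x. norm (g x)"] by blast
  have max: "norm (g w) \<le> norm (g x) * norm w" if "w \<in> Y" for w
  proof (cases "w = 0")
    case False
    have "norm (g ((1 / norm w) *\<^sub>R w)) \<le> norm (g x)"
      using False that Y by (intro x(2)) (simp add: subspace_scale)
    then show ?thesis using False by (simp add: linear_scale[OF g] field_simps)
  qed (simp add: linear_0[OF g])
  let ?v = "v(k := x)"
  have xv: "x \<bullet> v j = 0" if "j < k" for j using x(1) that by (simp add: Y_def)
  have "orthonormal_seq (Suc k) ?v"
    using on x(1) xv by (auto simp: orthonormal_seq_def less_Suc_eq inner_commute norm_eq_1)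
  moreover have "norm (g w) \<le> norm (g (?v i)) * norm w \<and> (w \<bullet> ?v i = 0 \<longrightarrow> g (?v i) \<bullet> g w = 0)"
    if i: "i < Suc k" and w: "\<forall>j<i. w \<bullet> ?v j = 0" for i w
  proof (cases "i = k")
    case True
    then have "w \<in> Y" using w by (auto simp: Y_def)
    moreover have "g x \<bullet> g w = 0" if "w \<bullet> x = 0"
      using that x(1) \<open>w \<in> Y\<close> Y
      by (intro maximal_stretch_orthogonal[OF g]) 
         (auto intro!: max simp: inner_commute subspace_add subspace_scale)
    ultimately show ?thesis using True max by simp
  qed (use v i w in auto)
  ultimately show ?case by blast
qed

lemma svd_exists:
  fixes g :: "'v::euclidean_space \<Rightarrow> 'v"
  assumes g: "linear g" "inj g"
  obtains v u s where "svd g v u s"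
proof -
  obtain v where on: "orthonormal_seq DIM('v) v"
    and v: "\<And>i w. i < DIM('v) \<Longrightarrow> (\<forall>j<i. w \<bullet> v j = 0) \<Longrightarrow> norm (g w) \<le> norm (g (v i)) * norm w"
    "\<And>i w. i < DIM('v) \<Longrightarrow> (\<forall>j<i. w \<bullet> v j = 0) \<Longrightarrow> w \<bullet> v i = 0 \<Longrightarrow> g (v i) \<bullet> g w = 0"
    using stretch_basis_exists[OF g(1) order_refl] by blast
  define s where "s i = norm (g (v i))" for i
  define u where "u i = (1 / s i) *\<^sub>R g (v i)" for i
  have nv: "norm (v i) = 1" if "i < DIM('v)" for i
    using orthonormal_seqD[OF on that that] by (simp add: norm_eq_1)
  have s: "0 < s i" if "i < DIM('v)" for i
    using nv[OF that] g by (metis linear_injective_0 norm_zero s_def zero_less_norm_iff zero_neq_one)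
  have lt: "g (v i) \<bullet> g (v j) = 0" if "i < j" "j < DIM('v)" for i j
    using that on by (intro v(2)) (auto simp: orthonormal_seq_def)
  have "orthonormal_seq DIM('v) u"
    unfolding orthonormal_seq_def
  proof (intro allI impI)
    fix i j assume ij: "i < DIM('v)" "j < DIM('v)"
    show "u i \<bullet> u j = (if i = j then 1 else 0)"
    proof (cases "i = j")
      case True
      then show ?thesis using s[OF ij(1)]
        by (simp add: u_def s_def flip: power2_norm_eq_inner)
    next
      case False
      then have "g (v i) \<bullet> g (v j) = 0" using lt[of i j] lt[of j i] ij by (metis inner_commute linorder_neqE_nat)
      then show ?thesis using False by (simp add: u_def)
    qed
  qed
  moreover have "s j \<le> s i" if "i \<le> j" "j < DIM('v)" for i j
    using v(1)[of i "v j"] that on nv[of j] by (auto simp: s_def orthonormal_seq_def)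
  ultimately have "svd g v u s"
    using on s g(1) by (auto simp: svd_def u_def less_imp_neq[THEN not_sym])
  then show ?thesis by (rule that)
qed

context
  fixes g :: "'v::euclidean_space \<Rightarrow> 'v" and v u s
  assumes svd: "svd g v u s"
begin

lemma svdD:
  "linear g" "orthonormal_seq DIM('v) v" "orthonormal_seq DIM('v) u"
  "i < DIM('v) \<Longrightarrow> g (v i) = s i *\<^sub>R u i" "i < DIM('v) \<Longrightarrow> 0 < s i"
  "i \<le> j \<Longrightarrow> j < DIM('v) \<Longrightarrow> s j \<le> s i"
  using svd by (auto simp: svd_def)

lemma svd_nonneg: "1 \<le> k \<Longrightarrow> k \<le> DIM('v) \<Longrightarrow> 0 \<le> s (k - 1)"
  by (intro less_imp_le svdD(5)) simp

lemma svd_inner: "i < DIM('v) \<Longrightarrow> g x \<bullet> u i = s i * (x \<bullet> v i)"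
proof -
  assume i: "i < DIM('v)"
  have "g x = (\<Sum>j<DIM('v). (x \<bullet> v j) *\<^sub>R g (v j))"
    by (subst orthonormal_seq_expansion[OF svdD(2), of x]) (simp add: linear_sum linear_scale svdD(1))
  also have "\<dots> = (\<Sum>j<DIM('v). (s j * (x \<bullet> v j)) *\<^sub>R u j)"
    by (intro sum.cong) (auto simp: svdD(4))
  finally show ?thesis using inner_sum_orthonormal_seq[OF svdD(3), of "{..<DIM('v)}" i] i by simp
qed

lemma svd_norm: "(norm (g x))\<^sup>2 = (\<Sum>i<DIM('v). (s i)\<^sup>2 * (x \<bullet> v i)\<^sup>2)"
  unfolding norm_orthonormal_seq[OF svdD(3), of "g x"]
  by (intro sum.cong) (auto simp: svd_inner power_mult_distrib)

lemma svd_norm_ge: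
  assumes t: "0 \<le> t" and le: "\<And>i. i < DIM('v) \<Longrightarrow> x \<bullet> v i \<noteq> 0 \<Longrightarrow> t \<le> s i"
  shows "t * norm x \<le> norm (g x)"
proof (rule power2_le_imp_le)
  have "(t * norm x)\<^sup>2 = (\<Sum>i<DIM('v). t\<^sup>2 * (x \<bullet> v i)\<^sup>2)"
    by (simp add: power_mult_distrib norm_orthonormal_seq[OF svdD(2), of x] sum_distrib_left)
  also have "\<dots> \<le> (\<Sum>i<DIM('v). (s i)\<^sup>2 * (x \<bullet> v i)\<^sup>2)"
  proof (rule sum_mono)
    fix i assume i: "i \<in> {..<DIM('v)}"
    show "t\<^sup>2 * (x \<bullet> v i)\<^sup>2 \<le> (s i)\<^sup>2 * (x \<bullet> v i)\<^sup>2"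
      using le[of i] i t by (cases "x \<bullet> v i = 0") (auto intro!: mult_right_mono power_mono)
  qed
  finally show "(t * norm x)\<^sup>2 \<le> (norm (g x))\<^sup>2" by (simp add: svd_norm)
qed simp

lemma svd_norm_le:
  assumes t: "0 \<le> t" and le: "\<And>i. i < DIM('v) \<Longrightarrow> x \<bullet> v i \<noteq> 0 \<Longrightarrow> s i \<le> t"
  shows "norm (g x) \<le> t * norm x"
proof (rule power2_le_imp_le)
  have "(norm (g x))\<^sup>2 = (\<Sum>i<DIM('v). (s i)\<^sup>2 * (x \<bullet> v i)\<^sup>2)" by (rule svd_norm)
  also have "\<dots> \<le> (\<Sum>i<DIM('v). t\<^sup>2 * (x \<bullet> v i)\<^sup>2)"
  proof (rule sum_mono)
    fix i assume i: "i \<in> {..<DIM('v)}"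
    show "(s i)\<^sup>2 * (x \<bullet> v i)\<^sup>2 \<le> t\<^sup>2 * (x \<bullet> v i)\<^sup>2"
      using le[of i] i svdD(5)[of i] by (cases "x \<bullet> v i = 0") (auto intro!: mult_right_mono power_mono)
  qed
  also have "\<dots> = (t * norm x)\<^sup>2"
    by (simp add: power_mult_distrib norm_orthonormal_seq[OF svdD(2), of x] sum_distrib_left)
  finally show "(norm (g x))\<^sup>2 \<le> (t * norm x)\<^sup>2" .
qed (use t in simp)

lemma svd_adjoint_inner: "i < DIM('v) \<Longrightarrow> adjoint g y \<bullet> v i = s i * (y \<bullet> u i)"
  using adjoint_works[OF svdD(1), of "v i" y] svdD(4)[of i] by (simp add: inner_commute)

lemma svd_right_eigenspace:
  assumes "0 \<le> t"
  shows "{x. adjoint g (g x) = t\<^sup>2 *\<^sub>R x} = span (v ` {i. i < DIM('v) \<and> s i = t})"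
proof -
  have "adjoint g (g x) = t\<^sup>2 *\<^sub>R x \<longleftrightarrow> (\<forall>i<DIM('v). s i \<noteq> t \<longrightarrow> x \<bullet> v i = 0)" for x
  proof -
    have "adjoint g (g x) = t\<^sup>2 *\<^sub>R x \<longleftrightarrow>
        (\<forall>i<DIM('v). (adjoint g (g x) - t\<^sup>2 *\<^sub>R x) \<bullet> v i = 0)"
    proof
      assume *: "\<forall>i<DIM('v). (adjoint g (g x) - t\<^sup>2 *\<^sub>R x) \<bullet> v i = 0"
      have "adjoint g (g x) - t\<^sup>2 *\<^sub>R x = 0"
        by (subst orthonormal_seq_expansion[OF svdD(2)]) (simp add: *)
      then show "adjoint g (g x) = t\<^sup>2 *\<^sub>R x" by simp
    qed simp
    also have "\<dots> \<longleftrightarrow> (\<forall>i<DIM('v). s i \<noteq> t \<longrightarrow> x \<bullet> v i = 0)"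
    proof (intro all_cong)
      fix i assume i: "i < DIM('v)"
      have "(adjoint g (g x) - t\<^sup>2 *\<^sub>R x) \<bullet> v i = ((s i)\<^sup>2 - t\<^sup>2) * (x \<bullet> v i)"
        using i by (simp add: inner_diff_left svd_adjoint_inner svd_inner power2_eq_square algebra_simps)
      moreover have "(s i)\<^sup>2 = t\<^sup>2 \<longleftrightarrow> s i = t" using svdD(5)[OF i] assms by (simp add: power2_eq_iff_nonneg)
      ultimately show "(adjoint g (g x) - t\<^sup>2 *\<^sub>R x) \<bullet> v i = 0 \<longleftrightarrow> (s i \<noteq> t \<longrightarrow> x \<bullet> v i = 0)" by auto
    qed
    finally show ?thesis .
  qed
  moreover have "{i. i < DIM('v) \<and> s i = t} \<subseteq> {..<DIM('v)}" by auto
  ultimately show ?thesis by (auto simp: span_orthonormal_seq_iff[OF svdD(2)])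
qed

lemma svd_left_eigenvector:
  assumes "0 \<le> t"
  shows "g (adjoint g y) = t\<^sup>2 *\<^sub>R y \<longleftrightarrow> y \<in> span (u ` {i. i < DIM('v) \<and> s i = t})"
proof -
  have "g (adjoint g y) = t\<^sup>2 *\<^sub>R y \<longleftrightarrow>
      (\<forall>i<DIM('v). (g (adjoint g y) - t\<^sup>2 *\<^sub>R y) \<bullet> u i = 0)"
  proof
    assume *: "\<forall>i<DIM('v). (g (adjoint g y) - t\<^sup>2 *\<^sub>R y) \<bullet> u i = 0"
    have "g (adjoint g y) - t\<^sup>2 *\<^sub>R y = 0"
      by (subst orthonormal_seq_expansion[OF svdD(3)]) (simp add: *)
    then show "g (adjoint g y) = t\<^sup>2 *\<^sub>R y" by simp
  qed simp
  also have "\<dots> \<longleftrightarrow> (\<forall>i<DIM('v). s i \<noteq> t \<longrightarrow> y \<bullet> u i = 0)"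
  proof (intro all_cong)
    fix i assume i: "i < DIM('v)"
    have "(g (adjoint g y) - t\<^sup>2 *\<^sub>R y) \<bullet> u i = ((s i)\<^sup>2 - t\<^sup>2) * (y \<bullet> u i)"
      using i by (simp add: inner_diff_left svd_adjoint_inner svd_inner power2_eq_square algebra_simps)
    moreover have "(s i)\<^sup>2 = t\<^sup>2 \<longleftrightarrow> s i = t" using svdD(5)[OF i] assms by (simp add: power2_eq_iff_nonneg)
    ultimately show "(g (adjoint g y) - t\<^sup>2 *\<^sub>R y) \<bullet> u i = 0 \<longleftrightarrow> (s i \<noteq> t \<longrightarrow> y \<bullet> u i = 0)" by auto
  qed
  finally show ?thesis by (subst span_orthonormal_seq_iff[OF svdD(3)]) auto
qed

text \<open>The prescribed multiplicities fix the multiset of entries and sortedness fixes their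
  order, so the definite description has at most one solution. A decomposition provides one, because
  the eigenspaces in question are spanned by the \<open>v i\<close> with equal
  \<open>s i\<close>.\<close>

lemma singular_values_svd: "singular_values g = map s [0..<DIM('v)]"
  unfolding singular_values_def
proof (rule the_equality)
  let ?xs = "map s [0..<DIM('v)]"
  have "sorted (rev ?xs)"
    unfolding sorted_rev_iff_nth_mono using svdD(6) by simp
  moreover have cnt: "count_list ?xs t = (if 0 \<le> t then dim {x. adjoint g (g x) = t\<^sup>2 *\<^sub>R x} else 0)" for t
  proof -
    have "count_list ?xs t = card {i. i < DIM('v) \<and> s i = t}"
      unfolding count_list_eq_length_filter length_filter_conv_card
      by (intro arg_cong[where f = card]) auto
    moreover have "{i. i < DIM('v) \<and> s i = t} = {}" if "\<not> 0 \<le> t"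
      using that svdD(5) by force
    moreover have "dim {x. adjoint g (g x) = t\<^sup>2 *\<^sub>R x} = card {i. i < DIM('v) \<and> s i = t}" if "0 \<le> t"
      unfolding svd_right_eigenspace[OF that] by (rule dim_span_orthonormal_seq[OF svdD(2)]) auto
    ultimately show ?thesis by auto
  qed
  ultimately show "sorted (rev ?xs) \<and>
      (\<forall>t. count_list ?xs t = (if 0 \<le> t then dim {x. adjoint g (g x) = t\<^sup>2 *\<^sub>R x} else 0))" by blast
  fix ys assume ys: "sorted (rev ys) \<and>
      (\<forall>t. count_list ys t = (if 0 \<le> t then dim {x. adjoint g (g x) = t\<^sup>2 *\<^sub>R x} else 0))"
  then have "mset ys = mset ?xs"
    by (intro multiset_eqI) (simp only: count_mset cnt)
  then have "mset (rev ys) = mset (rev ?xs)" by simp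
  then have "rev ys = rev ?xs"
    using ys \<open>sorted (rev ?xs)\<close> by (metis properties_for_sort sorted_sort_id)
  then show "ys = ?xs" by simp
qed

lemma sigma_svd: "1 \<le> k \<Longrightarrow> k \<le> DIM('v) \<Longrightarrow> sigma k g = s (k - 1)"
  by (simp add: sigma_def singular_values_svd)

text \<open>Ties are kept: besides all \<open>i < k\<close> the index set contains every later
  \<open>i\<close> with the same singular value, so for \<open>k < DIM('v)\<close> the span has
  dimension \<open>k\<close> only in the presence of a gap.\<close>

lemma axes_span_svd:
  assumes k: "1 \<le> k" "k \<le> DIM('v)"
  shows "axes_span k g = span (u ` {i. i < DIM('v) \<and> s (k - 1) \<le> s i})"
proof -
  have s0: "0 < s (k - 1)" using svdD(5)[of "k - 1"] k by simp
  let ?E = "{w. \<exists>t\<ge>sigma k g. g (adjoint g w) = t\<^sup>2 *\<^sub>R w}"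
  show ?thesis
    unfolding axes_span_def
  proof (rule span_unique)
    show "?E \<subseteq> span (u ` {i. i < DIM('v) \<and> s (k - 1) \<le> s i})"
    proof
      fix w assume "w \<in> ?E"
      then obtain t where t: "s (k - 1) \<le> t" "g (adjoint g w) = t\<^sup>2 *\<^sub>R w" using sigma_svd[OF k] by auto
      then have "w \<in> span (u ` {i. i < DIM('v) \<and> s i = t})" using s0 by (subst svd_left_eigenvector[symmetric]) auto
      moreover have "u ` {i. i < DIM('v) \<and> s i = t} \<subseteq> u ` {i. i < DIM('v) \<and> s (k - 1) \<le> s i}" using t by auto
      ultimately show "w \<in> span (u ` {i. i < DIM('v) \<and> s (k - 1) \<le> s i})" using span_mono by blast
    qed
    show "subspace (span (u ` {i. i < DIM('v) \<and> s (k - 1) \<le> s i}))" by simp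
    fix T assume T: "?E \<subseteq> T" "subspace T"
    show "span (u ` {i. i < DIM('v) \<and> s (k - 1) \<le> s i}) \<subseteq> T"
    proof (rule span_minimal[OF _ T(2)], safe)
      fix i assume i: "i < DIM('v)" "s (k - 1) \<le> s i"
      have "g (adjoint g (u i)) = (s i)\<^sup>2 *\<^sub>R u i"
        using i svdD(5)[OF i(1)] by (subst svd_left_eigenvector) (auto intro: span_base)
      then show "u i \<in> T" using i T(1) sigma_svd[OF k] by auto
    qed
  qed
qed

text \<open>Inversion exchanges the two orthonormal systems and reverses the order of the singular
  values; with indices from \<open>0\<close> the reversal sends \<open>i\<close> to
  \<open>DIM('v) - 1 - i\<close>.\<close>

lemma svd_inv_into:
  assumes "bij g"
  shows "svd (inv_into UNIV g) (\<lambda>i. u (DIM('v) - 1 - i)) (\<lambda>i. v (DIM('v) - 1 - i))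
    (\<lambda>i. 1 / s (DIM('v) - 1 - i))"
  unfolding svd_def
proof (intro conjI allI impI)
  show "linear (inv_into UNIV g)" by (simp add: assms bij_is_inj inj_linear_imp_inv_linear svdD(1))
  have inj: "(DIM('v) - 1 - i = DIM('v) - 1 - j) = (i = j)" if "i < DIM('v)" "j < DIM('v)" for i j
    using that by auto
  show "orthonormal_seq DIM('v) (\<lambda>i. u (DIM('v) - 1 - i))" "orthonormal_seq DIM('v) (\<lambda>i. v (DIM('v) - 1 - i))"
    using inj by (auto simp: orthonormal_seq_def orthonormal_seqD[OF svdD(2)] orthonormal_seqD[OF svdD(3)])
  fix i assume i: "i < DIM('v)"
  let ?i = "DIM('v) - 1 - i"
  have i': "?i < DIM('v)" by simp
  show "0 < 1 / s ?i" using svdD(5)[OF i'] by simp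
  have "u ?i = g ((1 / s ?i) *\<^sub>R v ?i)" using svdD(4,5)[OF i'] by (simp add: linear_scale svdD(1))
  then show "inv_into UNIV g (u ?i) = (1 / s ?i) *\<^sub>R v ?i" using assms by (simp add: bij_is_inj)
next
  fix i j :: nat assume ij: "i \<le> j \<and> j < DIM('v)"
  then show "1 / s (DIM('v) - 1 - j) \<le> 1 / s (DIM('v) - 1 - i)"
    using svdD(6)[of "DIM('v) - 1 - j" "DIM('v) - 1 - i"] svdD(5)[of "DIM('v) - 1 - i"] svdD(5)[of "DIM('v) - 1 - j"]
    by (intro divide_left_mono) auto
qed

text \<open>The sign of \<open>c\<close> goes into \<open>u\<close>, because singular values have to
  stay positive.\<close>

lemma svd_scaleR:
  assumes "c \<noteq> 0"
  shows "svd (\<lambda>x. c *\<^sub>R g x) v (\<lambda>i. sgn c *\<^sub>R u i) (\<lambda>i. \<bar>c\<bar> * s i)"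
  unfolding svd_def
proof (intro conjI allI impI)
  show "linear (\<lambda>x. c *\<^sub>R g x)" using svdD(1) by (simp add: linear_compose_scale_right)
  show "orthonormal_seq DIM('v) (\<lambda>i. sgn c *\<^sub>R u i)"
    using assms by (auto simp: orthonormal_seq_def orthonormal_seqD[OF svdD(3)] sgn_if)
qed (use assms in \<open>auto simp: svdD sgn_if intro!: mult_left_mono\<close>)

end

lemma subspace_axes_span: "subspace (axes_span k g)"
  by (simp add: axes_span_def)

section \<open>Estimates for one invertible map\<close>

context
  fixes g :: "'v::euclidean_space \<Rightarrow> 'v"
  assumes lin: "linear g" and bij: "bij g"
begin

lemma svd_obtain: obtains v u s where "svd g v u s"
  using svd_exists[OF lin bij_is_inj[OF bij]] by blast

lemma sigma_pos: "1 \<le> k \<Longrightarrow> k \<le> DIM('v) \<Longrightarrow> 0 < sigma k g"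
  by (rule svd_obtain) (simp add: sigma_svd svdD(5))

lemma sigma_antimono: "1 \<le> k \<Longrightarrow> k \<le> l \<Longrightarrow> l \<le> DIM('v) \<Longrightarrow> sigma l g \<le> sigma k g"
  by (rule svd_obtain) (simp add: sigma_svd svdD(6))

lemma axes_span_mono:
  assumes "1 \<le> k" "k \<le> l" "l \<le> DIM('v)" shows "axes_span k g \<subseteq> axes_span l g"
proof (rule svd_obtain)
  fix v u s assume svd: "svd g v u s"
  have "s (l - 1) \<le> s (k - 1)" using assms by (intro svdD(6)[OF svd]) auto
  then show ?thesis using assms by (auto simp: axes_span_svd[OF svd] intro!: span_mono)
qed

lemma axes_span_dim:
  assumes k: "1 \<le> k" "k < DIM('v)" and gap: "sigma (k + 1) g < sigma k g"
  shows "dim (axes_span k g) = k"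
proof (rule svd_obtain)
  fix v u s assume svd: "svd g v u s"
  have "{i. i < DIM('v) \<and> s (k - 1) \<le> s i} = {..<k}"
  proof safe
    fix i assume i: "i < DIM('v)" "s (k - 1) \<le> s i"
    show "i < k"
    proof (rule ccontr)
      assume "\<not> i < k"
      then have "s i \<le> s k" using i by (intro svdD(6)[OF svd]) auto
      then show False using i gap k by (simp add: sigma_svd[OF svd])
    qed
  qed (use k svdD(6)[OF svd] in auto)
  then show ?thesis using k dim_span_orthonormal_seq[OF svdD(3)[OF svd], of "{..<k}"]
    by (simp add: axes_span_svd[OF svd])
qed

lemma norm_le_sigma_1: "norm (g x) \<le> sigma 1 g * norm x"
proof (rule svd_obtain)
  fix v u s assume svd: "svd g v u s"
  have "norm (g x) \<le> s 0 * norm x"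
    using svdD(5)[OF svd, of 0] svdD(6)[OF svd, of 0] by (intro svd_norm_le[OF svd]) simp_all
  then show ?thesis by (simp add: sigma_svd[OF svd])
qed

text \<open>Removing the first \<open>k\<close> components along \<open>u\<close> from
  \<open>g x\<close> leaves the components \<open>s i * (x \<bullet> v i)\<close> with
  \<open>i \<ge> k\<close>, and these factors are at most \<open>sigma (k + 1) g\<close>.\<close>

lemma norm_diff_axes_span_le:
  assumes k: "1 \<le> k" "k < DIM('v)"
  shows "norm (g x - oproj (axes_span k g) (g x)) \<le> sigma (k + 1) g * norm x"
proof (rule svd_obtain)
  fix v u s assume svd: "svd g v u s"
  let ?y = "\<Sum>i<k. (g x \<bullet> u i) *\<^sub>R u i"
  have "?y \<in> axes_span k g"
    unfolding axes_span_svd[OF svd k(1) less_imp_le[OF k(2)]]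
    using k svdD(6)[OF svd] by (intro span_sum span_scale span_base imageI) auto
  then have "norm (g x - oproj (axes_span k g) (g x)) \<le> norm (g x - ?y)"
    by (rule norm_diff_oproj_le[OF subspace_axes_span])
  moreover have "(norm (g x - ?y))\<^sup>2 \<le> (s k * norm x)\<^sup>2"
  proof -
    have eq: "(g x - ?y) \<bullet> u i = (if i < k then 0 else s i * (x \<bullet> v i))" if "i < DIM('v)" for i
      using that k inner_sum_orthonormal_seq[OF svdD(3)[OF svd], of "{..<k}" i]
      by (simp add: inner_diff_left svd_inner[OF svd])
    have "(norm (g x - ?y))\<^sup>2 \<le> (\<Sum>i<DIM('v). (s k)\<^sup>2 * (x \<bullet> v i)\<^sup>2)"
      unfolding norm_orthonormal_seq[OF svdD(3)[OF svd], of "g x - ?y"]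
    proof (rule sum_mono)
      fix i assume i: "i \<in> {..<DIM('v)}"
      show "((g x - ?y) \<bullet> u i)\<^sup>2 \<le> (s k)\<^sup>2 * (x \<bullet> v i)\<^sup>2"
        using eq[of i] i svdD(5,6)[OF svd]
        by (auto simp: power_mult_distrib intro!: mult_right_mono power_mono intro: less_imp_le)
    qed
    then show ?thesis
      by (simp add: norm_orthonormal_seq[OF svdD(2)[OF svd], of x] sum_distrib_left power_mult_distrib)
  qed
  then have "norm (g x - ?y) \<le> s k * norm x"
    by (rule power2_le_imp_le) (use svdD(5)[OF svd, of k] k in simp)
  ultimately show ?thesis using k by (simp add: sigma_svd[OF svd])
qed

text \<open>A preimage of the leading axes has components only along those \<open>v i\<close> that
  are stretched at least by \<open>sigma k g\<close>.\<close>

lemma axes_span_preimage_norm: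
  assumes k: "1 \<le> k" "k \<le> DIM('v)" and x: "g x \<in> axes_span k g"
  shows "sigma k g * norm x \<le> norm (g x)"
proof (rule svd_obtain)
  fix v u s assume svd: "svd g v u s"
  have "x \<bullet> v i = 0" if "i < DIM('v)" "\<not> s (k - 1) \<le> s i" for i
  proof -
    have "g x \<bullet> u i = 0"
      using x that span_orthonormal_seq_iff[OF svdD(3)[OF svd], of "{i. i < DIM('v) \<and> s (k - 1) \<le> s i}" "g x"]
      unfolding axes_span_svd[OF svd k] by blast
    then show ?thesis using svd_inner[OF svd that(1), of x] svdD(5)[OF svd that(1)] by simp
  qed
  then have "s (k - 1) * norm x \<le> norm (g x)"
    using svd_nonneg[OF svd k] by (intro svd_norm_ge[OF svd]) auto
  then show ?thesis using k by (simp add: sigma_svd[OF svd])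
qed

text \<open>The leading \<open>d - k\<close> axes of the inverse contain the \<open>v i\<close> with
  \<open>i \<ge> k\<close>, the directions least expanded by \<open>g\<close>; this is the repelling
  space. What remains of \<open>x\<close> off it is expanded at least by \<open>sigma k g\<close>.
  Transversality to the repelling space is exploited through this estimate.\<close>

lemma norm_diff_axes_span_inv_le:
  assumes k: "1 \<le> k" "k < DIM('v)"
  shows "sigma k g * norm (x - oproj (axes_span (DIM('v) - k) (inv_into UNIV g)) x) \<le> norm (g x)"
proof (rule svd_obtain)
  fix v u s assume svd: "svd g v u s"
  note svd' = svd_inv_into[OF svd bij]
  let ?U = "axes_span (DIM('v) - k) (inv_into UNIV g)"
  have mem: "v i \<in> ?U" if "i \<in> {k..<DIM('v)}" for i
  proof -
    let ?j = "DIM('v) - 1 - i"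
    have "?j < DIM('v)" "1 / s (DIM('v) - 1 - (DIM('v) - k - 1)) \<le> 1 / s (DIM('v) - 1 - ?j)"
      using that k svdD(6)[OF svd', of ?j "DIM('v) - k - 1"] by auto
    then have "v (DIM('v) - 1 - ?j) \<in> ?U"
      using k by (subst axes_span_svd[OF svd']) (auto intro!: span_base)
    then show ?thesis using that by simp
  qed
  let ?y = "\<Sum>i\<in>{k..<DIM('v)}. (x \<bullet> v i) *\<^sub>R v i"
  have "?y \<in> ?U"
    by (intro subspace_sum subspace_scale mem subspace_axes_span)
  then have "norm (x - oproj ?U x) \<le> norm (x - ?y)"
    by (rule norm_diff_oproj_le[OF subspace_axes_span])
  moreover have "s (k - 1) * norm (x - ?y) \<le> norm (g x)"
  proof (rule power2_le_imp_le)
    have sub: "{k..<DIM('v)} \<subseteq> {..<DIM('v)}" by auto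
    have eq: "(x - ?y) \<bullet> v i = (if i < k then x \<bullet> v i else 0)" if "i < DIM('v)" for i
      unfolding inner_diff_left inner_sum_orthonormal_seq[OF svdD(2)[OF svd] sub that] using that by simp
    have "(s (k - 1) * norm (x - ?y))\<^sup>2 = (s (k - 1))\<^sup>2 * (\<Sum>i<DIM('v). ((x - ?y) \<bullet> v i)\<^sup>2)"
      by (simp only: power_mult_distrib norm_orthonormal_seq[OF svdD(2)[OF svd], symmetric])
    also have "\<dots> = (\<Sum>i<DIM('v). (s (k - 1))\<^sup>2 * ((x - ?y) \<bullet> v i)\<^sup>2)"
      by (rule sum_distrib_left)
    also have "\<dots> \<le> (\<Sum>i<DIM('v). (s i)\<^sup>2 * (x \<bullet> v i)\<^sup>2)"
    proof (rule sum_mono)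
      fix i assume i: "i \<in> {..<DIM('v)}"
      then have ei: "(x - ?y) \<bullet> v i = (if i < k then x \<bullet> v i else 0)" using eq by simp
      show "(s (k - 1))\<^sup>2 * ((x - ?y) \<bullet> v i)\<^sup>2 \<le> (s i)\<^sup>2 * (x \<bullet> v i)\<^sup>2"
      proof (cases "i < k")
        case True
        then have "s (k - 1) \<le> s i" "0 \<le> s (k - 1)"
          using k svdD(5)[OF svd, of "k - 1"] svdD(6)[OF svd, of i "k - 1"] by (auto intro: less_imp_le)
        then have "(s (k - 1))\<^sup>2 * (x \<bullet> v i)\<^sup>2 \<le> (s i)\<^sup>2 * (x \<bullet> v i)\<^sup>2"
          by (intro mult_right_mono power_mono) auto
        then show ?thesis unfolding ei using True by simp
      next
        case False
        then show ?thesis unfolding ei by simp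
      qed
    qed
    finally show "(s (k - 1) * norm (x - ?y))\<^sup>2 \<le> (norm (g x))\<^sup>2" by (simp only: svd_norm[OF svd])
  qed simp
  moreover have "0 \<le> s (k - 1)" using svd_nonneg[OF svd] k by simp
  ultimately have "s (k - 1) * norm (x - oproj ?U x) \<le> norm (g x)"
    using mult_left_mono order_trans by blast
  then show ?thesis using sigma_svd[OF svd, of k] k by simp
qed

lemma sigma_inv_into: "1 \<le> k \<Longrightarrow> k \<le> DIM('v) \<Longrightarrow> sigma k (inv_into UNIV g) = 1 / sigma (DIM('v) + 1 - k) g"
proof (rule svd_obtain)
  fix v u s assume k: "1 \<le> k" "k \<le> DIM('v)" and svd: "svd g v u s"
  have "DIM('v) - 1 - (k - 1) = DIM('v) + 1 - k - 1" using k by simp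
  then show ?thesis
    using sigma_svd[OF svd_inv_into[OF svd bij] k] sigma_svd[OF svd, of "DIM('v) + 1 - k"] k by simp
qed

lemma sigma_scaleR:
  assumes "c \<noteq> 0" "1 \<le> k" "k \<le> DIM('v)" shows "sigma k (\<lambda>x. c *\<^sub>R g x) = \<bar>c\<bar> * sigma k g"
proof (rule svd_obtain)
  fix v u s assume svd: "svd g v u s"
  show ?thesis
    using sigma_svd[OF svd_scaleR[OF svd assms(1)] assms(2,3)] sigma_svd[OF svd assms(2,3)] by simp
qed

lemma axes_span_scaleR:
  assumes c: "c \<noteq> 0" and k: "1 \<le> k" "k \<le> DIM('v)" shows "axes_span k (\<lambda>x. c *\<^sub>R g x) = axes_span k g"
proof (rule svd_obtain)
  fix v u s assume svd: "svd g v u s"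
  have "span ((\<lambda>i. sgn c *\<^sub>R u i) ` I) = span (u ` I)" for I
  proof -
    have "(\<lambda>i. sgn c *\<^sub>R u i) ` I = (\<lambda>x. sgn c *\<^sub>R x) ` (u ` I)" by auto
    also have "span \<dots> = (\<lambda>x. sgn c *\<^sub>R x) ` span (u ` I)"
      by (rule linear_span_image) (simp add: linear_scale_self)
    also have "\<dots> = span (u ` I)"
    proof safe
      fix x assume "x \<in> span (u ` I)"
      then have "sgn c *\<^sub>R x \<in> span (u ` I)" by (rule span_scale)
      moreover have "x = sgn c *\<^sub>R (sgn c *\<^sub>R x)" using c by (simp add: sgn_if)
      ultimately show "x \<in> (\<lambda>x. sgn c *\<^sub>R x) ` span (u ` I)" by blast
    qed (rule span_scale)
    finally show ?thesis .
  qed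
  then show ?thesis using c k
    by (simp add: axes_span_svd[OF svd_scaleR[OF svd c]] axes_span_svd[OF svd])
qed

end

text \<open>Minimax argument. On the span of the \<open>v i\<close> with
  \<open>i \<ge> k - 1\<close> the map \<open>g\<close> stretches at most by
  \<open>sigma k g\<close>; on the span of the first \<open>k\<close> right singular vectors of
  \<open>A\<close> the map \<open>A\<close> stretches at least by \<open>sigma k A\<close>. The
  dimensions \<open>d - k + 1\<close> and \<open>k\<close> add up to more than \<open>d\<close>, so
  the first space meets the image of the second under \<open>h2\<close> in a nonzero vector, on
  which the bounds are compared.\<close>

lemma sigma_comp_le:
  fixes A g h1 h2 :: "'v::euclidean_space \<Rightarrow> 'v"
  assumes g: "linear g" "bij g" and A: "linear A" "bij A"
    and h2: "linear h2" "bij h2" and eq: "\<And>x. A x = h1 (g (h2 x))"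
    and k: "1 \<le> k" "k \<le> DIM('v)" and a: "\<And>x. norm (h1 x) \<le> a * norm x" and b: "\<And>x. norm (h2 x) \<le> b * norm x"
    and nn: "0 \<le> a" "0 \<le> b"
  shows "sigma k A \<le> a * b * sigma k g"
proof -
  obtain v u s where svd: "svd g v u s" using svd_obtain[OF g] by blast
  obtain v' u' s' where svd': "svd A v' u' s'" using svd_obtain[OF A] by blast
  let ?P = "span (v ` {k-1..<DIM('v)})" and ?Q = "h2 ` span (v' ` {..<k})"
  have dP: "dim ?P = DIM('v) - (k - 1)"
    by (subst dim_span_orthonormal_seq[OF svdD(2)[OF svd]]) auto
  have "dim ?Q = dim (span (v' ` {..<k}))"
    using h2 by (intro dim_image_eq) (auto intro: inj_on_subset bij_is_inj)
  also have "\<dots> = k" using dim_span_orthonormal_seq[OF svdD(2)[OF svd'], of "{..<k}"] k by simp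
  finally have dQ: "dim ?Q = k" .
  have sQ: "subspace ?Q" using h2 by (intro linear_subspace_image) auto
  have "dim (?P \<inter> ?Q) + dim {x + y |x y. x \<in> ?P \<and> y \<in> ?Q} = dim ?P + dim ?Q"
    using dim_sums_Int[OF subspace_span sQ, of "v ` {k-1..<DIM('v)}"] by simp
  moreover have "dim {x + y |x y. x \<in> ?P \<and> y \<in> ?Q} \<le> DIM('v)" by (rule dim_subset_UNIV)
  ultimately have "dim (?P \<inter> ?Q) \<noteq> 0" using dP dQ k by linarith
  then obtain y where y: "y \<in> ?P" "y \<in> ?Q" "y \<noteq> 0"
    by (metis IntE dim_eq_0 singleton_iff subsetI)
  then obtain x where x: "x \<in> span (v' ` {..<k})" "y = h2 x" by blast
  have x0: "x \<noteq> 0" using y(3) x(2) linear_0[OF h2(1)] by auto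
  have "x \<bullet> v' i = 0" if "i < DIM('v)" "\<not> i < k" for i
  proof -
    have "{..<k} \<subseteq> {..<DIM('v)}" using k by auto
    then show ?thesis using that x(1) span_orthonormal_seq_iff[OF svdD(2)[OF svd'], of "{..<k}" x] by auto
  qed
  then have 1: "s' (k - 1) * norm x \<le> norm (A x)"
  proof (intro svd_norm_ge[OF svd'])
    show "0 \<le> s' (k - 1)" by (rule svd_nonneg[OF svd' k])
    fix i assume "i < DIM('v)" "x \<bullet> v' i \<noteq> 0"
    then have "i < k" using \<open>\<And>i. i < DIM('v) \<Longrightarrow> \<not> i < k \<Longrightarrow> x \<bullet> v' i = 0\<close> by blast
    then show "s' (k - 1) \<le> s' i" using k by (intro svdD(6)[OF svd']) auto
  qed
  have "y \<bullet> v i = 0" if "i < DIM('v)" "i < k - 1" for i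
  proof -
    have "{k-1..<DIM('v)} \<subseteq> {..<DIM('v)}" by auto
    then show ?thesis using that y(1) span_orthonormal_seq_iff[OF svdD(2)[OF svd], of "{k-1..<DIM('v)}" y] by auto
  qed
  then have 2: "norm (g y) \<le> s (k - 1) * norm y"
  proof (intro svd_norm_le[OF svd])
    show "0 \<le> s (k - 1)" by (rule svd_nonneg[OF svd k])
    fix i assume i: "i < DIM('v)" "y \<bullet> v i \<noteq> 0"
    then have "\<not> i < k - 1" using \<open>\<And>i. i < DIM('v) \<Longrightarrow> i < k - 1 \<Longrightarrow> y \<bullet> v i = 0\<close> by blast
    then show "s i \<le> s (k - 1)" using i by (intro svdD(6)[OF svd]) auto
  qed
  have "s' (k - 1) * norm x \<le> a * norm (g y)" using 1 a[of "g y"] eq[of x] x(2) by simp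
  also have "\<dots> \<le> a * (s (k - 1) * (b * norm x))"
  proof (rule mult_left_mono[OF order_trans[OF 2]])
    show "s (k - 1) * norm y \<le> s (k - 1) * (b * norm x)"
      using b[of x] x(2) svd_nonneg[OF svd k] by (intro mult_left_mono) auto
  qed fact
  finally have "s' (k - 1) * norm x \<le> (a * b * s (k - 1)) * norm x" by (simp add: mult_ac)
  then show ?thesis using x0 k by (simp add: sigma_svd[OF svd] sigma_svd[OF svd'])
qed

text \<open>A vector \<open>w\<close> of the leading axes of \<open>g\<close> is \<open>g t\<close>
  with \<open>t\<close> short, and \<open>h1 w = A (h2' t)\<close> is within
  \<open>sigma (k + 1) A\<close> times the norm of \<open>h2' t\<close> of the leading axes of
  \<open>A\<close>. Bounding \<open>1 / sigma k g\<close> by a multiple of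
  \<open>1 / sigma k A\<close> leaves only the singular value ratio of \<open>A\<close>, which the
  gap hypothesis makes small.\<close>

lemma axes_span_comp_close:
  fixes A g h1 h2 h2' :: "'v::euclidean_space \<Rightarrow> 'v"
  assumes g: "linear g" "bij g" and A: "linear A" "bij A"
    and h2: "linear h2" "bij h2" "\<And>x. h2 (h2' x) = x" and eq: "\<And>x. A x = h1 (g (h2 x))"
    and k: "1 \<le> k" "k < DIM('v)"
    and a: "\<And>x. norm (h1 x) \<le> a * norm x" and b: "\<And>x. norm (h2 x) \<le> b * norm x"
    and b': "\<And>x. norm (h2' x) \<le> b' * norm x" and nn: "0 \<le> a" "0 \<le> b" "0 \<le> b'"
    and w: "w \<in> axes_span k g"
  shows "norm (h1 w - oproj (axes_span k A) (h1 w)) \<le> a * b * b' * (sigma (k + 1) A / sigma k A) * norm w"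
proof -
  have kd: "k \<le> DIM('v)" using k by simp
  have sg: "0 < sigma k g" by (rule sigma_pos[OF g k(1) kd])
  have sA: "0 < sigma k A" by (rule sigma_pos[OF A k(1) kd])
  have sA': "0 < sigma (k + 1) A" by (rule sigma_pos[OF A]) (use k in auto)
  obtain t where t: "w = g t" using g(2) by (metis bij_pointE)
  have nt: "sigma k g * norm t \<le> norm w" using axes_span_preimage_norm[OF g k(1) kd] w t by simp
  have hw: "h1 w = A (h2' t)" by (simp add: eq h2(3) t)
  have "norm (h1 w - oproj (axes_span k A) (h1 w)) \<le> sigma (k + 1) A * norm (h2' t)"
    unfolding hw by (rule norm_diff_axes_span_le[OF A k])
  also have "\<dots> \<le> sigma (k + 1) A * (b' * norm t)" using sA' by (intro mult_left_mono b') auto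
  also have "\<dots> \<le> sigma (k + 1) A * (b' * (norm w / sigma k g))"
    using nt sg sA' nn by (intro mult_left_mono) (auto simp: pos_le_divide_eq mult.commute)
  also have "\<dots> = (sigma (k + 1) A * b' * norm w) * (1 / sigma k g)" by simp
  also have "\<dots> \<le> (sigma (k + 1) A * b' * norm w) * (a * b / sigma k A)"
  proof (rule mult_left_mono)
    have "sigma k A \<le> a * b * sigma k g"
      by (rule sigma_comp_le[OF g A h2(1,2) eq k(1) kd a b nn(1,2)])
    then show "1 / sigma k g \<le> a * b / sigma k A" using sg sA by (simp add: field_simps)
  qed (use sA' nn in auto)
  finally show ?thesis by (simp add: mult_ac)
qed

section \<open>Word metrics and geodesic rays\<close>

locale word_metric = group G for G :: "('g, 'b) monoid_scheme" (structure) +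
  fixes S :: "'g set"
  assumes gen: "symmetric_generating_set G S"
begin

abbreviation len :: "'g \<Rightarrow> nat" where "len \<equiv> word_length G S"
abbreviation wd :: "'g \<Rightarrow> 'g \<Rightarrow> real" where "wd \<equiv> word_dist G S"
abbreviation word_prod :: "'g list \<Rightarrow> 'g" where "word_prod w \<equiv> foldr (\<otimes>) w \<one>"

lemma finite_gen: "finite S" and gen_carrier: "S \<subseteq> carrier G"
  and gen_inv: "s \<in> S \<Longrightarrow> inv s \<in> S" and gen_generates: "generate G S = carrier G"
  using gen by (auto simp: symmetric_generating_set_def)

lemma word_prod_closed: "set w \<subseteq> S \<Longrightarrow> word_prod w \<in> carrier G"
  using gen_carrier by (induction w) auto

lemma word_prod_append:
  "set w \<subseteq> S \<Longrightarrow> set w' \<subseteq> S \<Longrightarrow> word_prod (w @ w') = word_prod w \<otimes> word_prod w'"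
proof (induction w)
  case (Cons a w)
  then have "a \<in> carrier G" using gen_carrier by auto
  then show ?case using Cons word_prod_closed[of w] word_prod_closed[of w'] by (simp add: m_assoc)
qed (simp add: word_prod_closed)

lemma word_exists:
  assumes "g \<in> carrier G"
  shows "\<exists>w. set w \<subseteq> S \<and> word_prod w = g"
proof -
  have "g \<in> generate G S" using assms gen_generates by simp
  then show ?thesis
  proof (induction rule: generate.induct)
    case one
    show ?case by (rule exI[of _ "[]"]) simp
  next
    case (incl h)
    then show ?case using gen_carrier by (intro exI[of _ "[h]"]) auto
  next
    case (inv h)
    then show ?case using gen_carrier gen_inv by (intro exI[of _ "[inv h]"]) auto
  next
    case (eng h1 h2)
    then obtain w1 w2 where "set w1 \<subseteq> S" "word_prod w1 = h1" "set w2 \<subseteq> S" "word_prod w2 = h2" by blast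
    then show ?case by (intro exI[of _ "w1 @ w2"]) (simp only: word_prod_append set_append Un_least simp_thms)
  qed
qed

lemma len_word: "g \<in> carrier G \<Longrightarrow> \<exists>w. set w \<subseteq> S \<and> length w = len g \<and> word_prod w = g"
  unfolding word_length_def by (rule LeastI_ex) (use word_exists in blast)

lemma len_le: "set w \<subseteq> S \<Longrightarrow> len (word_prod w) \<le> length w"
  unfolding word_length_def by (rule Least_le) blast

lemma len_one [simp]: "len \<one> = 0"
  using len_le[of "[]"] by simp

lemma len_mult: "g \<in> carrier G \<Longrightarrow> h \<in> carrier G \<Longrightarrow> len (g \<otimes> h) \<le> len g + len h"
proof -
  assume "g \<in> carrier G" "h \<in> carrier G"
  then obtain w w' where w: "set w \<subseteq> S" "length w = len g" "word_prod w = g"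
    "set w' \<subseteq> S" "length w' = len h" "word_prod w' = h"
    using len_word by metis
  then show ?thesis using len_le[of "w @ w'"] by (simp only: word_prod_append set_append Un_least length_append)
qed

lemma len_inv_le: "g \<in> carrier G \<Longrightarrow> len (inv g) \<le> len g"
proof -
  have "\<exists>w'. set w' \<subseteq> S \<and> length w' = length w \<and> word_prod w' = inv (word_prod w)" if "set w \<subseteq> S" for w
    using that
  proof (induction w)
    case (Cons a w)
    then obtain w' where w': "set w' \<subseteq> S" "length w' = length w" "word_prod w' = inv (word_prod w)" by auto
    have a: "a \<in> S" "a \<in> carrier G" using Cons.prems gen_carrier by auto
    have "word_prod (w' @ [inv a]) = inv (word_prod w) \<otimes> word_prod [inv a]"
      using w' a gen_inv by (subst word_prod_append) auto
    also have "\<dots> = inv (word_prod (a # w))"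
      using a Cons.prems word_prod_closed[of w] by (simp add: inv_mult_group)
    finally show ?case using w' a gen_inv by (intro exI[of _ "w' @ [inv a]"]) auto
  qed simp
  then show "g \<in> carrier G \<Longrightarrow> len (inv g) \<le> len g"
    using len_word[of g] len_le by metis
qed

lemma len_inv: "g \<in> carrier G \<Longrightarrow> len (inv g) = len g"
  using len_inv_le[of g] len_inv_le[of "inv g"] by simp

text \<open>Local finiteness of the Cayley graph. It is behind the bound on \<open>cond\<close> over
  balls, the compactness of the space of based rays and the extraction of limits of
  configurations.\<close>

lemma finite_len_le: "finite {g \<in> carrier G. len g \<le> n}"
proof (rule finite_subset)
  show "{g \<in> carrier G. len g \<le> n} \<subseteq> word_prod ` {w. set w \<subseteq> S \<and> length w \<le> n}"
  proof
    fix g assume g: "g \<in> {g \<in> carrier G. len g \<le> n}"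
    then obtain w where "set w \<subseteq> S" "length w = len g" "word_prod w = g" using len_word by blast
    then show "g \<in> word_prod ` {w. set w \<subseteq> S \<and> length w \<le> n}" using g by force
  qed
  show "finite (word_prod ` {w. set w \<subseteq> S \<and> length w \<le> n})"
    by (intro finite_imageI finite_lists_length_le finite_gen)
qed

lemma wd_one: "g \<in> carrier G \<Longrightarrow> wd \<one> g = len g"
  by (simp add: word_dist_def)

lemma wd_nonneg: "0 \<le> wd g h" by (simp add: word_dist_def)

lemma wd_self: "g \<in> carrier G \<Longrightarrow> wd g g = 0" by (simp add: word_dist_def)

lemma wd_commute: "g \<in> carrier G \<Longrightarrow> h \<in> carrier G \<Longrightarrow> wd g h = wd h g"
  using len_inv[of "inv g \<otimes> h"] by (simp add: word_dist_def inv_mult_group)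

lemma wd_triangle:
  "g \<in> carrier G \<Longrightarrow> h \<in> carrier G \<Longrightarrow> k \<in> carrier G \<Longrightarrow> wd g k \<le> wd g h + wd h k"
proof -
  assume a: "g \<in> carrier G" "h \<in> carrier G" "k \<in> carrier G"
  have "(inv g \<otimes> h) \<otimes> (inv h \<otimes> k) = inv g \<otimes> ((h \<otimes> inv h) \<otimes> k)"
    using a by (simp only: m_assoc inv_closed m_closed)
  also have "\<dots> = inv g \<otimes> k" using a by simp
  finally have "inv g \<otimes> k = (inv g \<otimes> h) \<otimes> (inv h \<otimes> k)" ..
  then show ?thesis using len_mult[of "inv g \<otimes> h" "inv h \<otimes> k"] a by (simp add: word_dist_def flip: of_nat_add)
qed

lemma wd_left_mult:
  "k \<in> carrier G \<Longrightarrow> g \<in> carrier G \<Longrightarrow> h \<in> carrier G \<Longrightarrow> wd (k \<otimes> g) (k \<otimes> h) = wd g h"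
proof -
  assume a: "k \<in> carrier G" "g \<in> carrier G" "h \<in> carrier G"
  have "inv (k \<otimes> g) \<otimes> (k \<otimes> h) = inv g \<otimes> (inv k \<otimes> k \<otimes> h)"
    using a by (simp only: inv_mult_group m_assoc inv_closed m_closed)
  also have "\<dots> = inv g \<otimes> h" using a by simp
  finally have "inv (k \<otimes> g) \<otimes> (k \<otimes> h) = inv g \<otimes> h" .
  then show ?thesis by (simp add: word_dist_def)
qed

lemma len_diff_le_wd:
  "g \<in> carrier G \<Longrightarrow> h \<in> carrier G \<Longrightarrow> \<bar>real (len g) - real (len h)\<bar> \<le> wd g h"
  using wd_triangle[of \<one> g h] wd_triangle[of \<one> h g] wd_commute[of g h] by (simp add: wd_one)

abbreviation ray :: "(nat \<Rightarrow> 'g) \<Rightarrow> bool" where "ray \<equiv> geodesic_ray G S"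
abbreviation endpt :: "(nat \<Rightarrow> 'g) \<Rightarrow> (nat \<Rightarrow> 'g) set" where "endpt \<equiv> ray_endpoint G S"

lemma ray_carrier: "ray \<gamma> \<Longrightarrow> \<gamma> n \<in> carrier G"
  and ray_wd: "ray \<gamma> \<Longrightarrow> wd (\<gamma> m) (\<gamma> n) = \<bar>real m - real n\<bar>"
  by (auto simp: geodesic_ray_def)

lemma ray_len: "ray \<gamma> \<Longrightarrow> \<gamma> 0 = \<one> \<Longrightarrow> len (\<gamma> n) = n"
  using ray_wd[of \<gamma> 0 n] wd_one[OF ray_carrier, of \<gamma> n] by simp

lemma ray_len_ge: "ray \<gamma> \<Longrightarrow> real n - real (len (\<gamma> 0)) \<le> len (\<gamma> n)"
  using len_diff_le_wd[of "\<gamma> n" "\<gamma> 0"] len_diff_le_wd[of "\<gamma> 0" "\<gamma> n"] wd_triangle[of "\<gamma> 0" \<one> "\<gamma> n"] 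
    ray_wd[of \<gamma> 0 n] wd_one[OF ray_carrier, of \<gamma> n] wd_one[OF ray_carrier, of \<gamma> 0]
    wd_commute[OF ray_carrier one_closed, of \<gamma> 0]
  by (simp add: ray_carrier)

lemma ray_translate: "ray \<gamma> \<Longrightarrow> g \<in> carrier G \<Longrightarrow> ray (\<lambda>n. g \<otimes> \<gamma> n)"
  by (simp add: geodesic_ray_def wd_left_mult)

lemma ray_shift: "ray \<gamma> \<Longrightarrow> ray (\<lambda>n. \<gamma> (k + n))"
  by (simp add: geodesic_ray_def)

lemma ray_mem_endpt: "ray \<gamma> \<Longrightarrow> \<gamma> \<in> endpt \<gamma>"
  by (auto simp: ray_endpoint_def wd_self ray_carrier)

lemma mem_endpt_iff:
  "\<beta> \<in> endpt \<alpha> \<longleftrightarrow> ray \<beta> \<and> (\<exists>C. \<forall>n. wd (\<alpha> n) (\<beta> n) \<le> C)"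
  by (simp add: ray_endpoint_def)

lemma endpt_eqI:
  assumes a: "ray \<alpha>" and b: "ray \<beta>" and C: "\<And>n. wd (\<alpha> n) (\<beta> n) \<le> C"
  shows "endpt \<alpha> = endpt \<beta>"
proof -
  have le: "wd (\<beta> n) (\<gamma> n) \<le> C + D" if "ray \<gamma>" "\<And>n. wd (\<alpha> n) (\<gamma> n) \<le> D" for \<gamma> D n
    using wd_triangle[of "\<beta> n" "\<alpha> n" "\<gamma> n"] C[of n] that(2)[of n] wd_commute[of "\<alpha> n" "\<beta> n"]
      ray_carrier a b that(1) by simp
  have le': "wd (\<alpha> n) (\<gamma> n) \<le> C + D" if "ray \<gamma>" "\<And>n. wd (\<beta> n) (\<gamma> n) \<le> D" for \<gamma> D n
    using wd_triangle[of "\<alpha> n" "\<beta> n" "\<gamma> n"] C[of n] that(2)[of n]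
      ray_carrier a b that(1) by simp
  show ?thesis unfolding ray_endpoint_def using le le' by blast
qed

lemma endpt_eq_iff:
  assumes "ray \<alpha>" "ray \<beta>"
  shows "endpt \<alpha> = endpt \<beta> \<longleftrightarrow> (\<exists>C. \<forall>n. wd (\<alpha> n) (\<beta> n) \<le> C)"
  using endpt_eqI[OF assms] ray_mem_endpt[OF assms(2)] assms by (metis mem_endpt_iff)

lemma endpt_shift: "ray \<gamma> \<Longrightarrow> endpt (\<lambda>n. \<gamma> (k + n)) = endpt \<gamma>"
  by (rule endpt_eqI[where C = k]) (auto simp: ray_wd ray_shift)

lemma endpt_boundary: "ray \<gamma> \<Longrightarrow> endpt \<gamma> \<in> boundary_points G S"
  by (auto simp: boundary_points_def)

lemma boundary_cases:
  assumes "x \<in> boundary_points G S" obtains \<gamma> where "ray \<gamma>" "x = endpt \<gamma>"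
  using assms by (auto simp: boundary_points_def)

lemma ray_step: "ray \<gamma> \<Longrightarrow> wd (\<gamma> n) (\<gamma> (Suc n)) \<le> 1" by (simp add: ray_wd)

end

locale hyperbolic_group = word_metric +
  assumes hyp: "word_hyperbolic G S"
begin

text \<open>The Gromov product of \<open>\<alpha> m\<close> and \<open>\<alpha> n\<close> at the
  identity is \<open>m\<close>, likewise for \<open>\<beta>\<close>, and that of
  \<open>\<alpha> n\<close> and \<open>\<beta> n\<close> is at least \<open>n - D / 2\<close>.
  Passing from \<open>\<alpha> m\<close> through \<open>\<alpha> n\<close> and
  \<open>\<beta> n\<close> to \<open>\<beta> m\<close> uses the four-point condition twice, which
  loses \<open>2 * \<delta>\<close> in the product and so \<open>4 * \<delta>\<close> in the
  distance.\<close>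

lemma rays_fellow_travel:
  obtains \<kappa> where "0 \<le> \<kappa>"
    "\<And>\<alpha> \<beta> n m D. ray \<alpha> \<Longrightarrow> ray \<beta> \<Longrightarrow> \<alpha> 0 = \<one> \<Longrightarrow> \<beta> 0 = \<one> \<Longrightarrow> wd (\<alpha> n) (\<beta> n) \<le> D \<Longrightarrow>
       real m \<le> real n - D / 2 \<Longrightarrow> wd (\<alpha> m) (\<beta> m) \<le> \<kappa>"
proof -
  obtain \<delta>0 where \<delta>0: "\<And>x y z. x \<in> carrier G \<Longrightarrow> y \<in> carrier G \<Longrightarrow> z \<in> carrier G \<Longrightarrow>
      min (gromov_product G S \<one> x y) (gromov_product G S \<one> y z) - \<delta>0 \<le> gromov_product G S \<one> x z"
    using hyp unfolding word_hyperbolic_def by blast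
  \<comment> \<open>Nonnegativity makes \<open>real m - \<delta>\<close> the smaller term in the
    second use of the four-point condition.\<close>
  define \<delta> where "\<delta> = max 0 \<delta>0"
  have \<delta>: "min (gromov_product G S \<one> x y) (gromov_product G S \<one> y z) - \<delta> \<le> gromov_product G S \<one> x z"
    if "x \<in> carrier G" "y \<in> carrier G" "z \<in> carrier G" for x y z
    using \<delta>0[OF that] by (simp add: \<delta>_def)
  show ?thesis
  proof (rule that[of "4 * \<delta>"])
    show "0 \<le> 4 * \<delta>" by (simp add: \<delta>_def)
    fix \<alpha> \<beta> n m D
    assume a: "ray \<alpha>" "ray \<beta>" "\<alpha> 0 = \<one>" "\<beta> 0 = \<one>" and D: "wd (\<alpha> n) (\<beta> n) \<le> D" "real m \<le> real n - D / 2"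
    have mn: "m \<le> n" using D wd_nonneg[of "\<alpha> n" "\<beta> n"] by linarith
    have gp: "gromov_product G S \<one> (\<alpha> m) (\<alpha> n) = m" "gromov_product G S \<one> (\<beta> n) (\<beta> m) = m"
      using a mn by (simp_all add: gromov_product_def wd_one ray_carrier ray_len ray_wd)
    have 1: "gromov_product G S \<one> (\<alpha> n) (\<beta> n) \<ge> m"
      using a D by (simp add: gromov_product_def wd_one ray_carrier ray_len)
    have 2: "real m - \<delta> \<le> gromov_product G S \<one> (\<alpha> m) (\<beta> n)"
      using \<delta>[of "\<alpha> m" "\<alpha> n" "\<beta> n"] a gp 1 by (simp add: ray_carrier)
    have "real m - 2 * \<delta> \<le> gromov_product G S \<one> (\<alpha> m) (\<beta> m)"
      using \<delta>[of "\<alpha> m" "\<beta> n" "\<beta> m"] a gp 2 by (simp add: ray_carrier \<delta>_def)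
    then show "wd (\<alpha> m) (\<beta> m) \<le> 4 * \<delta>"
      using a by (simp add: gromov_product_def wd_one ray_carrier ray_len field_simps)
  qed
qed

text \<open>\<open>T + 1\<close> is the first time at which the rays are more than
  \<open>\<kappa>\<close> apart. If their distance at a later time \<open>n\<close> were below
  \<open>2 * (n - T - 1)\<close>, fellow travelling back to time \<open>T + 1\<close> would
  contradict this. The same \<open>\<kappa>\<close> bounds rays with a common endpoint and defines
  the separation time, so that rays with nearby endpoints separate late.\<close>

lemma rays_separation:
  obtains \<kappa> where "0 \<le> \<kappa>"
    "\<And>\<alpha> \<beta> m. ray \<alpha> \<Longrightarrow> ray \<beta> \<Longrightarrow> \<alpha> 0 = \<one> \<Longrightarrow> \<beta> 0 = \<one> \<Longrightarrow> endpt \<alpha> = endpt \<beta> \<Longrightarrow> wd (\<alpha> m) (\<beta> m) \<le> \<kappa>"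
    "\<And>\<alpha> \<beta>. ray \<alpha> \<Longrightarrow> ray \<beta> \<Longrightarrow> \<alpha> 0 = \<one> \<Longrightarrow> \<beta> 0 = \<one> \<Longrightarrow> endpt \<alpha> \<noteq> endpt \<beta> \<Longrightarrow>
      \<exists>T. (\<forall>m\<le>T. wd (\<alpha> m) (\<beta> m) \<le> \<kappa>) \<and> \<kappa> < wd (\<alpha> (Suc T)) (\<beta> (Suc T)) \<and>
        (\<forall>n>T. 2 * (real n - real T - 1) \<le> wd (\<alpha> n) (\<beta> n))"
proof -
  obtain \<kappa> where k0: "0 \<le> \<kappa>" and
    ft: "\<And>\<alpha> \<beta> n m D. ray \<alpha> \<Longrightarrow> ray \<beta> \<Longrightarrow> \<alpha> 0 = \<one> \<Longrightarrow> \<beta> 0 = \<one> \<Longrightarrow> wd (\<alpha> n) (\<beta> n) \<le> D \<Longrightarrow>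
       real m \<le> real n - D / 2 \<Longrightarrow> wd (\<alpha> m) (\<beta> m) \<le> \<kappa>"
    using rays_fellow_travel by blast
  show ?thesis
  proof (rule that[OF k0])
    fix \<alpha> \<beta> m assume a: "ray \<alpha>" "ray \<beta>" "\<alpha> 0 = \<one>" "\<beta> 0 = \<one>" "endpt \<alpha> = endpt \<beta>"
    then obtain C where C: "\<And>n. wd (\<alpha> n) (\<beta> n) \<le> C" by (auto simp: endpt_eq_iff)
    obtain n where "real m + C / 2 \<le> real n" using real_arch_simple by blast
    then show "wd (\<alpha> m) (\<beta> m) \<le> \<kappa>" by (intro ft[OF a(1-4) C[of n]]) simp
  next
    fix \<alpha> \<beta> assume a: "ray \<alpha>" "ray \<beta>" "\<alpha> 0 = \<one>" "\<beta> 0 = \<one>" "endpt \<alpha> \<noteq> endpt \<beta>"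
    then have ex: "\<exists>n. \<kappa> < wd (\<alpha> n) (\<beta> n)" by (auto simp: endpt_eq_iff not_le)
    define T where "T = (LEAST n. \<kappa> < wd (\<alpha> n) (\<beta> n)) - 1"
    have T0: "(LEAST n. \<kappa> < wd (\<alpha> n) (\<beta> n)) \<noteq> 0"
    proof
      assume "(LEAST n. \<kappa> < wd (\<alpha> n) (\<beta> n)) = 0"
      then have "\<kappa> < wd (\<alpha> 0) (\<beta> 0)" using LeastI_ex[OF ex] by simp
      then show False using a k0 by (simp add: wd_self)
    qed
    then have T: "Suc T = (LEAST n. \<kappa> < wd (\<alpha> n) (\<beta> n))" by (simp add: T_def)
    have sep: "\<kappa> < wd (\<alpha> (Suc T)) (\<beta> (Suc T))" unfolding T by (rule LeastI_ex[OF ex])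
    show "\<exists>T. (\<forall>m\<le>T. wd (\<alpha> m) (\<beta> m) \<le> \<kappa>) \<and> \<kappa> < wd (\<alpha> (Suc T)) (\<beta> (Suc T)) \<and>
        (\<forall>n>T. 2 * (real n - real T - 1) \<le> wd (\<alpha> n) (\<beta> n))"
    proof (rule exI[of _ T], intro conjI allI impI)
      fix m assume "m \<le> T"
      then show "wd (\<alpha> m) (\<beta> m) \<le> \<kappa>" using not_less_Least[of m "\<lambda>n. \<kappa> < wd (\<alpha> n) (\<beta> n)"] T by simp
    next
      fix n assume n: "T < n"
      show "2 * (real n - real T - 1) \<le> wd (\<alpha> n) (\<beta> n)"
      proof (rule ccontr)
        assume "\<not> 2 * (real n - real T - 1) \<le> wd (\<alpha> n) (\<beta> n)"
        then have "wd (\<alpha> (Suc T)) (\<beta> (Suc T)) \<le> \<kappa>"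
          by (intro ft[OF a(1-4), of n "2 * (real n - real T - 1)"]) (auto simp: field_simps)
        then show False using sep by simp
      qed
    qed (fact sep)
  qed
qed

text \<open>Both points are moved along their rays to the common time \<open>max n k\<close>, where
  the linear divergence after separation applies. Up to time \<open>T\<close> the bound is trivial,
  since then \<open>n + k\<close> is at most \<open>2 * T\<close>.\<close>

lemma rays_diverge:
  assumes a: "ray \<alpha>" "ray \<beta>" "\<alpha> 0 = \<one>" "\<beta> 0 = \<one>" "endpt \<alpha> \<noteq> endpt \<beta>"
  obtains c where "\<And>n k. real n + real k - c \<le> wd (\<beta> n) (\<alpha> k)"
proof -
  obtain T where T: "\<forall>n>T. 2 * (real n - real T - 1) \<le> wd (\<alpha> n) (\<beta> n)"
    using rays_separation a by metis
  show ?thesis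
  proof (rule that[of "2 * (real T + 1)"])
    fix n k :: nat
    let ?m = "max n k"
    show "real n + real k - 2 * (real T + 1) \<le> wd (\<beta> n) (\<alpha> k)"
    proof (cases "T < ?m")
      case True
      have "wd (\<alpha> ?m) (\<beta> ?m) \<le> wd (\<beta> ?m) (\<beta> n) + wd (\<beta> n) (\<alpha> k) + wd (\<alpha> k) (\<alpha> ?m)"
        using wd_triangle[of "\<beta> ?m" "\<beta> n" "\<alpha> ?m"] wd_triangle[of "\<beta> n" "\<alpha> k" "\<alpha> ?m"] wd_commute[of "\<alpha> ?m" "\<beta> ?m"]
        by (simp add: ray_carrier a)
      moreover have "wd (\<beta> ?m) (\<beta> n) = real ?m - real n" "wd (\<alpha> k) (\<alpha> ?m) = real ?m - real k"
        using a by (auto simp: ray_wd)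
      ultimately show ?thesis using T True by fastforce
    next
      case False
      then show ?thesis using wd_nonneg[of "\<beta> n" "\<alpha> k"] by auto
    qed
  qed
qed

end

text \<open>Diagonal argument, with constant subsequences supplied by the pigeonhole principle.
  Values are discrete, so convergence at an index means eventual equality.\<close>

lemma pointwise_convergent_subsequence:
  fixes f :: "nat \<Rightarrow> nat \<Rightarrow> 'a"
  assumes fin: "\<And>j. finite (range (\<lambda>n. f n j))"
  obtains \<phi> F where "strict_mono (\<phi> :: nat \<Rightarrow> nat)" "\<And>j. \<forall>\<^sub>F n in sequentially. f (\<phi> n) j = F j"
proof -
  define P where "P j (\<phi> :: nat \<Rightarrow> nat) \<longleftrightarrow> (\<exists>c. \<forall>\<^sub>F n in sequentially. f (\<phi> n) j = c)" for j \<phi>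
  interpret subseqs P
  proof
    fix j and \<phi> :: "nat \<Rightarrow> nat" assume \<phi>: "strict_mono \<phi>"
    have "finite (range (\<lambda>n. f (\<phi> n) j))" by (rule finite_subset[OF _ fin[of j]]) auto
    then obtain n0 where inf: "infinite {n. f (\<phi> n) j = f (\<phi> n0) j}"
      using pigeonhole_infinite[of UNIV "\<lambda>n. f (\<phi> n) j"] by auto
    then obtain r :: "nat \<Rightarrow> nat" where "strict_mono r" "\<And>n. r n \<in> {n. f (\<phi> n) j = f (\<phi> n0) j}"
      using infinite_enumerate by blast
    then show "\<exists>r. strict_mono r \<and> P j (\<phi> \<circ> r)"
      unfolding P_def by (intro exI[of _ r]) (auto intro!: exI[of _ "f (\<phi> n0) j"])
  qed
  have "P j diagseq" for j
  proof -
    \<comment> \<open>The diagonal sequence refines the stage for \<open>j\<close> only from some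
      index on; the shift by \<open>Suc j\<close> is harmless because \<open>P j\<close> concerns
      tails.\<close>
    have "P j (diagseq \<circ> ((+) (Suc j)))"
    proof (rule diagseq_holds)
      fix n s and r :: "nat \<Rightarrow> nat" assume r: "strict_mono r" and "P n s"
      then obtain c where c: "\<forall>\<^sub>F m in sequentially. f (s m) n = c" by (auto simp: P_def)
      have "\<forall>\<^sub>F m in sequentially. f (s (r m)) n = c"
        using eventually_subseq[OF r c] .
      then show "P n (s \<circ> r)" by (auto simp: P_def)
    qed
    then obtain c N where "\<And>n. n \<ge> N \<Longrightarrow> f (diagseq (Suc j + n)) j = c"
      by (auto simp: P_def eventually_sequentially)
    note N = this
    have "f (diagseq n) j = c" if "n \<ge> N + Suc j" for n
      using N[of "n - Suc j"] that by simp
    then show ?thesis unfolding P_def eventually_sequentially by blast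
  qed
  then have "\<forall>\<^sub>F n in sequentially. f (diagseq n) j = (SOME c. \<forall>\<^sub>F n in sequentially. f (diagseq n) j = c)" for j
    unfolding P_def by (rule someI_ex)
  then show ?thesis by (rule that[OF subseq_diagseq])
qed

section \<open>Projective representations and attracting spaces\<close>

locale proj_rep = word_metric G S for G :: "('g, 'b) monoid_scheme" (structure) and S +
  fixes \<rho> :: "'g \<Rightarrow> ('v::euclidean_space \<Rightarrow> 'v) set"
  assumes hom: "\<rho> \<in> hom G PGL"
begin

lemma rep_rcoset: 
  assumes "\<gamma> \<in> carrier G"
  obtains a where "linear a" "bij a" "\<rho> \<gamma> = (\<lambda>c x. c *\<^sub>R a x) ` {c. c \<noteq> 0}"
proof -
  have "\<rho> \<gamma> \<in> carrier (PGL :: ('v \<Rightarrow> 'v) set monoid)" using hom assms by (auto simp: hom_def)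
  then obtain a where a: "a \<in> carrier (GL :: ('v \<Rightarrow> 'v) monoid)" "\<rho> \<gamma> = homotheties #>\<^bsub>GL\<^esub> a"
    by (auto simp: PGL_def FactGroup_def RCOSETS_def)
  have "\<rho> \<gamma> = (\<lambda>c x. c *\<^sub>R a x) ` {c. c \<noteq> 0}"
    unfolding a(2) r_coset_def GL_def homotheties_def by (auto simp: fun_eq_iff image_iff)
  then show ?thesis using that a(1) by (auto simp: GL_def)
qed

lemma rep_exists: "\<gamma> \<in> carrier G \<Longrightarrow> \<exists>g. g \<in> \<rho> \<gamma>"
  by (rule rep_rcoset) (auto intro!: exI[of _ 1])

lemma rep_linear: "\<gamma> \<in> carrier G \<Longrightarrow> g \<in> \<rho> \<gamma> \<Longrightarrow> linear g"
  by (rule rep_rcoset) (auto simp: linear_compose_scale_right)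

lemma rep_scale: "\<gamma> \<in> carrier G \<Longrightarrow> g \<in> \<rho> \<gamma> \<Longrightarrow> g' \<in> \<rho> \<gamma> \<Longrightarrow> \<exists>c. c \<noteq> 0 \<and> g' = (\<lambda>x. c *\<^sub>R g x)"
proof -
  assume "\<gamma> \<in> carrier G" "g \<in> \<rho> \<gamma>" "g' \<in> \<rho> \<gamma>"
  then obtain a c c' where "c \<noteq> 0" "c' \<noteq> 0" "g = (\<lambda>x. c *\<^sub>R a x)" "g' = (\<lambda>x. c' *\<^sub>R a x)"
    by (elim rep_rcoset) auto
  then show ?thesis by (intro exI[of _ "c' / c"]) auto
qed

lemma rep_scaleR: "\<gamma> \<in> carrier G \<Longrightarrow> g \<in> \<rho> \<gamma> \<Longrightarrow> c \<noteq> 0 \<Longrightarrow> (\<lambda>x. c *\<^sub>R g x) \<in> \<rho> \<gamma>"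
proof -
  assume a: "\<gamma> \<in> carrier G" "g \<in> \<rho> \<gamma>" "c \<noteq> 0"
  obtain a where "\<rho> \<gamma> = (\<lambda>c x. c *\<^sub>R a x) ` {c. c \<noteq> 0}" using rep_rcoset[OF a(1)] by blast
  moreover then obtain c' where "c' \<noteq> 0" "g = (\<lambda>x. c' *\<^sub>R a x)" using a(2) by auto
  ultimately show ?thesis using a(3) by (auto intro!: image_eqI[of _ _ "c * c'"])
qed

lemma rep_bij: "\<gamma> \<in> carrier G \<Longrightarrow> g \<in> \<rho> \<gamma> \<Longrightarrow> bij g"
proof -
  assume a: "\<gamma> \<in> carrier G" "g \<in> \<rho> \<gamma>"
  obtain a where la: "linear a" and ba: "bij a" and eq: "\<rho> \<gamma> = (\<lambda>c x. c *\<^sub>R a x) ` {c. c \<noteq> 0}"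
    using rep_rcoset[OF a(1)] by blast
  obtain c where c: "c \<noteq> 0" "g = (\<lambda>x. c *\<^sub>R a x)" using a(2) eq by auto
  have "inj g" using c ba by (auto simp: inj_on_def bij_def)
  moreover have "surj g"
  proof (rule surjI[of _ "\<lambda>y. inv_into UNIV a ((1 / c) *\<^sub>R y)"])
    fix y show "g (inv_into UNIV a ((1 / c) *\<^sub>R y)) = y"
      using c ba by (simp add: bij_is_surj surj_f_inv_f)
  qed
  ultimately show ?thesis by (simp add: bij_def)
qed

lemma rep_mult:
  assumes "\<gamma> \<in> carrier G" "\<gamma>' \<in> carrier G" "g \<in> \<rho> \<gamma>" "h \<in> \<rho> \<gamma>'"
  shows "g \<circ> h \<in> \<rho> (\<gamma> \<otimes> \<gamma>')"
proof -
  have "\<rho> (\<gamma> \<otimes> \<gamma>') = \<rho> \<gamma> <#>\<^bsub>GL\<^esub> \<rho> \<gamma>'"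
    using hom assms by (auto simp: hom_def PGL_def FactGroup_def)
  then show ?thesis using assms by (auto simp: set_mult_def GL_def)
qed

text \<open>The square of a member \<open>g\<close> of \<open>\<rho> \<one>\<close> is again a
  member, hence a multiple of \<open>g\<close>; cancelling the surjective \<open>g\<close> shows
  that \<open>g\<close> is a homothety.\<close>

lemma rep_one: "id \<in> \<rho> \<one>"
proof -
  obtain g where g: "g \<in> \<rho> \<one>" using rep_exists by blast
  have "g \<circ> g \<in> \<rho> \<one>" using rep_mult[OF _ _ g g] by simp
  then obtain c where c: "c \<noteq> 0" "g \<circ> g = (\<lambda>x. c *\<^sub>R g x)" using rep_scale[OF _ g] by blast
  have "y = (1 / c) *\<^sub>R g y" for y
  proof -
    obtain x where "y = g x" using rep_bij[OF _ g] by (metis bij_pointE one_closed)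
    then show ?thesis using fun_cong[OF c(2), of x] c(1) by simp
  qed
  then have "id = (\<lambda>x. (1 / c) *\<^sub>R g x)" by auto
  then show ?thesis using rep_scaleR[OF _ g, of "1 / c"] c(1) by simp
qed

lemma rep_inv:
  assumes "\<gamma> \<in> carrier G" "g \<in> \<rho> \<gamma>"
  shows "inv_into UNIV g \<in> \<rho> (inv \<gamma>)"
proof -
  obtain h where h: "h \<in> \<rho> (inv \<gamma>)" using rep_exists assms by blast
  have "g \<circ> h \<in> \<rho> \<one>" using rep_mult[of \<gamma> "inv \<gamma>", OF _ _ assms(2) h] assms by simp
  then obtain c where c: "c \<noteq> 0" "g \<circ> h = (\<lambda>x. c *\<^sub>R id x)" using rep_scale[OF _ rep_one] by blast
  have lh: "linear h" using rep_linear[OF _ h] assms by simp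
  have "inv_into UNIV g y = (1 / c) *\<^sub>R h y" for y
  proof -
    have "g (h ((1 / c) *\<^sub>R y)) = y" using fun_cong[OF c(2), of "(1 / c) *\<^sub>R y"] c(1) by simp
    then have "inv_into UNIV g y = h ((1 / c) *\<^sub>R y)"
      using rep_bij[OF assms] by (metis bij_inv_eq_iff)
    then show ?thesis by (simp add: linear_scale[OF lh])
  qed
  then have "inv_into UNIV g = (\<lambda>x. (1 / c) *\<^sub>R h x)" by auto
  then show ?thesis using rep_scaleR[OF _ h, of "1 / c"] c(1) assms by simp
qed

text \<open>An arbitrary linear representative. The quantities \<open>att\<close> and
  \<open>ratio\<close>, for \<open>p\<close> in their proper range, and \<open>cond\<close> are
  unchanged by homotheties, so the choice does not affect them.\<close>

definition rep :: "'g \<Rightarrow> 'v \<Rightarrow> 'v" where "rep \<gamma> = (SOME g. g \<in> \<rho> \<gamma>)"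

lemma rep_mem: "\<gamma> \<in> carrier G \<Longrightarrow> rep \<gamma> \<in> \<rho> \<gamma>"
  unfolding rep_def by (rule someI_ex[OF rep_exists])

lemma linear_rep: "\<gamma> \<in> carrier G \<Longrightarrow> linear (rep \<gamma>)"
  and bij_rep: "\<gamma> \<in> carrier G \<Longrightarrow> bij (rep \<gamma>)"
  using rep_mem rep_linear rep_bij by blast+

definition att :: "nat \<Rightarrow> 'g \<Rightarrow> 'v set" where "att p \<gamma> = axes_span p (rep \<gamma>)"

lemma subspace_att: "subspace (att p \<gamma>)" by (simp add: att_def subspace_axes_span)

definition ratio :: "nat \<Rightarrow> 'g \<Rightarrow> real" where
  "ratio p \<gamma> = sigma (p + 1) (rep \<gamma>) / sigma p (rep \<gamma>)"

text \<open>The condition number of a representative: its largest singular value divided by its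
  smallest.\<close>

definition cond :: "'g \<Rightarrow> real" where
  "cond h = sigma 1 (rep h) * sigma 1 (inv_into UNIV (rep h))"

context
  fixes \<gamma> g assumes \<gamma>: "\<gamma> \<in> carrier G" and g: "g \<in> \<rho> \<gamma>"
begin

lemma axes_span_rep: "1 \<le> p \<Longrightarrow> p \<le> DIM('v) \<Longrightarrow> axes_span p g = att p \<gamma>"
  unfolding att_def using rep_scale[OF \<gamma> rep_mem[OF \<gamma>] g] axes_span_scaleR[OF linear_rep[OF \<gamma>] bij_rep[OF \<gamma>]]
  by auto

lemma sigma_ratio_rep: "1 \<le> p \<Longrightarrow> p < DIM('v) \<Longrightarrow> sigma (p + 1) g / sigma p g = ratio p \<gamma>"
  unfolding ratio_def using rep_scale[OF \<gamma> rep_mem[OF \<gamma>] g] sigma_scaleR[OF linear_rep[OF \<gamma>] bij_rep[OF \<gamma>]]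
  by auto

end

lemma sigma_rep_pos: "\<gamma> \<in> carrier G \<Longrightarrow> 1 \<le> p \<Longrightarrow> p \<le> DIM('v) \<Longrightarrow> 0 < sigma p (rep \<gamma>)"
  by (intro sigma_pos linear_rep bij_rep)

lemma bij_inv_rep: "\<gamma> \<in> carrier G \<Longrightarrow> bij (inv_into UNIV (rep \<gamma>))"
  and linear_inv_rep: "\<gamma> \<in> carrier G \<Longrightarrow> linear (inv_into UNIV (rep \<gamma>))"
  using rep_inv[OF _ rep_mem] rep_linear[of "inv \<gamma>"] rep_bij[of "inv \<gamma>"] by auto

lemma cond_pos: "h \<in> carrier G \<Longrightarrow> 0 < cond h"
  unfolding cond_def by (intro mult_pos_pos sigma_pos linear_rep bij_rep linear_inv_rep bij_inv_rep) auto

lemma ratio_pos: "\<gamma> \<in> carrier G \<Longrightarrow> 1 \<le> p \<Longrightarrow> p < DIM('v) \<Longrightarrow> 0 < ratio p \<gamma>"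
  unfolding ratio_def by (intro divide_pos_pos sigma_rep_pos) auto

lemma dim_att: "\<gamma> \<in> carrier G \<Longrightarrow> 1 \<le> p \<Longrightarrow> p < DIM('v) \<Longrightarrow> ratio p \<gamma> < 1 \<Longrightarrow> dim (att p \<gamma>) = p"
  unfolding att_def using sigma_rep_pos[of \<gamma> p]
  by (intro axes_span_dim linear_rep bij_rep) (auto simp: ratio_def)

lemma rep_norm_le: "\<gamma> \<in> carrier G \<Longrightarrow> norm (rep \<gamma> x) \<le> sigma 1 (rep \<gamma>) * norm x"
  by (intro norm_le_sigma_1 linear_rep bij_rep)

lemma inv_rep_norm_le:
  "\<gamma> \<in> carrier G \<Longrightarrow> norm (inv_into UNIV (rep \<gamma>) x) \<le> sigma 1 (inv_into UNIV (rep \<gamma>)) * norm x"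
  by (intro norm_le_sigma_1 linear_inv_rep bij_inv_rep)

text \<open>The case of \<open>axes_span_comp_close\<close> in which \<open>h1\<close> is the
  identity: right multiplication hardly moves the attracting space when the gap of the product is
  large.\<close>

lemma att_mult_right_close:
  assumes \<gamma>: "\<gamma> \<in> carrier G" and h: "h \<in> carrier G" and p: "1 \<le> p" "p < DIM('v)" and w: "w \<in> att p \<gamma>"
  shows "norm (w - oproj (att p (\<gamma> \<otimes> h)) w) \<le> cond h * ratio p (\<gamma> \<otimes> h) * norm w"
proof -
  let ?A = "rep \<gamma> \<circ> rep h"
  have A: "?A \<in> \<rho> (\<gamma> \<otimes> h)" and c: "\<gamma> \<otimes> h \<in> carrier G" using \<gamma> h by (auto intro!: rep_mult rep_mem)
  have "norm (w - oproj (axes_span p ?A) w)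
      \<le> 1 * sigma 1 (rep h) * sigma 1 (inv_into UNIV (rep h)) * (sigma (p + 1) ?A / sigma p ?A) * norm w"
  proof (rule axes_span_comp_close[where ?h1.0 = "\<lambda>x. x" and g = "rep \<gamma>" and ?h2.0 = "rep h"
        and h2' = "inv_into UNIV (rep h)" and a = 1])
    show "rep h (inv_into UNIV (rep h) x) = x" for x using bij_rep[OF h] by (simp add: bij_is_surj surj_f_inv_f)
    show "linear (rep \<gamma>)" "bij (rep \<gamma>)" "linear (rep h)" "bij (rep h)" using \<gamma> h by (auto simp: linear_rep bij_rep)
    show "linear ?A" "bij ?A" using rep_linear[OF c A] rep_bij[OF c A] by auto
    show "norm (rep h x) \<le> sigma 1 (rep h) * norm x" for x by (rule rep_norm_le[OF h])
    show "norm (inv_into UNIV (rep h) x) \<le> sigma 1 (inv_into UNIV (rep h)) * norm x" for x by (rule inv_rep_norm_le[OF h])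
    show "0 \<le> sigma 1 (rep h)" using sigma_rep_pos[OF h, of 1] by simp
    show "0 \<le> sigma 1 (inv_into UNIV (rep h))"
      using sigma_pos[OF linear_inv_rep[OF h] bij_inv_rep[OF h], of 1] by simp
  qed (use p w in \<open>auto simp: att_def\<close>)
  then show ?thesis
    unfolding axes_span_rep[OF c A p(1) less_imp_le[OF p(2)]] sigma_ratio_rep[OF c A p] by (simp add: cond_def)
qed

text \<open>Here \<open>h2\<close> is the identity. As the ratio of the product tends to
  \<open>0\<close>, its attracting space absorbs the image of \<open>att p \<gamma>\<close> under
  \<open>h\<close>; this is the origin of the equivariance of the limit maps.\<close>

lemma att_mult_left_close:
  assumes \<gamma>: "\<gamma> \<in> carrier G" and h: "h \<in> carrier G" and p: "1 \<le> p" "p < DIM('v)" and w: "w \<in> att p \<gamma>"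
  shows "norm (rep h w - oproj (att p (h \<otimes> \<gamma>)) (rep h w)) \<le> sigma 1 (rep h) * ratio p (h \<otimes> \<gamma>) * norm w"
proof -
  let ?A = "rep h \<circ> rep \<gamma>"
  have A: "?A \<in> \<rho> (h \<otimes> \<gamma>)" and c: "h \<otimes> \<gamma> \<in> carrier G" using \<gamma> h by (auto intro!: rep_mult rep_mem)
  have "norm (rep h w - oproj (axes_span p ?A) (rep h w))
      \<le> sigma 1 (rep h) * 1 * 1 * (sigma (p + 1) ?A / sigma p ?A) * norm w"
  proof (rule axes_span_comp_close[where ?h1.0 = "rep h" and ?h2.0 = "\<lambda>x. x"
        and h2' = "\<lambda>x. x" and g = "rep \<gamma>" and b = 1 and b' = 1])
    show "linear (rep \<gamma>)" "bij (rep \<gamma>)" using \<gamma> by (auto simp: linear_rep bij_rep)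
    show "linear ?A" "bij ?A" using rep_linear[OF c A] rep_bij[OF c A] by auto
    show "norm (rep h x) \<le> sigma 1 (rep h) * norm x" for x by (rule rep_norm_le[OF h])
    show "0 \<le> sigma 1 (rep h)" using sigma_rep_pos[OF h, of 1] by simp
    show "linear (\<lambda>x::'v. x)" by (rule linear_ident)
    show "bij (\<lambda>x::'v. x)" using bij_id by (simp add: id_def)
  qed (use p w in \<open>auto simp: att_def\<close>)
  then show ?thesis
    unfolding axes_span_rep[OF c A p(1) less_imp_le[OF p(2)]] sigma_ratio_rep[OF c A p] by simp
qed

lemma cond_bound: "\<exists>K>0. \<forall>h\<in>carrier G. len h \<le> n \<longrightarrow> cond h \<le> K"
proof -
  let ?F = "insert \<one> {h \<in> carrier G. len h \<le> n}"
  have fin: "finite (cond ` ?F)" using finite_len_le by auto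
  have "cond h \<le> Max (cond ` ?F)" if "h \<in> carrier G" "len h \<le> n" for h
    using that by (intro Max_ge[OF fin]) auto
  moreover have "cond \<one> \<le> Max (cond ` ?F)" by (intro Max_ge[OF fin]) auto
  moreover have "0 < cond \<one>" by (rule cond_pos) simp
  ultimately show ?thesis
    by (intro exI[of _ "Max (cond ` ?F)"] conjI ballI impI) (blast intro: less_le_trans)+
qed

end

section \<open>Boundary maps of Anosov representations\<close>

text \<open>The constants of the gap are parameters, so that the locale can be interpreted for one
  representation at \<open>1\<close>, at \<open>r\<close> and at \<open>d - r\<close>, and estimates
  carry explicit rates.\<close>

locale anosov_rep = proj_rep G S \<rho> for G :: "('g, 'b) monoid_scheme" (structure) and S
    and \<rho> :: "'g \<Rightarrow> ('v::euclidean_space \<Rightarrow> 'v) set" +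
  fixes p :: nat and c \<mu> :: real
  assumes p: "1 \<le> p" "p < DIM('v)" and c: "0 < c" and mu: "0 < \<mu>"
    and ratio_rep: "\<And>\<gamma> g. \<gamma> \<in> carrier G \<Longrightarrow> g \<in> \<rho> \<gamma> \<Longrightarrow>
      sigma (p + 1) g / sigma p g \<le> c * exp (- \<mu> * real (word_length G S \<gamma>))"
begin

lemma ratio_le: "\<gamma> \<in> carrier G \<Longrightarrow> ratio p \<gamma> \<le> c * exp (- \<mu> * real (len \<gamma>))"
  using ratio_rep[OF _ rep_mem] by (simp add: ratio_def)

lemma ratio_le_of_len_ge: "\<gamma> \<in> carrier G \<Longrightarrow> t \<le> real (len \<gamma>) \<Longrightarrow> ratio p \<gamma> \<le> c * exp (- \<mu> * t)"
  using ratio_le[of \<gamma>] c mu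
  by (meson dual_order.trans exp_le_cancel_iff mult_le_cancel_left_pos mult_le_cancel_left_neg neg_less_0_iff_less)

text \<open>When the ratios are below \<open>1\<close>, both spaces have dimension \<open>p\<close>
  and the one-sided estimate for right multiplication suffices. Otherwise \<open>\<gamma>\<close>
  has bounded length and the constant absorbs the trivial bound.\<close>

lemma att_mult_right_dist:
  "\<exists>C>0. \<forall>\<gamma>\<in>carrier G. \<forall>h\<in>carrier G. len h \<le> n \<longrightarrow>
    dist (oproj (att p \<gamma>)) (oproj (att p (\<gamma> \<otimes> h))) \<le> C * exp (- \<mu> * real (len \<gamma>))"
proof -
  obtain K where K: "0 < K" "\<And>h. h \<in> carrier G \<Longrightarrow> len h \<le> n \<Longrightarrow> cond h \<le> K"
    using cond_bound by blast
  \<comment> \<open>\<open>4 * K\<close> comes from the one-sided estimate, \<open>2\<close> is the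
    trivial bound for the distance of two projections, and \<open>exp (\<mu> * n)\<close> pays for
    the length that multiplication by \<open>h\<close> may remove.\<close>
  define C where "C = (4 * K + 2) * (c * exp (\<mu> * n))"
  have "dist (oproj (att p \<gamma>)) (oproj (att p (\<gamma> \<otimes> h))) \<le> C * exp (- \<mu> * real (len \<gamma>))"
    if \<gamma>: "\<gamma> \<in> carrier G" and h: "h \<in> carrier G" "len h \<le> n" for \<gamma> h
  proof -
    define g0 where "g0 = c * exp (- \<mu> * (real (len \<gamma>) - real n))"
    have g0: "0 < g0" using c by (simp add: g0_def)
    have C: "C * exp (- \<mu> * real (len \<gamma>)) = (4 * K + 2) * g0"
      by (simp add: C_def g0_def right_diff_distrib mult_exp_exp)
    have gh: "\<gamma> \<otimes> h \<in> carrier G" using \<gamma> h by simp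
    have "wd \<gamma> (\<gamma> \<otimes> h) = len h" using \<gamma> h by (simp add: word_dist_def flip: m_assoc)
    then have "real (len \<gamma>) - real n \<le> len (\<gamma> \<otimes> h)"
      using len_diff_le_wd[OF \<gamma> gh] h(2) by linarith
    then have r1: "ratio p (\<gamma> \<otimes> h) \<le> g0" unfolding g0_def by (rule ratio_le_of_len_ge[OF gh])
    have r2: "ratio p \<gamma> \<le> g0" unfolding g0_def by (rule ratio_le_of_len_ge[OF \<gamma>]) simp
    show ?thesis
    proof (cases "g0 < 1")
      case True
      have "dist (oproj (att p \<gamma>)) (oproj (att p (\<gamma> \<otimes> h))) \<le> 4 * (K * g0)"
      proof (rule gap_le_of_one_sided)
        show "dim (att p \<gamma>) = dim (att p (\<gamma> \<otimes> h))"
          using dim_att[OF \<gamma> p] dim_att[OF gh p] r1 r2 True by simp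
        show "0 \<le> K * g0" using K g0 by simp
        fix w assume w: "w \<in> att p \<gamma>"
        have "norm (w - oproj (att p (\<gamma> \<otimes> h)) w) \<le> cond h * ratio p (\<gamma> \<otimes> h) * norm w"
          by (rule att_mult_right_close[OF \<gamma> h(1) p w])
        also have "\<dots> \<le> K * g0 * norm w"
          using K h r1 g0 ratio_pos[OF gh p] by (intro mult_right_mono mult_mono) auto
        finally show "norm (w - oproj (att p (\<gamma> \<otimes> h)) w) \<le> K * g0 * norm w" .
      qed (auto simp: subspace_att)
      then show ?thesis unfolding C using g0 by (simp add: algebra_simps)
    next
      case False
      have "2 * 1 \<le> (4 * K + 2) * g0" using False K by (intro mult_mono) auto
      then show ?thesis unfolding C using dist_oproj_le_2[OF subspace_att subspace_att, of p \<gamma> p "\<gamma> \<otimes> h"] by simp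
    qed
  qed
  moreover have "0 < C" using K c by (auto simp: C_def intro!: mult_pos_pos)
  ultimately show ?thesis by blast
qed

text \<open>Along a path whose word length grows at least linearly the single steps form a geometric
  series. The offset \<open>t\<close> is negative for rays that start away from the identity and run
  towards it, and positive for paths that stay far out.\<close>

lemma att_path_dist:
  obtains C where "0 < C"
    "\<And>w i m t. i \<le> m \<Longrightarrow> (\<And>j. i \<le> j \<Longrightarrow> j \<le> m \<Longrightarrow> w j \<in> carrier G \<and> real j + t \<le> real (len (w j))) \<Longrightarrow>
      (\<And>j. i \<le> j \<Longrightarrow> j < m \<Longrightarrow> wd (w j) (w (Suc j)) \<le> 1) \<Longrightarrow>
      dist (oproj (att p (w i))) (oproj (att p (w m))) \<le> C * exp (- \<mu> * (real i + t))"
proof -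
  obtain C0 where C0: "0 < C0" "\<And>\<gamma> h. \<gamma> \<in> carrier G \<Longrightarrow> h \<in> carrier G \<Longrightarrow> len h \<le> 1 \<Longrightarrow>
    dist (oproj (att p \<gamma>)) (oproj (att p (\<gamma> \<otimes> h))) \<le> C0 * exp (- \<mu> * real (len \<gamma>))"
    using att_mult_right_dist[of 1] by blast
  define q where "q = exp (- \<mu>)"
  have q: "q < 1" using mu by (simp add: q_def)
  \<comment> \<open>The solution of \<open>C0 + C * q = C\<close>, so that prepending one step
    reproduces the bound in the induction.\<close>
  define C where "C = C0 / (1 - q)"
  have C: "0 < C" "C0 + C * q = C" using C0(1) q by (auto simp: C_def field_simps)
  have main: "dist (oproj (att p (w i))) (oproj (att p (w (i + k)))) \<le> C * exp (- \<mu> * (real i + t))"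
    if w: "\<And>j. i \<le> j \<Longrightarrow> j \<le> i + k \<Longrightarrow> w j \<in> carrier G \<and> real j + t \<le> real (len (w j))"
      "\<And>j. i \<le> j \<Longrightarrow> j < i + k \<Longrightarrow> wd (w j) (w (Suc j)) \<le> 1" for w i k t
    using that
  proof (induction k arbitrary: i)
    case 0
    then show ?case using C(1) by simp
  next
    case (Suc k)
    define h where "h = inv (w i) \<otimes> w (Suc i)"
    have wi: "w i \<in> carrier G" "w (Suc i) \<in> carrier G" "real i + t \<le> real (len (w i))"
      using Suc.prems(1)[of i] Suc.prems(1)[of "Suc i"] by auto
    have h: "h \<in> carrier G" "w i \<otimes> h = w (Suc i)" using wi by (auto simp: h_def simp flip: m_assoc)
    have "len h \<le> 1" using Suc.prems(2)[of i] by (simp add: word_dist_def h_def)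
    then have "dist (oproj (att p (w i))) (oproj (att p (w (Suc i)))) \<le> C0 * exp (- \<mu> * real (len (w i)))"
      using C0(2)[OF wi(1) h(1)] h(2) by simp
    also have "\<dots> \<le> C0 * exp (- \<mu> * (real i + t))"
      using C0(1) wi(3) mu by (intro mult_left_mono) (auto intro: mult_left_mono)
    finally have 1: "dist (oproj (att p (w i))) (oproj (att p (w (Suc i)))) \<le> C0 * exp (- \<mu> * (real i + t))" .
    have "dist (oproj (att p (w (Suc i)))) (oproj (att p (w (Suc i + k)))) \<le> C * exp (- \<mu> * (real (Suc i) + t))"
      by (rule Suc.IH) (use Suc.prems in auto)
    also have "\<dots> = C * q * exp (- \<mu> * (real i + t))"
      by (simp add: q_def mult_exp_exp algebra_simps)
    finally have "dist (oproj (att p (w i))) (oproj (att p (w (Suc i + k)))) \<le> (C0 + C * q) * exp (- \<mu> * (real i + t))"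
      using 1 dist_triangle[of "oproj (att p (w i))" "oproj (att p (w (Suc i + k)))" "oproj (att p (w (Suc i)))"]
      by (simp add: algebra_simps)
    then show ?case using C(2) by simp
  qed
  show ?thesis
  proof (rule that[OF C(1)])
    fix w and i m :: nat and t :: real
    assume "i \<le> m" and w: "\<And>j. i \<le> j \<Longrightarrow> j \<le> m \<Longrightarrow> w j \<in> carrier G \<and> real j + t \<le> real (len (w j))"
      "\<And>j. i \<le> j \<Longrightarrow> j < m \<Longrightarrow> wd (w j) (w (Suc j)) \<le> 1"
    then show "dist (oproj (att p (w i))) (oproj (att p (w m))) \<le> C * exp (- \<mu> * (real i + t))"
      using main[of i "m - i" w t] by simp
  qed
qed

lemma exp_decay: "(\<lambda>n. C * exp (- \<mu> * (real n + t))) \<longlonglongrightarrow> 0"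
proof -
  have "(\<lambda>n. C * exp (- \<mu> * t) * exp (- \<mu>) ^ n) \<longlonglongrightarrow> C * exp (- \<mu> * t) * 0"
    using mu by (intro tendsto_intros LIMSEQ_power_zero) auto
  moreover have "(\<lambda>n. C * exp (- \<mu> * t) * exp (- \<mu>) ^ n) = (\<lambda>n. C * exp (- \<mu> * (real n + t)))"
    by (simp add: algebra_simps mult_exp_exp flip: exp_of_nat_mult)
  ultimately show ?thesis by simp
qed

lemma ratio_tendsto_0:
  assumes "\<And>n. w n \<in> carrier G" "\<And>n. real n + t \<le> real (len (w n))"
  shows "(\<lambda>n. ratio p (w n)) \<longlonglongrightarrow> 0"
proof (rule tendsto_sandwich[OF _ _ tendsto_const exp_decay[of c t]])
  show "\<forall>\<^sub>F n in sequentially. 0 \<le> ratio p (w n)"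
    by (intro always_eventually allI less_imp_le ratio_pos assms(1) p)
  show "\<forall>\<^sub>F n in sequentially. ratio p (w n) \<le> c * exp (- \<mu> * (real n + t))"
    by (intro always_eventually allI ratio_le_of_len_ge assms)
qed

lemma ray_att_limit:
  assumes \<gamma>: "ray \<gamma>"
  obtains W where "subspace W" "dim W = p" "(\<lambda>n. oproj (att p (\<gamma> n))) \<longlonglongrightarrow> oproj W"
proof -
  obtain C where C: "0 < C"
    "\<And>w i m t. i \<le> m \<Longrightarrow> (\<And>j. i \<le> j \<Longrightarrow> j \<le> m \<Longrightarrow> w j \<in> carrier G \<and> real j + t \<le> real (len (w j))) \<Longrightarrow>
      (\<And>j. i \<le> j \<Longrightarrow> j < m \<Longrightarrow> wd (w j) (w (Suc j)) \<le> 1) \<Longrightarrow>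
      dist (oproj (att p (w i))) (oproj (att p (w m))) \<le> C * exp (- \<mu> * (real i + t))"
    using att_path_dist by blast
  let ?t = "- real (len (\<gamma> 0))"
  have d: "dist (oproj (att p (\<gamma> i))) (oproj (att p (\<gamma> m))) \<le> C * exp (- \<mu> * (real i + ?t))" if "i \<le> m" for i m
    using that \<gamma> ray_len_ge[OF \<gamma>] by (intro C(2)) (auto simp: ray_carrier ray_step)
  have "Cauchy (\<lambda>n. oproj (att p (\<gamma> n)))"
  proof (rule metric_CauchyI)
    fix e :: real assume "0 < e"
    then have "\<forall>\<^sub>F i in sequentially. C * exp (- \<mu> * (real i + ?t)) < e / 2"
      by (intro order_tendstoD(2)[OF exp_decay]) simp
    then obtain N where N: "C * exp (- \<mu> * (real N + ?t)) < e / 2" by (auto simp: eventually_sequentially)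
    have "dist (oproj (att p (\<gamma> m))) (oproj (att p (\<gamma> n))) < e" if "m \<ge> N" "n \<ge> N" for m n
      using d[OF that(1)] d[OF that(2)] N dist_triangle3[of "oproj (att p (\<gamma> m))" "oproj (att p (\<gamma> n))" "oproj (att p (\<gamma> N))"]
      by linarith
    then show "\<exists>M. \<forall>m\<ge>M. \<forall>n\<ge>M. dist (oproj (att p (\<gamma> m))) (oproj (att p (\<gamma> n))) < e" by blast
  qed
  then obtain W where W: "subspace W" "(\<lambda>n. oproj (att p (\<gamma> n))) \<longlonglongrightarrow> oproj W"
    using Cauchy_oproj_limit[of "\<lambda>n. att p (\<gamma> n)"] subspace_att by blast
  have "(\<lambda>n. ratio p (\<gamma> n)) \<longlonglongrightarrow> 0"
    using ray_len_ge[OF \<gamma>] by (intro ratio_tendsto_0[where t = ?t] ray_carrier[OF \<gamma>]) simp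
  then have "\<forall>\<^sub>F n in sequentially. ratio p (\<gamma> n) < 1" by (rule order_tendstoD) simp
  moreover have "\<forall>\<^sub>F n in sequentially. dist (oproj (att p (\<gamma> n))) (oproj W) < 1"
    using W(2) by (rule tendstoD) simp
  ultimately have "\<forall>\<^sub>F n in sequentially. dim W = p"
  proof eventually_elim
    case (elim n)
    then show ?case
      using dim_eq_of_gap_less_1[OF subspace_att W(1), of p "\<gamma> n"] dim_att[OF ray_carrier[OF \<gamma>] p] by simp
  qed
  then have "dim W = p" by simp
  then show ?thesis using that W by blast
qed

abbreviation xi :: "(nat \<Rightarrow> 'g) set \<Rightarrow> 'v set" where "xi \<equiv> boundary_map \<rho> p"

text \<open>The definite description asks for the limit along every ray of the class and for every
  choice of representatives. Rays of one class stay at bounded distance, so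
  \<open>att_mult_right_dist\<close> gives them the same limit; uniqueness is read off on
  \<open>\<gamma>\<close> alone.\<close>

lemma boundary_map_eqI:
  assumes \<gamma>: "ray \<gamma>" and W: "subspace W" "dim W = p" "(\<lambda>n. oproj (att p (\<gamma> n))) \<longlonglongrightarrow> oproj W"
  shows "xi (endpt \<gamma>) = W"
proof -
  have pd: "p \<le> DIM('v)" using p by simp
  have gap: "gap (axes_span p (g n)) W' = dist (oproj (att p (\<gamma>' n))) (oproj W')"
    if "subspace W'" "ray \<gamma>'" "\<And>n. g n \<in> \<rho> (\<gamma>' n)" for W' \<gamma>' g n
    using that axes_span_rep[OF ray_carrier[OF that(2)] that(3) p(1) pd]
    by (simp add: gap_eq_dist subspace_att)
  show ?thesis unfolding boundary_map_def
  proof (rule the_equality)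
    show "W \<in> grassmannian p \<and> (\<forall>\<gamma>'\<in>endpt \<gamma>. \<forall>g. (\<forall>n. g n \<in> \<rho> (\<gamma>' n)) \<longrightarrow>
        (\<lambda>n. gap (axes_span p (g n)) W) \<longlonglongrightarrow> 0)"
    proof (intro conjI ballI allI impI)
      show "W \<in> grassmannian p" using W by (simp add: grassmannian_def)
      fix \<gamma>' g assume \<gamma>': "\<gamma>' \<in> endpt \<gamma>" and g: "\<forall>n. g n \<in> \<rho> (\<gamma>' n)"
      obtain D where r': "ray \<gamma>'" and D: "\<And>n. wd (\<gamma> n) (\<gamma>' n) \<le> D" using \<gamma>' by (auto simp: mem_endpt_iff)
      obtain m :: nat where m: "D \<le> real m" using real_arch_simple by blast
      obtain C where C: "0 < C" "\<And>\<gamma> h. \<gamma> \<in> carrier G \<Longrightarrow> h \<in> carrier G \<Longrightarrow> len h \<le> m \<Longrightarrow>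
          dist (oproj (att p \<gamma>)) (oproj (att p (\<gamma> \<otimes> h))) \<le> C * exp (- \<mu> * real (len \<gamma>))"
        using att_mult_right_dist[of m] by blast
      let ?t = "- real (len (\<gamma> 0))"
      have le: "dist (oproj (att p (\<gamma> n))) (oproj (att p (\<gamma>' n))) \<le> C * exp (- \<mu> * (real n + ?t))" for n
      proof -
        let ?h = "inv (\<gamma> n) \<otimes> \<gamma>' n"
        have car: "\<gamma> n \<in> carrier G" "\<gamma>' n \<in> carrier G" using \<gamma> r' by (auto simp: ray_carrier)
        have "real (len ?h) \<le> real m" using D[of n] m by (simp add: word_dist_def)
        then have "dist (oproj (att p (\<gamma> n))) (oproj (att p (\<gamma> n \<otimes> ?h))) \<le> C * exp (- \<mu> * real (len (\<gamma> n)))"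
          using car by (intro C(2)) auto
        moreover have "\<gamma> n \<otimes> ?h = \<gamma>' n" using car by (simp flip: m_assoc)
        moreover have "C * exp (- \<mu> * real (len (\<gamma> n))) \<le> C * exp (- \<mu> * (real n + ?t))"
          using ray_len_ge[OF \<gamma>, of n] C(1) mu by (intro mult_left_mono) auto
        ultimately show ?thesis by simp
      qed
      have "(\<lambda>n. dist (oproj (att p (\<gamma> n))) (oproj (att p (\<gamma>' n)))) \<longlonglongrightarrow> 0"
        by (rule tendsto_sandwich[OF _ _ tendsto_const exp_decay[of C ?t]]) (use le in auto)
      moreover have "(\<lambda>n. dist (oproj (att p (\<gamma> n))) (oproj W)) \<longlonglongrightarrow> 0"
        by (rule tendsto_dist_iff[THEN iffD1, OF W(3)])
      ultimately have "(\<lambda>n. dist (oproj (att p (\<gamma> n))) (oproj (att p (\<gamma>' n))) + dist (oproj (att p (\<gamma> n))) (oproj W)) \<longlonglongrightarrow> 0 + 0"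
        by (rule tendsto_add)
      then have lim: "(\<lambda>n. dist (oproj (att p (\<gamma> n))) (oproj (att p (\<gamma>' n))) + dist (oproj (att p (\<gamma> n))) (oproj W)) \<longlonglongrightarrow> 0"
        by simp
      have "(\<lambda>n. dist (oproj (att p (\<gamma>' n))) (oproj W)) \<longlonglongrightarrow> 0"
      proof (rule tendsto_sandwich[OF _ _ tendsto_const lim])
        show "\<forall>\<^sub>F n in sequentially. 0 \<le> dist (oproj (att p (\<gamma>' n))) (oproj W)" by simp
        show "\<forall>\<^sub>F n in sequentially. dist (oproj (att p (\<gamma>' n))) (oproj W)
            \<le> dist (oproj (att p (\<gamma> n))) (oproj (att p (\<gamma>' n))) + dist (oproj (att p (\<gamma> n))) (oproj W)"
          by (intro always_eventually allI dist_triangle3)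
      qed
      then show "(\<lambda>n. gap (axes_span p (g n)) W) \<longlonglongrightarrow> 0" using gap[OF W(1) r'] g by simp
    qed
    fix W' assume W': "W' \<in> grassmannian p \<and> (\<forall>\<gamma>'\<in>endpt \<gamma>. \<forall>g. (\<forall>n. g n \<in> \<rho> (\<gamma>' n)) \<longrightarrow>
        (\<lambda>n. gap (axes_span p (g n)) W') \<longlonglongrightarrow> 0)"
    then have s: "subspace W'" by (simp add: grassmannian_def)
    have "(\<lambda>n. gap (axes_span p (rep (\<gamma> n))) W') \<longlonglongrightarrow> 0"
    proof -
      have "\<forall>n. rep (\<gamma> n) \<in> \<rho> (\<gamma> n)" using rep_mem[OF ray_carrier[OF \<gamma>]] by blast
      then show ?thesis using bspec[OF conjunct2[OF W'] ray_mem_endpt[OF \<gamma>]] by simp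
    qed
    then have "(\<lambda>n. oproj (att p (\<gamma> n))) \<longlonglongrightarrow> oproj W'"
      unfolding gap[OF s \<gamma> rep_mem[OF ray_carrier[OF \<gamma>]]] by (rule tendsto_dist_iff[THEN iffD2])
    then have "oproj W' = oproj W" by (rule LIMSEQ_unique[OF _ W(3)])
    then show "W' = W" by (rule oproj_inject[OF s W(1)])
  qed
qed

lemma xi_ray:
  assumes \<gamma>: "ray \<gamma>"
  shows "subspace (xi (endpt \<gamma>))" "dim (xi (endpt \<gamma>)) = p"
    "(\<lambda>n. oproj (att p (\<gamma> n))) \<longlonglongrightarrow> oproj (xi (endpt \<gamma>))"
proof -
  obtain W where W: "subspace W" "dim W = p" "(\<lambda>n. oproj (att p (\<gamma> n))) \<longlonglongrightarrow> oproj W"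
    using ray_att_limit[OF \<gamma>] by blast
  then have "xi (endpt \<gamma>) = W" by (rule boundary_map_eqI[OF \<gamma>])
  then show "subspace (xi (endpt \<gamma>))" "dim (xi (endpt \<gamma>)) = p"
    "(\<lambda>n. oproj (att p (\<gamma> n))) \<longlonglongrightarrow> oproj (xi (endpt \<gamma>))" using W by auto
qed

lemma xi_grassmannian: "x \<in> boundary_points G S \<Longrightarrow> xi x \<in> grassmannian p"
  by (erule boundary_cases) (simp add: grassmannian_def xi_ray)

lemma subspace_xi: "x \<in> boundary_points G S \<Longrightarrow> subspace (xi x)"
  and dim_xi: "x \<in> boundary_points G S \<Longrightarrow> dim (xi x) = p"
  using xi_grassmannian by (auto simp: grassmannian_def)

text \<open>The path estimate with its end sent to infinity, stated together with the finite version
  so that one constant serves both.\<close>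

lemma xi_path_dist:
  obtains C where "0 < C"
    "\<And>w i t P. (\<And>j. i \<le> j \<Longrightarrow> w j \<in> carrier G \<and> real j + t \<le> real (len (w j))) \<Longrightarrow>
      (\<And>j. i \<le> j \<Longrightarrow> wd (w j) (w (Suc j)) \<le> 1) \<Longrightarrow> (\<lambda>n. oproj (att p (w n))) \<longlonglongrightarrow> P \<Longrightarrow>
      dist (oproj (att p (w i))) P \<le> C * exp (- \<mu> * (real i + t))"
    "\<And>w i m t. i \<le> m \<Longrightarrow> (\<And>j. i \<le> j \<Longrightarrow> j \<le> m \<Longrightarrow> w j \<in> carrier G \<and> real j + t \<le> real (len (w j))) \<Longrightarrow>
      (\<And>j. i \<le> j \<Longrightarrow> j < m \<Longrightarrow> wd (w j) (w (Suc j)) \<le> 1) \<Longrightarrow>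
      dist (oproj (att p (w i))) (oproj (att p (w m))) \<le> C * exp (- \<mu> * (real i + t))"
proof -
  obtain C where C: "0 < C"
    "\<And>w i m t. i \<le> m \<Longrightarrow> (\<And>j. i \<le> j \<Longrightarrow> j \<le> m \<Longrightarrow> w j \<in> carrier G \<and> real j + t \<le> real (len (w j))) \<Longrightarrow>
      (\<And>j. i \<le> j \<Longrightarrow> j < m \<Longrightarrow> wd (w j) (w (Suc j)) \<le> 1) \<Longrightarrow>
      dist (oproj (att p (w i))) (oproj (att p (w m))) \<le> C * exp (- \<mu> * (real i + t))"
    using att_path_dist by blast
  show ?thesis
  proof (rule that[OF C(1) _ C(2)])
    fix w and i :: nat and t :: real and P
    assume w: "\<And>j. i \<le> j \<Longrightarrow> w j \<in> carrier G \<and> real j + t \<le> real (len (w j))"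
      "\<And>j. i \<le> j \<Longrightarrow> wd (w j) (w (Suc j)) \<le> 1" and P: "(\<lambda>n. oproj (att p (w n))) \<longlonglongrightarrow> P"
    show "dist (oproj (att p (w i))) P \<le> C * exp (- \<mu> * (real i + t))"
    proof (rule Lim_bounded)
      show "(\<lambda>n. dist (oproj (att p (w i))) (oproj (att p (w n)))) \<longlonglongrightarrow> dist (oproj (att p (w i))) P"
        by (intro tendsto_intros P)
      show "\<forall>n\<ge>i. dist (oproj (att p (w i))) (oproj (att p (w n))) \<le> C * exp (- \<mu> * (real i + t))"
        using w by (intro allI impI C(2)) auto
    qed
  qed
qed

text \<open>A vector of the limit space is the limit of its projections to
  \<open>att p (\<gamma> n)\<close>, whose images under \<open>h\<close> approach
  \<open>att p (h \<otimes> \<gamma> n)\<close>. This inclusion is the form in which equivariance is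
  used.\<close>

lemma rep_xi_mem:
  assumes \<gamma>: "ray \<gamma>" and h: "h \<in> carrier G" and e: "e \<in> xi (endpt \<gamma>)"
  shows "rep h e \<in> xi (endpt (\<lambda>n. h \<otimes> \<gamma> n))"
proof -
  let ?e = "\<lambda>n. oproj (att p (\<gamma> n)) e"
  let ?h\<gamma> = "\<lambda>n. h \<otimes> \<gamma> n"
  have r: "ray ?h\<gamma>" by (rule ray_translate[OF \<gamma> h])
  have lin: "bounded_linear (rep h)" using linear_rep[OF h] by (simp add: linear_conv_bounded_linear)
  have "?e \<longlonglongrightarrow> oproj (xi (endpt \<gamma>)) e" by (intro tendsto_intros xi_ray \<gamma>)
  then have e': "?e \<longlonglongrightarrow> e" using e xi_ray[OF \<gamma>] by (simp add: oproj_id)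
  have "(\<lambda>n. rep h (?e n) - oproj (att p (?h\<gamma> n)) (rep h (?e n))) \<longlonglongrightarrow>
      rep h e - oproj (xi (endpt ?h\<gamma>)) (rep h e)"
    by (intro tendsto_intros bounded_linear.tendsto[OF lin] e' xi_ray r)
  moreover have "(\<lambda>n. rep h (?e n) - oproj (att p (?h\<gamma> n)) (rep h (?e n))) \<longlonglongrightarrow> 0"
  proof (rule Lim_null_comparison)
    show "\<forall>\<^sub>F n in sequentially. norm (rep h (?e n) - oproj (att p (?h\<gamma> n)) (rep h (?e n)))
        \<le> sigma 1 (rep h) * ratio p (?h\<gamma> n) * norm (?e n)"
      by (intro always_eventually allI att_mult_left_close ray_carrier[OF \<gamma>] h p oproj_mem subspace_att)
    have "(\<lambda>n. ratio p (?h\<gamma> n)) \<longlonglongrightarrow> 0"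
      using ray_len_ge[OF r] by (intro ratio_tendsto_0[where t = "- real (len (?h\<gamma> 0))"] ray_carrier[OF r]) simp
    then have "(\<lambda>n. sigma 1 (rep h) * ratio p (?h\<gamma> n) * norm (?e n)) \<longlonglongrightarrow> sigma 1 (rep h) * 0 * norm e"
      by (intro tendsto_intros e')
    then show "(\<lambda>n. sigma 1 (rep h) * ratio p (?h\<gamma> n) * norm (?e n)) \<longlonglongrightarrow> 0" by simp
  qed
  ultimately have "rep h e - oproj (xi (endpt ?h\<gamma>)) (rep h e) = 0" by (rule LIMSEQ_unique)
  then have "oproj (xi (endpt ?h\<gamma>)) (rep h e) = rep h e" by simp
  then show ?thesis using oproj_fixed_iff[OF xi_ray(1)[OF r]] by blast
qed

end

text \<open>Leading axes are nested, and inclusions pass to limits of projections.\<close>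

lemma (in proj_rep) boundary_map_mono:
  assumes p: "anosov_rep G S \<rho> p c \<mu>" and q: "anosov_rep G S \<rho> q c' \<mu>'" and le: "p \<le> q"
    and x: "x \<in> boundary_points G S"
  shows "boundary_map \<rho> p x \<subseteq> boundary_map \<rho> q x"
proof
  interpret P: anosov_rep G S \<rho> p c \<mu> by fact
  interpret Q: anosov_rep G S \<rho> q c' \<mu>' by fact
  obtain \<gamma> where \<gamma>: "ray \<gamma>" "x = endpt \<gamma>" using x by (rule boundary_cases)
  fix e assume e: "e \<in> boundary_map \<rho> p x"
  let ?e = "\<lambda>n. oproj (att p (\<gamma> n)) e"
  have "?e \<longlonglongrightarrow> oproj (P.xi (endpt \<gamma>)) e" by (intro tendsto_intros P.xi_ray \<gamma>)
  then have e': "?e \<longlonglongrightarrow> e" using e P.xi_ray[OF \<gamma>(1)] by (simp add: oproj_id \<gamma>)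
  have "(\<lambda>n. oproj (att q (\<gamma> n)) (?e n)) \<longlonglongrightarrow> oproj (Q.xi (endpt \<gamma>)) e"
    by (intro tendsto_intros e' Q.xi_ray \<gamma>)
  moreover have "oproj (att q (\<gamma> n)) (?e n) = ?e n" for n
  proof (rule oproj_id[OF subspace_att])
    have "att p (\<gamma> n) \<subseteq> att q (\<gamma> n)"
      unfolding att_def using P.p(1) Q.p(2) le ray_carrier[OF \<gamma>(1)]
      by (intro axes_span_mono linear_rep bij_rep) auto
    then show "?e n \<in> att q (\<gamma> n)" using oproj_mem[OF subspace_att] by blast
  qed
  ultimately have "oproj (Q.xi (endpt \<gamma>)) e = e" using LIMSEQ_unique[OF _ e'] by simp
  then show "e \<in> boundary_map \<rho> q x" unfolding \<gamma>(2) using oproj_fixed_iff[OF Q.xi_ray(1)[OF \<gamma>(1)]] by blast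
qed

section \<open>Injectivity of the limit curve\<close>

text \<open>The right-hand side of the hypothesis grows at each step at most by the factor
  \<open>1 + D * E n\<close>, hence at most by \<open>exp (D * E n)\<close>.\<close>

lemma discrete_gronwall:
  fixes s E :: "nat \<Rightarrow> real"
  assumes s: "\<And>n. s n \<le> s 0 + D * (\<Sum>i<n. s i * E i)" and nn: "0 \<le> s 0" "0 \<le> D" "\<And>i. 0 \<le> E i"
    and B: "\<And>n. (\<Sum>i<n. E i) \<le> B"
  shows "s n \<le> s 0 * exp (D * B)"
proof -
  define T where "T n = s 0 + D * (\<Sum>i<n. s i * E i)" for n
  have T: "T n \<le> s 0 * exp (D * (\<Sum>i<n. E i))" for n
  proof (induction n)
    case (Suc n)
    have "T (Suc n) = T n + D * (s n * E n)" by (simp add: T_def algebra_simps)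
    also have "\<dots> \<le> T n + D * (T n * E n)"
      using s[of n] nn by (intro add_left_mono mult_left_mono mult_right_mono) (auto simp: T_def)
    also have "\<dots> = T n * (1 + D * E n)" by (simp add: algebra_simps)
    also have "\<dots> \<le> (s 0 * exp (D * (\<Sum>i<n. E i))) * exp (D * E n)"
    proof (rule mult_mono)
      show "T n \<le> s 0 * exp (D * (\<Sum>i<n. E i))" by (rule Suc.IH)
      show "1 + D * E n \<le> exp (D * E n)" by (rule exp_ge_add_one_self)
      show "0 \<le> s 0 * exp (D * (\<Sum>i<n. E i))" using nn by simp
      show "0 \<le> 1 + D * E n" using nn by (simp add: add_nonneg_nonneg)
    qed
    finally show ?case by (simp add: mult_exp_exp algebra_simps)
  qed (simp add: T_def)
  have "s n \<le> T n" using s by (simp add: T_def)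
  also have "\<dots> \<le> s 0 * exp (D * (\<Sum>i<n. E i))" by (rule T)
  also have "\<dots> \<le> s 0 * exp (D * B)" using B[of n] nn by (intro mult_left_mono) (auto intro: mult_left_mono)
  finally show ?thesis .
qed

lemma sigma_1_le:
  fixes g :: "'v::euclidean_space \<Rightarrow> 'v"
  assumes g: "linear g" "bij g" and K: "\<And>x. norm x = 1 \<Longrightarrow> norm (g x) \<le> K"
  shows "sigma 1 g \<le> K"
proof -
  obtain v u s where svd: "svd g v u s" using svd_obtain[OF g] by blast
  have n: "norm (v 0) = 1" "norm (u 0) = 1"
    using orthonormal_seqD[OF svdD(2)[OF svd], of 0 0] orthonormal_seqD[OF svdD(3)[OF svd], of 0 0]
    by (simp_all add: norm_eq_1)
  have "norm (g (v 0)) = s 0" using svdD(4,5)[OF svd, of 0] n by simp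
  then show ?thesis using K[OF n(1)] by (simp add: sigma_svd[OF svd])
qed

lemma line_eq_span:
  fixes F :: "'v::euclidean_space set"
  assumes "subspace F" "dim F = 1" "e \<in> F" "e \<noteq> 0"
  shows "F = span {e}"
proof -
  have "span {e} = F"
  proof (rule subspace_dim_equal)
    show "span {e} \<subseteq> F" using assms by (simp add: span_minimal)
    have "dim (span {e}) = 1" using assms(4) by (auto simp: dim_span)
    then show "dim F \<le> dim (span {e})" using assms(2) by simp
  qed (use assms in auto)
  then show ?thesis by simp
qed

lemma oproj_line:
  fixes F :: "'v::euclidean_space set"
  assumes "subspace F" "dim F = 1" "e \<in> F" "norm e = 1"
  shows "oproj F x = (x \<bullet> e) *\<^sub>R e"
proof (rule oproj_eqI[OF assms(1)])
  show "(x \<bullet> e) *\<^sub>R e \<in> F" using assms by (simp add: subspace_scale)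
  fix w assume w: "w \<in> F"
  have "e \<noteq> 0" using assms(4) by auto
  then have "F = span {e}" using line_eq_span assms by blast
  then obtain t where "w = t *\<^sub>R e" using w by (auto simp: span_singleton)
  then show "(x - (x \<bullet> e) *\<^sub>R e) \<bullet> w = 0"
    using assms(4) by (simp add: inner_diff_left norm_eq_1)
qed

lemma unit_vector_in_line:
  fixes F :: "'v::euclidean_space set"
  assumes "subspace F" "dim F = 1"
  obtains e where "e \<in> F" "norm e = 1"
proof -
  have "\<not> F \<subseteq> {0}" using assms(2) dim_eq_0[of F] by simp
  then obtain x where x: "x \<in> F" "x \<noteq> 0" by blast
  show ?thesis
    by (rule that[of "(1 / norm x) *\<^sub>R x"]) (use x assms in \<open>auto simp: subspace_scale\<close>)
qed

locale hyperbolic_anosov_1 = hyperbolic_group G S + anosov_rep G S \<rho> 1 c \<mu>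
  for G :: "('g, 'b) monoid_scheme" (structure) and S
    and \<rho> :: "'g \<Rightarrow> ('v::euclidean_space \<Rightarrow> 'v) set" and c \<mu>
begin

text \<open>Since \<open>k\<close> preserves the norm of one unit vector, it is \<open>rep t\<close>
  scaled by at most the norm of the inverse of \<open>rep t\<close>.\<close>

lemma norm_rep_le_cond:
  assumes t: "t \<in> carrier G" and k: "k \<in> \<rho> t" and e: "norm e = 1" "norm (k e) = 1"
  shows "norm (k x) \<le> cond t * norm x"
proof -
  obtain a where a: "a \<noteq> 0" "k = (\<lambda>x. a *\<^sub>R rep t x)" using rep_scale[OF t rep_mem[OF t] k] by blast
  have "e = inv_into UNIV (rep t) (rep t e)" using bij_rep[OF t] by (simp add: bij_is_inj)
  then have "1 \<le> sigma 1 (inv_into UNIV (rep t)) * norm (rep t e)"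
    using inv_rep_norm_le[OF t, of "rep t e"] e by simp
  moreover have "\<bar>a\<bar> * norm (rep t e) = 1" using e(2) a by simp
  ultimately have "\<bar>a\<bar> * 1 \<le> sigma 1 (inv_into UNIV (rep t)) * 1"
    by (metis abs_ge_zero mult.left_commute mult_left_mono)
  then have "\<bar>a\<bar> \<le> sigma 1 (inv_into UNIV (rep t))" by simp
  moreover have "norm (k x) \<le> \<bar>a\<bar> * (sigma 1 (rep t) * norm x)"
    unfolding a(2) using rep_norm_le[OF t, of x] by (simp add: mult_left_mono)
  moreover have "0 < sigma 1 (rep t)" by (rule sigma_rep_pos[OF t]) auto
  ultimately have "norm (k x) \<le> sigma 1 (inv_into UNIV (rep t)) * (sigma 1 (rep t) * norm x)"
    by (smt (verit) mult_right_mono mult_nonneg_nonneg norm_ge_zero)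
  then show ?thesis by (simp add: cond_def mult_ac)
qed

text \<open>If the limit lines of two separating rays agreed, then along one of them the cocycle would be
  block triangular with respect to the common line and its orthogonal complement. Normalised to be
  isometric on the line, its norm \<open>s n\<close> grows exponentially since the line is contracted, whereas the
  diagonal block transverse to the line is bounded by \<open>s n * exp (- \<mu> * n)\<close> since the line attracts.
  A discrete Gronwall estimate shows that this is impossible.\<close>

lemma xi_based_inj:
  assumes \<alpha>: "ray \<alpha>" "\<alpha> 0 = \<one>" and \<beta>: "ray \<beta>" "\<beta> 0 = \<one>" and ne: "endpt \<alpha> \<noteq> endpt \<beta>"
  shows "xi (endpt \<alpha>) \<noteq> xi (endpt \<beta>)"
proof
  assume eq: "xi (endpt \<alpha>) = xi (endpt \<beta>)"
  obtain e where e: "e \<in> xi (endpt \<alpha>)" "norm e = 1"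
    using unit_vector_in_line[OF xi_ray(1,2)[OF \<alpha>(1)]] by blast
  have e': "e \<in> xi (endpt \<beta>)" using e eq by simp
  have d1: "1 \<le> DIM('v)" "2 \<le> DIM('v)" using p by auto
  define E where "E n = exp (- \<mu> * real n)" for n :: nat
  have E: "0 < E n" for n by (simp add: E_def)
  have bc: "\<beta> n \<in> carrier G" for n by (rule ray_carrier[OF \<beta>(1)])
  have blen: "len (\<beta> n) = n" for n by (rule ray_len[OF \<beta>])
  \<comment> \<open>The cocycle is read backwards along \<open>\<beta>\<close>: left translation by
    \<open>b n\<close> brings \<open>\<beta> n\<close> to the identity.\<close>
  define b where "b n = inv (\<beta> n)" for n
  have b: "b n \<in> carrier G" "len (b n) = n" for n using bc blen by (auto simp: b_def len_inv)
  define h where "h n x = (1 / norm (rep (b n) e)) *\<^sub>R rep (b n) x" for n x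
  have ne0: "norm (rep (b n) e) \<noteq> 0" for n
    using bij_rep[OF b(1)] linear_rep[OF b(1)] e(2) by (metis bij_is_inj linear_injective_0 norm_eq_zero norm_zero zero_neq_one)
  have h: "h n \<in> \<rho> (b n)" for n
    unfolding h_def[abs_def] using ne0 by (intro rep_scaleR[OF b(1) rep_mem[OF b(1)]]) simp
  have lh: "linear (h n)" and bh: "bij (h n)" for n using rep_linear[OF b(1) h] rep_bij[OF b(1) h] by auto
  define en where "en n = h n e" for n
  have en: "norm (en n) = 1" for n using ne0[of n] by (simp add: en_def h_def)
  define s where "s n = sigma 1 (h n)" for n
  have s: "0 < s n" for n unfolding s_def using d1 by (intro sigma_pos lh bh) auto
  have hn: "norm (h n x) \<le> s n * norm x" for n x unfolding s_def by (intro norm_le_sigma_1 lh bh)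
  have s2: "sigma 2 (h n) \<le> c * E n * s n" for n
  proof -
    have "sigma (1 + 1) (h n) / sigma 1 (h n) \<le> c * E n" unfolding E_def using ratio_rep[OF b(1) h, of n] b(2) by simp
    then show ?thesis using s[of n] by (simp add: s_def pos_divide_le_eq numeral_2_eq_2)
  qed
  obtain C where C: "0 < C" and Cp:
    "\<And>w i t P. (\<And>j. i \<le> j \<Longrightarrow> w j \<in> carrier G \<and> real j + t \<le> real (len (w j))) \<Longrightarrow>
      (\<And>j. i \<le> j \<Longrightarrow> wd (w j) (w (Suc j)) \<le> 1) \<Longrightarrow> (\<lambda>n. oproj (att 1 (w n))) \<longlonglongrightarrow> P \<Longrightarrow>
      dist (oproj (att 1 (w i))) P \<le> C * exp (- \<mu> * (real i + t))"
    using xi_path_dist by metis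
  \<comment> \<open>The line of \<open>e\<close> is exponentially close to the attracting line of
    \<open>\<beta> n\<close>, which \<open>h n\<close>, representing the inverse, contracts by its
    smallest singular value, at most \<open>c * E n * s n\<close>. As \<open>h n e\<close> has norm
    \<open>1\<close>, the number \<open>s n\<close> must be large.\<close>
  have grow: "1 \<le> s n * (c + C) * E n" for n
  proof -
    let ?u = "oproj (att 1 (\<beta> n)) e"
    let ?i = "inv_into UNIV (h n)"
    have i: "?i \<in> \<rho> (\<beta> n)" using rep_inv[OF b(1) h, of n] bc by (simp add: b_def)
    have li: "linear ?i" "bij ?i" using rep_linear[OF bc i] rep_bij[OF bc i] by auto
    have "dist (oproj (att 1 (\<beta> n))) (oproj (xi (endpt \<beta>))) \<le> C * exp (- \<mu> * (real n + 0))"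
      by (rule Cp) (use \<beta> bc blen ray_step[OF \<beta>(1)] xi_ray[OF \<beta>(1)] in auto)
    then have "norm (e - ?u) \<le> C * E n"
      using norm_diff_oproj_le_dist[OF xi_ray(1)[OF \<beta>(1)] e', of "att 1 (\<beta> n)"] e(2)
      by (simp add: E_def dist_commute)
    then have 1: "norm (h n (e - ?u)) \<le> s n * (C * E n)"
      using hn[of n "e - ?u"] s[of n] by (meson less_imp_le mult_left_mono order_trans)
    have "?u \<in> axes_span 1 ?i"
      unfolding axes_span_rep[OF bc i order_refl d1(1)] by (rule oproj_mem[OF subspace_att])
    then have "?i (h n ?u) \<in> axes_span 1 ?i" using bh by (simp add: bij_is_inj)
    then have "sigma 1 ?i * norm (h n ?u) \<le> norm (?i (h n ?u))"
      by (rule axes_span_preimage_norm[OF li order_refl d1(1)])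
    also have "\<dots> \<le> 1" using norm_oproj_le[OF subspace_att, of 1 "\<beta> n" e] e(2) bh by (simp add: bij_is_inj)
    finally have "sigma 1 ?i * norm (h n ?u) \<le> 1" .
    moreover have "sigma 1 ?i = 1 / sigma (DIM('v)) (h n)"
      using sigma_inv_into[OF lh bh order_refl d1(1)] by simp
    moreover have "0 < sigma (DIM('v)) (h n)" using d1 by (intro sigma_pos lh bh) auto
    ultimately have "norm (h n ?u) / sigma (DIM('v)) (h n) \<le> 1" by simp
    then have "norm (h n ?u) \<le> sigma (DIM('v)) (h n)"
      using \<open>0 < sigma (DIM('v)) (h n)\<close> by (simp add: pos_divide_le_eq)
    also have "\<dots> \<le> sigma 2 (h n)" using d1 by (intro sigma_antimono lh bh) auto
    finally have 2: "norm (h n ?u) \<le> c * E n * s n" using s2[of n] by simp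
    have "h n e = h n (e - ?u) + h n ?u" by (simp add: linear_diff[OF lh])
    then have "1 \<le> norm (h n (e - ?u)) + norm (h n ?u)"
      using en[of n] norm_triangle_ineq[of "h n (e - ?u)" "h n ?u"] by (simp add: en_def)
    then show ?thesis using 1 2 by (simp add: algebra_simps)
  qed
  \<comment> \<open>The other ray enters here. Translated by \<open>b n\<close> it starts at
    \<open>b n\<close> and has word length at least \<open>n + k - c0\<close> at time
    \<open>k\<close>, so the attracting line of \<open>b n\<close> is exponentially close to the
    limit line \<open>F n\<close>, which contains \<open>en n\<close>.\<close>
  obtain c0 where c0: "\<And>n k. real n + real k - c0 \<le> wd (\<beta> n) (\<alpha> k)"
    using rays_diverge[OF \<alpha>(1) \<beta>(1) \<alpha>(2) \<beta>(2) ne] by blast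
  define F where "F n = xi (endpt (\<lambda>k. b n \<otimes> \<alpha> k))" for n
  have r: "ray (\<lambda>k. b n \<otimes> \<alpha> k)" for n by (rule ray_translate[OF \<alpha>(1) b(1)])
  have F: "subspace (F n)" "dim (F n) = 1" for n using xi_ray[OF r] by (auto simp: F_def)
  have "rep (b n) e \<in> F n" for n unfolding F_def by (rule rep_xi_mem[OF \<alpha>(1) b(1) e(1)])
  then have enF: "en n \<in> F n" for n unfolding en_def h_def by (intro subspace_scale F)
  define C2 where "C2 = c + C * exp (\<mu> * c0)"
  have C2: "0 < C2" using c C by (simp add: C2_def add_pos_pos)
  have block: "norm (h n x - (h n x \<bullet> en n) *\<^sub>R en n) \<le> C2 * s n * E n * norm x" for n x
  proof -
    let ?P = "oproj (att 1 (b n))" and ?Q = "oproj (F n)"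
    have "dist (oproj (att 1 (b n \<otimes> \<alpha> 0))) ?Q \<le> C * exp (- \<mu> * (real 0 + (real n - c0)))"
    proof (rule Cp)
      show "b n \<otimes> \<alpha> j \<in> carrier G \<and> real j + (real n - c0) \<le> real (len (b n \<otimes> \<alpha> j))" for j
        using c0[of n j] b(1) ray_carrier[OF \<alpha>(1)] by (simp add: word_dist_def b_def)
      show "wd (b n \<otimes> \<alpha> j) (b n \<otimes> \<alpha> (Suc j)) \<le> 1" for j by (rule ray_step[OF r])
      show "(\<lambda>k. oproj (att 1 (b n \<otimes> \<alpha> k))) \<longlonglongrightarrow> ?Q" unfolding F_def by (rule xi_ray[OF r])
    qed
    also have "C * exp (- \<mu> * (real 0 + (real n - c0))) = C * exp (\<mu> * c0) * E n"
      by (simp add: E_def mult_exp_exp algebra_simps)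
    finally have PQ: "dist ?P ?Q \<le> C * exp (\<mu> * c0) * E n" using b(1) \<alpha> by simp
    have "norm (h n x - oproj (axes_span 1 (h n)) (h n x)) \<le> sigma (1 + 1) (h n) * norm x"
      using p by (intro norm_diff_axes_span_le lh bh) auto
    then have 1: "norm (h n x - ?P (h n x)) \<le> c * E n * s n * norm x"
      using mult_right_mono[OF s2[of n] norm_ge_zero[of x]] axes_span_rep[OF b(1) h order_refl d1(1)]
      by (simp add: numeral_2_eq_2)
    have "norm ((?P - ?Q) (h n x)) \<le> dist ?P ?Q * norm (h n x)" by (simp add: dist_norm norm_blinfun)
    also have "\<dots> \<le> (C * exp (\<mu> * c0) * E n) * (s n * norm x)"
      using C E[of n] by (intro mult_mono PQ hn) auto
    finally have 2: "norm ((?P - ?Q) (h n x)) \<le> C * exp (\<mu> * c0) * E n * (s n * norm x)" .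
    have "h n x - (h n x \<bullet> en n) *\<^sub>R en n = (h n x - ?P (h n x)) + (?P - ?Q) (h n x)"
      using oproj_line[OF F enF en] by (simp add: minus_blinfun.rep_eq)
    then have "norm (h n x - (h n x \<bullet> en n) *\<^sub>R en n) \<le> norm (h n x - ?P (h n x)) + norm ((?P - ?Q) (h n x))"
      using norm_triangle_ineq by metis
    then show ?thesis using 1 2 by (simp add: C2_def algebra_simps)
  qed
  obtain K where K: "0 < K" "\<And>t. t \<in> carrier G \<Longrightarrow> len t \<le> 1 \<Longrightarrow> cond t \<le> K" using cond_bound by blast
  \<comment> \<open>The transition maps represent elements of length at most \<open>1\<close> and
    carry the unit vector \<open>en n\<close> to the unit vector \<open>en (Suc n)\<close>, so one
    constant bounds all their norms.\<close>
  define k where "k n = h (Suc n) \<circ> inv_into UNIV (h n)" for n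
  have kh: "k n (h n x) = h (Suc n) x" for n x using bh by (simp add: k_def bij_is_inj)
  have ken: "k n (en n) = en (Suc n)" for n by (simp add: en_def kh)
  have lk: "linear (k n)" for n
    unfolding k_def by (intro linear_compose lh inj_linear_imp_inv_linear bij_is_inj bh)
  have kn: "norm (k n x) \<le> K * norm x" for n x
  proof -
    let ?t = "b (Suc n) \<otimes> inv (b n)"
    have t: "?t \<in> carrier G" using b(1) by simp
    have "?t = inv (\<beta> (Suc n)) \<otimes> \<beta> n" using bc by (simp add: b_def)
    then have "real (len ?t) \<le> 1" using ray_wd[OF \<beta>(1), of "Suc n" n] by (simp add: word_dist_def)
    moreover have "k n \<in> \<rho> ?t" unfolding k_def using b(1) by (intro rep_mult h rep_inv) auto
    ultimately show ?thesis
      using norm_rep_le_cond[OF t, of "k n" "en n" x] K(2)[OF t] en ken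
      by (smt (verit) mult_right_mono norm_ge_zero of_nat_le_1_iff)
  qed
  have bound: "s n \<le> s 0 + (3 * K * C2) * (\<Sum>i<n. s i * E i)" for n
  proof (cases n)
    case (Suc m)
    show ?thesis unfolding s_def[of n]
    proof (rule sigma_1_le[OF lh bh])
      fix x :: 'v assume x: "norm x = 1"
      define a where "a i = h i x \<bullet> en i" for i
      define w where "w i = h i x - a i *\<^sub>R en i" for i
      have w: "norm (w i) \<le> C2 * (s i * E i)" for i
        using block[of i x] x by (simp add: w_def a_def mult_ac)
      have step: "h (Suc i) x = a i *\<^sub>R en (Suc i) + k i (w i)" for i
        by (simp add: w_def linear_diff[OF lk] linear_scale[OF lk] ken kh)
      have kw: "norm (k i (w i)) \<le> K * C2 * (s i * E i)" for i
        using order_trans[OF kn mult_left_mono[OF w less_imp_le[OF K(1)]]] by (simp only: mult.assoc)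
      \<comment> \<open>The coefficient along the line is carried over unchanged; it is altered only
        by the transverse part, of size at most a constant times \<open>s i * E i\<close>. Summation
        yields the hypothesis of the Gronwall estimate.\<close>
      have a_Suc: "a (Suc i) = a i + k i (w i) \<bullet> en (Suc i)" for i
        using en[of "Suc i"] by (simp add: a_def[of "Suc i"] step inner_add_left norm_eq_1)
      have ki: "\<bar>k i (w i) \<bullet> en (Suc i)\<bar> \<le> K * C2 * (s i * E i)" for i
        using Cauchy_Schwarz_ineq2[of "k i (w i)" "en (Suc i)"] en[of "Suc i"] kw[of i] by simp
      have a: "\<bar>a i\<bar> \<le> s 0 + K * C2 * (\<Sum>j<i. s j * E j)" for i
      proof (induction i)
        case 0
        show ?case using Cauchy_Schwarz_ineq2[of "h 0 x" "en 0"] en[of 0] hn[of 0 x] x by (simp add: a_def)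
      next
        case (Suc i)
        then show ?case using a_Suc[of i] ki[of i] by (simp add: algebra_simps)
      qed
      have "norm (h n x) \<le> \<bar>a m\<bar> + norm (k m (w m))"
        unfolding Suc step using norm_triangle_ineq[of "a m *\<^sub>R en (Suc m)" "k m (w m)"] en[of "Suc m"] by simp
      also have "\<dots> \<le> s 0 + K * C2 * (\<Sum>j<m. s j * E j) + K * C2 * (s m * E m)"
        using a[of m] kw[of m] by simp
      also have "\<dots> = s 0 + (K * C2) * (\<Sum>j<n. s j * E j)" by (simp add: Suc algebra_simps)
      also have "\<dots> \<le> s 0 + (3 * K * C2) * (\<Sum>j<n. s j * E j)"
        using K(1) C2 s E by (intro add_left_mono mult_right_mono sum_nonneg) (auto intro: less_imp_le)
      finally show "norm (h n x) \<le> s 0 + 3 * K * C2 * (\<Sum>i<n. s i * E i)" .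
    qed
  qed simp
  have sumE: "(\<Sum>i<n. E i) \<le> 1 / (1 - exp (- \<mu>))" for n
  proof -
    have "(\<Sum>i<n. E i) = (\<Sum>i<n. exp (- \<mu>) ^ i)" by (simp add: E_def flip: exp_of_nat_mult) (simp add: mult.commute)
    also have "\<dots> = (1 - exp (- \<mu>) ^ n) / (1 - exp (- \<mu>))" using mu by (subst sum_gp_strict) auto
    also have "\<dots> \<le> 1 / (1 - exp (- \<mu>))" using mu by (intro divide_right_mono) auto
    finally show ?thesis .
  qed
  have sb: "s n \<le> s 0 * exp (3 * K * C2 * (1 / (1 - exp (- \<mu>))))" for n
    by (rule discrete_gronwall[where E = E, OF bound _ _ _ sumE]) (use s K C2 E in \<open>auto intro: less_imp_le\<close>)
  \<comment> \<open>With \<open>s n\<close> bounded, \<open>grow\<close> keeps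
    \<open>B * E n\<close> at least \<open>1\<close> for all \<open>n\<close>, although it tends to
    \<open>0\<close>.\<close>
  define B where "B = s 0 * exp (3 * K * C2 * (1 / (1 - exp (- \<mu>)))) * (c + C)"
  have "(\<lambda>n. B * exp (- \<mu> * (real n + 0))) \<longlonglongrightarrow> 0" by (rule exp_decay)
  then have "\<forall>\<^sub>F n in sequentially. B * exp (- \<mu> * (real n + 0)) < 1" by (rule order_tendstoD) simp
  then obtain n where "B * E n < 1" by (auto simp: eventually_sequentially E_def)
  moreover have "s n * (c + C) * E n \<le> B * E n"
    unfolding B_def using sb[of n] c C E[of n] by (intro mult_right_mono) auto
  ultimately show False using grow[of n] by simp
qed

end

section \<open>Uniform transversality and secants of the limit curve\<close>

context anosov_rep
begin

text \<open>Starting points in a ball of radius \<open>K\<close> make the rate of convergence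
  uniform, so the limits along two rays that meet at time \<open>j\<close> differ by at most twice
  \<open>C * exp (- \<mu> * (j - K))\<close>.\<close>

lemma xi_tendsto:
  assumes A: "\<And>n. ray (A n)" "ray B" and K: "\<And>n. real (len (A n 0)) \<le> K"
    and ev: "\<And>j. \<forall>\<^sub>F n in sequentially. A n j = B j"
  shows "(\<lambda>n. oproj (xi (endpt (A n)))) \<longlonglongrightarrow> oproj (xi (endpt B))"
proof (rule tendstoI)
  fix e :: real assume e: "0 < e"
  obtain C where C: "0 < C"
    "\<And>w i t P. (\<And>j. i \<le> j \<Longrightarrow> w j \<in> carrier G \<and> real j + t \<le> real (len (w j))) \<Longrightarrow>
      (\<And>j. i \<le> j \<Longrightarrow> wd (w j) (w (Suc j)) \<le> 1) \<Longrightarrow> (\<lambda>n. oproj (att p (w n))) \<longlonglongrightarrow> P \<Longrightarrow>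
      dist (oproj (att p (w i))) P \<le> C * exp (- \<mu> * (real i + t))"
    using xi_path_dist by metis
  have "\<forall>\<^sub>F n in sequentially. A n 0 = B 0" by (rule ev)
  then obtain n0 where "A n0 0 = B 0" by (auto simp: eventually_sequentially)
  then have B0: "real (len (B 0)) \<le> K" using K[of n0] by simp
  have d: "dist (oproj (att p (w j))) (oproj (xi (endpt w))) \<le> C * exp (- \<mu> * (real j + - K))"
    if "ray w" "real (len (w 0)) \<le> K" for w j
  proof (rule C(2))
    show "w i \<in> carrier G \<and> real i + - K \<le> real (len (w i))" for i
      using ray_carrier[OF that(1), of i] ray_len_ge[OF that(1), of i] that(2) by simp
  qed (use that ray_step xi_ray(3) in auto)
  have "\<forall>\<^sub>F j in sequentially. C * exp (- \<mu> * (real j + - K)) < e / 2"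
    using e by (intro order_tendstoD(2)[OF exp_decay]) simp
  then obtain j where j: "C * exp (- \<mu> * (real j + - K)) < e / 2" by (auto simp: eventually_sequentially)
  show "\<forall>\<^sub>F n in sequentially. dist (oproj (xi (endpt (A n)))) (oproj (xi (endpt B))) < e"
    using ev[of j]
  proof eventually_elim
    case (elim n)
    then show ?case
      using d[OF A(1) K, of n j] d[OF A(2) B0, of j] j
        dist_triangle3[of "oproj (xi (endpt (A n)))" "oproj (xi (endpt B))" "oproj (att p (B j))"]
      by simp
  qed
qed

text \<open>The end of a long geodesic segment from the identity has almost the same attracting
  space as a point \<open>Z n j\<close> with \<open>j\<close> large but fixed, and that point
  eventually lies on \<open>B\<close>. The segments are controlled only up to \<open>M n\<close>,
  which eventually exceeds every fixed \<open>j\<close>.\<close>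

lemma att_geodesic_tendsto:
  assumes Z: "\<And>n i. i \<le> M n \<Longrightarrow> Z n i \<in> carrier G" "\<And>n. Z n 0 = \<one>"
    "\<And>n i j. i \<le> M n \<Longrightarrow> j \<le> M n \<Longrightarrow> wd (Z n i) (Z n j) = \<bar>real i - real j\<bar>"
    and M: "filterlim M at_top sequentially" and B: "ray B" "B 0 = \<one>"
    and ev: "\<And>j. \<forall>\<^sub>F n in sequentially. Z n j = B j"
  shows "(\<lambda>n. oproj (att p (Z n (M n)))) \<longlonglongrightarrow> oproj (xi (endpt B))"
proof (rule tendstoI)
  fix e :: real assume e: "0 < e"
  obtain C where C: "0 < C"
    "\<And>w i t P. (\<And>j. i \<le> j \<Longrightarrow> w j \<in> carrier G \<and> real j + t \<le> real (len (w j))) \<Longrightarrow>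
      (\<And>j. i \<le> j \<Longrightarrow> wd (w j) (w (Suc j)) \<le> 1) \<Longrightarrow> (\<lambda>n. oproj (att p (w n))) \<longlonglongrightarrow> P \<Longrightarrow>
      dist (oproj (att p (w i))) P \<le> C * exp (- \<mu> * (real i + t))"
    "\<And>w i m t. i \<le> m \<Longrightarrow> (\<And>j. i \<le> j \<Longrightarrow> j \<le> m \<Longrightarrow> w j \<in> carrier G \<and> real j + t \<le> real (len (w j))) \<Longrightarrow>
      (\<And>j. i \<le> j \<Longrightarrow> j < m \<Longrightarrow> wd (w j) (w (Suc j)) \<le> 1) \<Longrightarrow>
      dist (oproj (att p (w i))) (oproj (att p (w m))) \<le> C * exp (- \<mu> * (real i + t))"
    using xi_path_dist by blast
  have dB: "dist (oproj (att p (B j))) (oproj (xi (endpt B))) \<le> C * exp (- \<mu> * (real j + 0))" for j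
    by (rule C(2)) (use B ray_carrier ray_step xi_ray(3) ray_len[OF B] in auto)
  have lenZ: "len (Z n i) = i" if "i \<le> M n" for n i
    using Z(3)[of 0 n i] Z(2)[of n] wd_one[OF Z(1)[OF that]] that by simp
  have dZ: "dist (oproj (att p (Z n j))) (oproj (att p (Z n (M n)))) \<le> C * exp (- \<mu> * (real j + 0))" if "j \<le> M n" for n j
    by (rule C(3)) (use that Z lenZ in auto)
  have "\<forall>\<^sub>F j in sequentially. C * exp (- \<mu> * (real j + 0)) < e / 2"
    using e by (intro order_tendstoD(2)[OF exp_decay]) simp
  then obtain j where j: "C * exp (- \<mu> * (real j + 0)) < e / 2" by (auto simp: eventually_sequentially)
  have "\<forall>\<^sub>F n in sequentially. j \<le> M n" using M by (simp add: filterlim_at_top)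
  then show "\<forall>\<^sub>F n in sequentially. dist (oproj (att p (Z n (M n)))) (oproj (xi (endpt B))) < e"
    using ev[of j]
  proof eventually_elim
    case (elim n)
    then show ?case
      using dB[of j] dZ[OF elim(1)] j
        dist_triangle3[of "oproj (att p (Z n (M n)))" "oproj (xi (endpt B))" "oproj (att p (B j))"]
      by simp
  qed
qed

end

text \<open>An injective linear map on the plane of coefficients is bounded below; the factor
  \<open>1/2\<close> passes from the Euclidean norm to the sum of absolute values.\<close>

lemma linear_combination_bounded_below:
  fixes Q :: "'v::euclidean_space \<Rightarrow> 'w::euclidean_space"
  assumes Q: "linear Q" and inj: "\<And>s t. Q (s *\<^sub>R p + t *\<^sub>R q) = 0 \<Longrightarrow> s = 0 \<and> t = 0"
  obtains \<eta> where "0 < \<eta>" "\<And>s t. \<eta> * (\<bar>s\<bar> + \<bar>t\<bar>) \<le> norm (Q (s *\<^sub>R p + t *\<^sub>R q))"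
proof -
  define f where "f x = Q (fst x *\<^sub>R p + snd x *\<^sub>R q)" for x :: "real \<times> real"
  have lin: "linear f"
    unfolding f_def using Q
    by (intro linearI) (simp_all add: linear_add linear_scale algebra_simps)
  have "inj f"
    unfolding linear_injective_0[OF lin] by (auto simp: f_def prod_eq_iff dest: inj)
  then obtain B where B: "B > 0" "\<And>x. B * norm x \<le> norm (f x)"
    using linear_inj_bounded_below_pos[OF lin] by blast
  have "B / 2 * (\<bar>s\<bar> + \<bar>t\<bar>) \<le> norm (Q (s *\<^sub>R p + t *\<^sub>R q))" for s t
  proof -
    have "(\<bar>s\<bar> + \<bar>t\<bar>) / 2 \<le> norm (s, t)"
      using norm_fst_le[of "s" "t"] norm_snd_le[of "t" "s"] by simp
    then have "B * ((\<bar>s\<bar> + \<bar>t\<bar>) / 2) \<le> B * norm (s, t)" using B(1) by (intro mult_left_mono) auto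
    also have "\<dots> \<le> norm (f (s, t))" by (rule B(2))
    finally show ?thesis by (simp add: f_def)
  qed
  then show ?thesis using that[of "B / 2"] B(1) by simp
qed

text \<open>Rays from the identity to every boundary point are assumed here; for a spherical
  boundary their existence follows from the absence of isolated points.\<close>

locale hyperconvex_rep = hyperbolic_anosov_1 G S \<rho> c \<mu>
  for G :: "('g, 'b) monoid_scheme" (structure) and S
    and \<rho> :: "'g \<Rightarrow> ('v::euclidean_space \<Rightarrow> 'v) set" and c \<mu> +
  fixes r :: nat and c' \<mu>' :: real
  assumes r: "2 \<le> r" "r < DIM('v)" and c': "0 < c'" and mu': "0 < \<mu>'"
    and ratio_rep_r: "\<And>\<gamma> g. \<gamma> \<in> carrier G \<Longrightarrow> g \<in> \<rho> \<gamma> \<Longrightarrow>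
      sigma (r + 1) g / sigma r g \<le> c' * exp (- \<mu>' * real (word_length G S \<gamma>))"
    and hyperconvex_sum: "\<And>x y z. x \<in> boundary_points G S \<Longrightarrow> y \<in> boundary_points G S \<Longrightarrow>
      z \<in> boundary_points G S \<Longrightarrow> x \<noteq> y \<Longrightarrow> y \<noteq> z \<Longrightarrow> x \<noteq> z \<Longrightarrow>
      {u + v |u v. u \<in> boundary_map \<rho> 1 x \<and> v \<in> boundary_map \<rho> 1 y}
        \<inter> boundary_map \<rho> (DIM('v) - r) z = {0}"
    and based_ray_exists: "\<And>x. x \<in> boundary_points G S \<Longrightarrow>
      \<exists>\<gamma>. geodesic_ray G S \<gamma> \<and> \<gamma> 0 = \<one>\<^bsub>G\<^esub> \<and> ray_endpoint G S \<gamma> = x"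
begin

sublocale R: anosov_rep G S \<rho> r c' \<mu>'
  by unfold_locales (use r c' mu' ratio_rep_r in auto)

text \<open>The singular values of the inverse are the reciprocals in reverse order, and an element
  and its inverse have the same length.\<close>

lemma ratio_rep_dual:
  assumes \<gamma>: "\<gamma> \<in> carrier G" and g: "g \<in> \<rho> \<gamma>"
  shows "sigma (DIM('v) - r + 1) g / sigma (DIM('v) - r) g \<le> c' * exp (- \<mu>' * real (len \<gamma>))"
proof -
  have i: "inv_into UNIV g \<in> \<rho> (inv \<gamma>)" by (rule rep_inv[OF \<gamma> g])
  have ic: "inv \<gamma> \<in> carrier G" using \<gamma> by simp
  note li = rep_linear[OF ic i] and bi = rep_bij[OF ic i]
  have "inv_into UNIV (inv_into UNIV g) = g" by (rule inv_inv_eq[OF rep_bij[OF \<gamma> g]])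
  then have "sigma (DIM('v) - r + 1) g = 1 / sigma r (inv_into UNIV g)"
    "sigma (DIM('v) - r) g = 1 / sigma (r + 1) (inv_into UNIV g)"
    using r sigma_inv_into[OF li bi, of "DIM('v) - r + 1"] sigma_inv_into[OF li bi, of "DIM('v) - r"]
    by (simp_all add: Suc_diff_le)
  then show ?thesis using ratio_rep_r[OF ic i] \<gamma> by (simp add: len_inv)
qed

sublocale D: anosov_rep G S \<rho> "DIM('v) - r" c' \<mu>'
  by unfold_locales (use r c' mu' ratio_rep_dual in auto)

lemma xi_inj:
  assumes "x \<in> boundary_points G S" "y \<in> boundary_points G S" "x \<noteq> y"
  shows "xi x \<noteq> xi y"
  using based_ray_exists[OF assms(1)] based_ray_exists[OF assms(2)] xi_based_inj assms(3) by blast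

text \<open>Hyperconvexity only makes the combination vanish. That \<open>e\<close> and
  \<open>f\<close> are linearly independent is the injectivity of the limit map.\<close>

lemma hyperconvex_independent:
  assumes b: "x \<in> boundary_points G S" "y \<in> boundary_points G S" "z \<in> boundary_points G S"
    and ne: "x \<noteq> y" "y \<noteq> z" "x \<noteq> z" and e: "e \<in> xi x" "e \<noteq> 0" and f: "f \<in> xi y" "f \<noteq> 0"
    and mem: "s *\<^sub>R e + t *\<^sub>R f \<in> D.xi z"
  shows "s = 0 \<and> t = 0"
proof -
  note sx = subspace_xi[OF b(1)] and sy = subspace_xi[OF b(2)]
  have sz: "subspace (D.xi z)" by (rule D.subspace_xi[OF b(3)])
  have "s *\<^sub>R e \<in> xi x" "t *\<^sub>R f \<in> xi y" using e f sx sy by (auto intro: subspace_scale)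
  then have "s *\<^sub>R e + t *\<^sub>R f \<in> {u + v |u v. u \<in> xi x \<and> v \<in> xi y} \<inter> D.xi z" using mem by auto
  then have 0: "s *\<^sub>R e + t *\<^sub>R f = 0" using hyperconvex_sum[OF b ne] by blast
  have xy: "xi x = span {e}" "xi y = span {f}"
    using line_eq_span[OF sx dim_xi[OF b(1)] e] line_eq_span[OF sy dim_xi[OF b(2)] f] by auto
  have "s = 0"
  proof (rule ccontr)
    assume s: "s \<noteq> 0"
    have "s *\<^sub>R e = (- t) *\<^sub>R f" using 0 by (simp add: eq_neg_iff_add_eq_0)
    then have "(1 / s) *\<^sub>R (s *\<^sub>R e) = (1 / s) *\<^sub>R ((- t) *\<^sub>R f)" by (rule arg_cong)
    then have "e = (- t / s) *\<^sub>R f" using s by simp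
    then have "e \<in> xi y" using subspace_scale[OF sy f(1), of "- t / s"] by metis
    then have "xi y = span {e}" using line_eq_span[OF sy dim_xi[OF b(2)] _ e(2)] by simp
    then show False using xi_inj[OF b(1,2) ne(1)] xy by simp
  qed
  then show ?thesis using 0 f(2) by simp
qed

text \<open>A configuration seen from the point where two rays separate: \<open>A\<close> and \<open>B\<close> follow the two
  rays forward and \<open>Z\<close> goes back to the origin.\<close>

definition split_config :: "real \<Rightarrow> (nat \<Rightarrow> 'g) \<Rightarrow> (nat \<Rightarrow> 'g) \<Rightarrow> (nat \<Rightarrow> 'g) \<Rightarrow> nat \<Rightarrow> bool" where
  "split_config \<kappa> A B Z M \<longleftrightarrow> ray A \<and> A 0 = \<one> \<and> ray B \<and> real (len (B 0)) \<le> \<kappa> \<and>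
     (\<forall>i\<le>M. Z i \<in> carrier G) \<and> Z 0 = \<one> \<and> (\<forall>i\<le>M. \<forall>j\<le>M. wd (Z i) (Z j) = \<bar>real i - real j\<bar>) \<and>
     (\<forall>j. 2 * real j - 2 \<le> wd (A j) (B j)) \<and>
     (\<forall>j\<le>M. 2 * real j \<le> wd (Z j) (A j) \<and> 2 * real j \<le> wd (Z j) (B j))"

text \<open>At each time the three paths lie in a fixed finite ball, which allows a diagonal
  subsequence. The metric conditions involve at most two indices at a time and pass to the limit,
  where linear divergence makes the endpoints distinct.\<close>

lemma split_config_limit:
  assumes conf: "\<And>n. split_config \<kappa> (A n) (B n) (Z n) (M n)" and M: "\<And>n. n \<le> M n"
  obtains \<phi> A' B' Z' where "strict_mono (\<phi> :: nat \<Rightarrow> nat)" "ray A'" "ray B'" "ray Z'" "Z' 0 = \<one>"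
    "endpt A' \<noteq> endpt B'" "endpt B' \<noteq> endpt Z'" "endpt A' \<noteq> endpt Z'"
    "\<And>j. \<forall>\<^sub>F n in sequentially. A (\<phi> n) j = A' j \<and> B (\<phi> n) j = B' j \<and> Z (\<phi> n) j = Z' j"
proof -
  note c = conf[unfolded split_config_def]
  have A: "ray (A n)" "A n 0 = \<one>" and B: "ray (B n)" "real (len (B n 0)) \<le> \<kappa>"
    and Z: "i \<le> M n \<Longrightarrow> Z n i \<in> carrier G" "Z n 0 = \<one>"
       "i \<le> M n \<Longrightarrow> j \<le> M n \<Longrightarrow> wd (Z n i) (Z n j) = \<bar>real i - real j\<bar>"
    and AB: "2 * real j - 2 \<le> wd (A n j) (B n j)"
    and ZA: "j \<le> M n \<Longrightarrow> 2 * real j \<le> wd (Z n j) (A n j)" and ZB: "j \<le> M n \<Longrightarrow> 2 * real j \<le> wd (Z n j) (B n j)"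
    for n i j
    using c[of n] by auto
  \<comment> \<open>Nothing is known about \<open>Z n\<close> beyond \<open>M n\<close>, so it is
    frozen there; each fixed \<open>j\<close> is eventually below \<open>M n\<close>.\<close>
  define f where "f n j = (A n j, B n j, Z n (min j (M n)))" for n j
  obtain L :: nat where L: "\<kappa> \<le> real L" using real_arch_simple by blast
  have fin: "finite (range (\<lambda>n. f n j))" for j
  proof (rule finite_subset)
    let ?F = "{g \<in> carrier G. len g \<le> L + j}"
    show "range (\<lambda>n. f n j) \<subseteq> ?F \<times> ?F \<times> ?F"
    proof (rule image_subsetI)
      fix n
      have 1: "len (A n j) \<le> L + j" using ray_len[OF A, of n j] by simp
      have "real (len (B n j)) \<le> \<kappa> + real j"
        using len_diff_le_wd[of "B n j" "B n 0"] ray_carrier[OF B(1)] ray_wd[OF B(1), of n j 0] B(2)[of n] by simp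
      then have 2: "len (B n j) \<le> L + j" using L by linarith
      have "real (len (Z n (min j (M n)))) = real (min j (M n))"
        using Z(3)[of 0 n "min j (M n)"] Z(2)[of n] wd_one[OF Z(1)[of "min j (M n)" n]] by simp
      then have 3: "len (Z n (min j (M n))) \<le> L + j" by linarith
      show "f n j \<in> ?F \<times> ?F \<times> ?F" unfolding f_def
        using 1 2 3 ray_carrier[OF A(1)] ray_carrier[OF B(1)] Z(1)[of "min j (M n)" n] by simp
    qed
    show "finite (?F \<times> ?F \<times> ?F)" by (intro finite_cartesian_product finite_len_le)
  qed
  obtain \<phi> F where \<phi>: "strict_mono (\<phi> :: nat \<Rightarrow> nat)" and F: "\<And>j. \<forall>\<^sub>F n in sequentially. f (\<phi> n) j = F j"
    by (rule pointwise_convergent_subsequence[of f, OF fin]) (rule that)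
  define A' where "A' j = fst (F j)" for j
  define B' where "B' j = fst (snd (F j))" for j
  define Z' where "Z' j = snd (snd (F j))" for j
  have Mle: "\<forall>\<^sub>F n in sequentially. j \<le> M (\<phi> n)" for j
    using eventually_ge_at_top[of j]
  proof eventually_elim
    case (elim n)
    then show ?case using M[of "\<phi> n"] seq_suble[OF \<phi>, of n] by linarith
  qed
  have ev: "\<forall>\<^sub>F n in sequentially. A (\<phi> n) j = A' j \<and> B (\<phi> n) j = B' j \<and> Z (\<phi> n) j = Z' j \<and> j \<le> M (\<phi> n)" for j
    using F[of j] Mle[of j]
  proof eventually_elim
    case (elim n)
    then have "F j = (A (\<phi> n) j, B (\<phi> n) j, Z (\<phi> n) j)" by (simp add: f_def min_def)
    then show ?case using elim(2) by (simp add: A'_def B'_def Z'_def)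
  qed
  \<comment> \<open>Two indices are realised by the same \<open>n\<close>, as is needed to read off
    distances.\<close>
  have ev2: "\<exists>n. A n i = A' i \<and> B n i = B' i \<and> Z n i = Z' i \<and> i \<le> M n \<and>
      A n j = A' j \<and> B n j = B' j \<and> Z n j = Z' j \<and> j \<le> M n" for i j
  proof -
    have "\<forall>\<^sub>F n in sequentially. (A (\<phi> n) i = A' i \<and> B (\<phi> n) i = B' i \<and> Z (\<phi> n) i = Z' i \<and> i \<le> M (\<phi> n)) \<and>
      (A (\<phi> n) j = A' j \<and> B (\<phi> n) j = B' j \<and> Z (\<phi> n) j = Z' j \<and> j \<le> M (\<phi> n))"
      by (rule eventually_conj[OF ev ev])
    then have "\<exists>n. (A (\<phi> n) i = A' i \<and> B (\<phi> n) i = B' i \<and> Z (\<phi> n) i = Z' i \<and> i \<le> M (\<phi> n)) \<and>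
      (A (\<phi> n) j = A' j \<and> B (\<phi> n) j = B' j \<and> Z (\<phi> n) j = Z' j \<and> j \<le> M (\<phi> n))"
      by (auto simp: eventually_sequentially)
    then show ?thesis by blast
  qed
  have rA: "ray A'" unfolding geodesic_ray_def
  proof (intro conjI allI)
    fix i j
    obtain n where n: "A n i = A' i" "A n j = A' j" using ev2[of i j] by blast
    show "A' i \<in> carrier G" using n ray_carrier[OF A(1), of n i] by simp
    show "wd (A' i) (A' j) = \<bar>real i - real j\<bar>" using n ray_wd[OF A(1), of n i j] by simp
  qed
  have rB: "ray B'" unfolding geodesic_ray_def
  proof (intro conjI allI)
    fix i j
    obtain n where n: "B n i = B' i" "B n j = B' j" using ev2[of i j] by blast
    show "B' i \<in> carrier G" using n ray_carrier[OF B(1), of n i] by simp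
    show "wd (B' i) (B' j) = \<bar>real i - real j\<bar>" using n ray_wd[OF B(1), of n i j] by simp
  qed
  have rZ: "ray Z'" unfolding geodesic_ray_def
  proof (intro conjI allI)
    fix i j
    obtain n where n: "Z n i = Z' i" "i \<le> M n" "Z n j = Z' j" "j \<le> M n" using ev2[of i j] by blast
    show "Z' i \<in> carrier G" using n Z(1)[of i n] by simp
    show "wd (Z' i) (Z' j) = \<bar>real i - real j\<bar>" using n Z(3)[of i n j] by simp
  qed
  have Z0: "Z' 0 = \<one>"
  proof -
    obtain n where "Z n 0 = Z' 0" using ev2[of 0 0] by blast
    then show ?thesis using Z(2)[of n] by simp
  qed
  have unb: "endpt \<alpha> \<noteq> endpt \<beta>" if ab: "ray \<alpha>" "ray \<beta>" "\<And>j. 2 * real j - 2 \<le> wd (\<alpha> j) (\<beta> j)" for \<alpha> \<beta>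
  proof
    assume "endpt \<alpha> = endpt \<beta>"
    then obtain C where C: "\<And>n. wd (\<alpha> n) (\<beta> n) \<le> C" using endpt_eq_iff[OF ab(1,2)] by blast
    obtain j :: nat where "C + 2 \<le> real j" using real_arch_simple by blast
    then show False using C[of j] ab(3)[of j] wd_nonneg[of "\<alpha> j" "\<beta> j"] by linarith
  qed
  have "endpt A' \<noteq> endpt B'"
  proof (rule unb[OF rA rB])
    fix j
    obtain n where n: "A n j = A' j" "B n j = B' j" using ev2[of j j] by blast
    show "2 * real j - 2 \<le> wd (A' j) (B' j)" using AB[of j n] n by simp
  qed
  moreover have "endpt Z' \<noteq> endpt B'"
  proof (rule unb[OF rZ rB])
    fix j
    obtain n where n: "Z n j = Z' j" "B n j = B' j" "j \<le> M n" using ev2[of j j] by blast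
    show "2 * real j - 2 \<le> wd (Z' j) (B' j)" using ZB[of j n] n by simp
  qed
  moreover have "endpt Z' \<noteq> endpt A'"
  proof (rule unb[OF rZ rA])
    fix j
    obtain n where n: "Z n j = Z' j" "A n j = A' j" "j \<le> M n" using ev2[of j j] by blast
    show "2 * real j - 2 \<le> wd (Z' j) (A' j)" using ZA[of j n] n by simp
  qed
  moreover have "\<forall>\<^sub>F n in sequentially. A (\<phi> n) j = A' j \<and> B (\<phi> n) j = B' j \<and> Z (\<phi> n) j = Z' j" for j
    using ev[of j] by eventually_elim simp
  ultimately show ?thesis by (intro that[OF \<phi> rA rB rZ Z0]) auto
qed

text \<open>Compactness: configurations violating the bound would subconverge to three rays with
  distinct endpoints, where hyperconvexity gives a definite angle. The same \<open>n\<close> makes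
  the violated bound tend to \<open>0\<close> and forces \<open>M\<close> to infinity.\<close>

lemma uniform_transversality:
  obtains \<epsilon> N where "0 < \<epsilon>" "\<And>A B Z M e f. split_config \<kappa> A B Z M \<Longrightarrow> N \<le> M \<Longrightarrow>
    e \<in> xi (endpt A) \<Longrightarrow> f \<in> xi (endpt B) \<Longrightarrow>
    \<epsilon> * norm (e + f) \<le> norm ((e + f) - oproj (att (DIM('v) - r) (Z M)) (e + f))"
proof -
  let ?d = "DIM('v) - r"
  have "\<exists>n. \<forall>A B Z M e f. split_config \<kappa> A B Z M \<longrightarrow> n \<le> M \<longrightarrow> e \<in> xi (endpt A) \<longrightarrow> f \<in> xi (endpt B) \<longrightarrow>
    1 / (real n + 1) * norm (e + f) \<le> norm ((e + f) - oproj (att ?d (Z M)) (e + f))"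
  proof (rule ccontr)
    assume "\<not> ?thesis"
    then have "\<forall>n. \<exists>A B Z M e f. split_config \<kappa> A B Z M \<and> n \<le> M \<and> e \<in> xi (endpt A) \<and> f \<in> xi (endpt B) \<and>
      norm ((e + f) - oproj (att ?d (Z M)) (e + f)) < 1 / (real n + 1) * norm (e + f)"
      by (simp add: not_le)
    then obtain A B Z M e f where conf: "\<And>n. split_config \<kappa> (A n) (B n) (Z n) (M n)" and M: "\<And>n. n \<le> M n"
      and e: "\<And>n. e n \<in> xi (endpt (A n))" and f: "\<And>n. f n \<in> xi (endpt (B n))"
      and lt: "\<And>n. norm ((e n + f n) - oproj (att ?d (Z n (M n))) (e n + f n)) < 1 / (real n + 1) * norm (e n + f n)"
      by metis
    obtain \<phi> A' B' Z' where \<phi>: "strict_mono (\<phi> :: nat \<Rightarrow> nat)" and rays: "ray A'" "ray B'" "ray Z'" "Z' 0 = \<one>"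
      and ne: "endpt A' \<noteq> endpt B'" "endpt B' \<noteq> endpt Z'" "endpt A' \<noteq> endpt Z'"
      and ev: "\<And>j. \<forall>\<^sub>F n in sequentially. A (\<phi> n) j = A' j \<and> B (\<phi> n) j = B' j \<and> Z (\<phi> n) j = Z' j"
      using split_config_limit[OF conf M] by blast
    note cf = conf[unfolded split_config_def]
    have rA: "ray (A n)" "A n 0 = \<one>" and rB: "ray (B n)" "real (len (B n 0)) \<le> \<kappa>" for n
      using cf[of n] by auto
    have limA: "(\<lambda>n. oproj (xi (endpt (A (\<phi> n))))) \<longlonglongrightarrow> oproj (xi (endpt A'))"
      by (rule xi_tendsto[where K = 0]) (use rA rays in \<open>auto intro: eventually_mono[OF ev]\<close>)
    have limB: "(\<lambda>n. oproj (xi (endpt (B (\<phi> n))))) \<longlonglongrightarrow> oproj (xi (endpt B'))"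
      by (rule xi_tendsto[where K = \<kappa>]) (use rB rays in \<open>auto intro: eventually_mono[OF ev]\<close>)
    have Mtop: "filterlim (\<lambda>n. M (\<phi> n)) at_top sequentially"
      by (rule filterlim_at_top_mono[OF filterlim_ident])
        (intro always_eventually allI order_trans[OF seq_suble[OF \<phi>] M])
    have limZ: "(\<lambda>n. oproj (att ?d (Z (\<phi> n) (M (\<phi> n))))) \<longlonglongrightarrow> oproj (D.xi (endpt Z'))"
      by (rule D.att_geodesic_tendsto[OF _ _ _ Mtop rays(3,4)])
        (use cf in \<open>auto intro: eventually_mono[OF ev]\<close>)
    obtain p0 where p0: "p0 \<in> xi (endpt A')" "norm p0 = 1"
      using unit_vector_in_line[OF xi_ray(1,2)[OF rays(1)]] by blast
    obtain q0 where q0: "q0 \<in> xi (endpt B')" "norm q0 = 1"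
      using unit_vector_in_line[OF xi_ray(1,2)[OF rays(2)]] by blast
    define Q where "Q x = x - oproj (D.xi (endpt Z')) x" for x
    have linQ: "linear Q" unfolding Q_def
      by (intro linear_compose_sub linear_ident bounded_linear.linear[OF blinfun.bounded_linear_right])
    have "s = 0 \<and> t = 0" if "Q (s *\<^sub>R p0 + t *\<^sub>R q0) = 0" for s t
    proof (rule hyperconvex_independent[OF endpt_boundary[OF rays(1)] endpt_boundary[OF rays(2)]
          endpt_boundary[OF rays(3)] ne p0(1) _ q0(1)])
      show "s *\<^sub>R p0 + t *\<^sub>R q0 \<in> D.xi (endpt Z')"
        using that oproj_fixed_iff[OF D.xi_ray(1)[OF rays(3)], of "s *\<^sub>R p0 + t *\<^sub>R q0"] by (simp add: Q_def)
    qed (use p0(2) q0(2) in auto)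
    \<comment> \<open>Transversality of the limit, expressed through coefficients: the vectors
      \<open>e n\<close> and \<open>f n\<close> need not converge, only their lines do.\<close>
    then obtain \<eta> where eta: "0 < \<eta>" "\<And>s t. \<eta> * (\<bar>s\<bar> + \<bar>t\<bar>) \<le> norm (Q (s *\<^sub>R p0 + t *\<^sub>R q0))"
      using linear_combination_bounded_below[OF linQ] by metis
    define Qn where "Qn n x = x - oproj (att ?d (Z (\<phi> n) (M (\<phi> n)))) x" for n x
    \<comment> \<open>Projecting the limit generators gives convergent generators of the lines
      without any choice of sign.\<close>
    define pn where "pn n = oproj (xi (endpt (A (\<phi> n)))) p0" for n
    define qn where "qn n = oproj (xi (endpt (B (\<phi> n)))) q0" for n
    have lp: "pn \<longlonglongrightarrow> p0"
      using blinfun.tendsto[OF limA tendsto_const, of p0] oproj_id[OF xi_ray(1)[OF rays(1)] p0(1)] by (simp add: pn_def[abs_def])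
    have lq: "qn \<longlonglongrightarrow> q0"
      using blinfun.tendsto[OF limB tendsto_const, of q0] oproj_id[OF xi_ray(1)[OF rays(2)] q0(1)] by (simp add: qn_def[abs_def])
    have Qp: "(\<lambda>n. Qn n (pn n)) \<longlonglongrightarrow> Q p0" "(\<lambda>n. Qn n (qn n)) \<longlonglongrightarrow> Q q0"
      unfolding Qn_def Q_def by (intro tendsto_intros lp lq limZ)+
    have "\<forall>\<^sub>F n in sequentially. dist (Qn n (pn n)) (Q p0) < \<eta> / 2" "\<forall>\<^sub>F n in sequentially. dist (Qn n (qn n)) (Q q0) < \<eta> / 2"
      using eta(1) by (intro tendstoD[OF Qp(1)] tendstoD[OF Qp(2)]; simp)+
    moreover have "\<forall>\<^sub>F n in sequentially. pn n \<noteq> 0" "\<forall>\<^sub>F n in sequentially. qn n \<noteq> 0"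
      using tendsto_imp_eventually_ne[OF lp] tendsto_imp_eventually_ne[OF lq] p0(2) q0(2) by force+
    moreover have "\<forall>\<^sub>F n in sequentially. 1 / (real n + 1) < \<eta> / 2"
      using eta(1) by real_asymp
    ultimately have "\<forall>\<^sub>F n in sequentially. False"
    proof eventually_elim
      case (elim n)
      have "pn n \<in> xi (endpt (A (\<phi> n)))" "qn n \<in> xi (endpt (B (\<phi> n)))"
        unfolding pn_def qn_def by (intro oproj_mem xi_ray rA rB)+
      then have "xi (endpt (A (\<phi> n))) = span {pn n}" "xi (endpt (B (\<phi> n))) = span {qn n}"
        using elim by (intro line_eq_span xi_ray rA rB; simp)+
      then obtain s t where st: "e (\<phi> n) = s *\<^sub>R pn n" "f (\<phi> n) = t *\<^sub>R qn n"
        using e[of "\<phi> n"] f[of "\<phi> n"] by (auto simp: span_singleton)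
      let ?v = "s *\<^sub>R pn n + t *\<^sub>R qn n"
      have nv: "norm ?v \<le> \<bar>s\<bar> + \<bar>t\<bar>"
      proof -
        have "norm (pn n) \<le> 1" "norm (qn n) \<le> 1"
          unfolding pn_def qn_def using p0(2) q0(2) norm_oproj_le[OF xi_ray(1)[OF rA(1)], of "\<phi> n" p0]
            norm_oproj_le[OF xi_ray(1)[OF rB(1)], of "\<phi> n" q0] by simp_all
        then have "\<bar>s\<bar> * norm (pn n) \<le> \<bar>s\<bar> * 1" "\<bar>t\<bar> * norm (qn n) \<le> \<bar>t\<bar> * 1" by (intro mult_left_mono; simp)+
        then show ?thesis using norm_triangle_ineq[of "s *\<^sub>R pn n" "t *\<^sub>R qn n"] by simp
      qed
      have "Q (s *\<^sub>R p0 + t *\<^sub>R q0) = Qn n ?v - (s *\<^sub>R (Qn n (pn n) - Q p0) + t *\<^sub>R (Qn n (qn n) - Q q0))"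
        by (simp add: Q_def Qn_def blinfun.bilinear_simps algebra_simps)
      then have "\<eta> * (\<bar>s\<bar> + \<bar>t\<bar>) \<le> norm (Qn n ?v) + norm (s *\<^sub>R (Qn n (pn n) - Q p0) + t *\<^sub>R (Qn n (qn n) - Q q0))"
        using eta(2)[of s t] norm_triangle_ineq4 by (metis order_trans)
      also have "\<dots> \<le> norm (Qn n ?v) + (\<bar>s\<bar> * (\<eta> / 2) + \<bar>t\<bar> * (\<eta> / 2))"
      proof (intro add_left_mono order_trans[OF norm_triangle_ineq] add_mono)
        show "norm (s *\<^sub>R (Qn n (pn n) - Q p0)) \<le> \<bar>s\<bar> * (\<eta> / 2)"
          unfolding norm_scaleR using elim by (intro mult_left_mono) (auto simp: dist_norm)
        show "norm (t *\<^sub>R (Qn n (qn n) - Q q0)) \<le> \<bar>t\<bar> * (\<eta> / 2)"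
          unfolding norm_scaleR using elim by (intro mult_left_mono) (auto simp: dist_norm)
      qed
      finally have "\<eta> / 2 * (\<bar>s\<bar> + \<bar>t\<bar>) \<le> norm (Qn n ?v)" by (simp add: algebra_simps)
      moreover have "\<eta> / 2 * norm ?v \<le> \<eta> / 2 * (\<bar>s\<bar> + \<bar>t\<bar>)" using nv eta(1) by (intro mult_left_mono) auto
      moreover have "norm (Qn n ?v) < 1 / (real (\<phi> n) + 1) * norm ?v"
        using lt[of "\<phi> n"] st by (simp add: Qn_def)
      moreover have "1 / (real (\<phi> n) + 1) * norm ?v \<le> \<eta> / 2 * norm ?v"
      proof (rule mult_right_mono)
        have "1 / (real (\<phi> n) + 1) \<le> 1 / (real n + 1)" using seq_suble[OF \<phi>, of n] by (intro divide_left_mono) auto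
        then show "1 / (real (\<phi> n) + 1) \<le> \<eta> / 2" using elim by linarith
      qed simp
      ultimately show False by linarith
    qed
    then show False by simp
  qed
  then obtain n where n: "\<forall>A B Z M e f. split_config \<kappa> A B Z M \<longrightarrow> n \<le> M \<longrightarrow> e \<in> xi (endpt A) \<longrightarrow> f \<in> xi (endpt B) \<longrightarrow>
    1 / (real n + 1) * norm (e + f) \<le> norm ((e + f) - oproj (att ?d (Z M)) (e + f))" by blast
  show ?thesis by (rule that[of "1 / (real n + 1)" n]) (use n in auto)
qed

text \<open>Let \<open>h\<close> represent \<open>\<alpha> T\<close> and let \<open>v = h y\<close>
  be the secant. The angle of \<open>y\<close> with the repelling space bounds
  \<open>sigma r h * \<epsilon> * norm y\<close> by \<open>norm v\<close>, while the part of
  \<open>v\<close> off the attracting space is at most \<open>sigma (r + 1) h * norm y\<close>. The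
  quotient is governed by the singular value ratio at \<open>\<alpha> T\<close>. Replacing the
  attracting space by its limit costs a term of the same order.\<close>

lemma secant_decay:
  obtains C where "0 < C" "\<And>\<alpha> \<beta> T e f. ray \<alpha> \<Longrightarrow> \<alpha> 0 = \<one> \<Longrightarrow> ray \<beta> \<Longrightarrow> \<beta> 0 = \<one> \<Longrightarrow>
    wd (\<alpha> T) (\<beta> T) \<le> \<kappa> \<Longrightarrow> \<forall>n>T. 2 * (real n - real T - 1) \<le> wd (\<alpha> n) (\<beta> n) \<Longrightarrow>
    e \<in> xi (endpt \<alpha>) \<Longrightarrow> f \<in> xi (endpt \<beta>) \<Longrightarrow>
    norm ((e + f) - oproj (R.xi (endpt \<alpha>)) (e + f)) \<le> C * exp (- \<mu>' * real T) * norm (e + f)"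
proof -
  let ?d = "DIM('v) - r"
  obtain \<epsilon> N where eps: "0 < \<epsilon>" and tr: "\<And>A B Z M e f. split_config \<kappa> A B Z M \<Longrightarrow> N \<le> M \<Longrightarrow>
    e \<in> xi (endpt A) \<Longrightarrow> f \<in> xi (endpt B) \<Longrightarrow>
    \<epsilon> * norm (e + f) \<le> norm ((e + f) - oproj (att ?d (Z M)) (e + f))"
    using uniform_transversality by blast
  obtain C0 where C0: "0 < C0"
    "\<And>w i t P. (\<And>j. i \<le> j \<Longrightarrow> w j \<in> carrier G \<and> real j + t \<le> real (len (w j))) \<Longrightarrow>
      (\<And>j. i \<le> j \<Longrightarrow> wd (w j) (w (Suc j)) \<le> 1) \<Longrightarrow> (\<lambda>n. oproj (att r (w n))) \<longlonglongrightarrow> P \<Longrightarrow>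
      dist (oproj (att r (w i))) P \<le> C0 * exp (- \<mu>' * (real i + t))"
    using R.xi_path_dist by metis
  define C where "C = max (exp (\<mu>' * N)) (c' / \<epsilon> + C0)"
  show ?thesis
  proof (rule that[of C])
    show "0 < C" by (simp add: C_def less_max_iff_disj)
    fix \<alpha> \<beta> T e f
    assume \<alpha>: "ray \<alpha>" "\<alpha> 0 = \<one>" and \<beta>: "ray \<beta>" "\<beta> 0 = \<one>" and T: "wd (\<alpha> T) (\<beta> T) \<le> \<kappa>"
      "\<forall>n>T. 2 * (real n - real T - 1) \<le> wd (\<alpha> n) (\<beta> n)"
      and e: "e \<in> xi (endpt \<alpha>)" and f: "f \<in> xi (endpt \<beta>)"
    let ?v = "e + f"
    show "norm (?v - oproj (R.xi (endpt \<alpha>)) ?v) \<le> C * exp (- \<mu>' * real T) * norm ?v"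
    proof (cases "N \<le> T")
      case False
      have "norm (?v - oproj (R.xi (endpt \<alpha>)) ?v) \<le> 1 * norm ?v"
        using norm_diff_oproj_le_norm[OF R.xi_ray(1)[OF \<alpha>(1)], of ?v] by simp
      also have "\<dots> \<le> (C * exp (- \<mu>' * real T)) * norm ?v"
      proof (rule mult_right_mono)
        have "1 \<le> exp (\<mu>' * N) * exp (- \<mu>' * real T)" using False mu' by (simp add: mult_exp_exp algebra_simps)
        also have "\<dots> \<le> C * exp (- \<mu>' * real T)" by (intro mult_right_mono) (auto simp: C_def)
        finally show "1 \<le> C * exp (- \<mu>' * real T)" .
      qed simp
      finally show ?thesis .
    next
      case True
      let ?\<gamma> = "\<alpha> T"
      define g where "g = inv ?\<gamma>"
      have \<gamma>: "?\<gamma> \<in> carrier G" by (rule ray_carrier[OF \<alpha>(1)])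
      have g: "g \<in> carrier G" using \<gamma> by (simp add: g_def)
      note car = ray_carrier[OF \<alpha>(1)] ray_carrier[OF \<beta>(1)]
      define A where "A j = g \<otimes> \<alpha> (T + j)" for j
      define B where "B j = g \<otimes> \<beta> (T + j)" for j
      define Z where "Z j = g \<otimes> \<alpha> (T - j)" for j
      have rA: "ray A" unfolding A_def[abs_def] by (intro ray_translate ray_shift \<alpha> g)
      have rB: "ray B" unfolding B_def[abs_def] by (intro ray_translate ray_shift \<beta> g)
      have conf: "split_config \<kappa> A B Z T"
        unfolding split_config_def
      proof (intro conjI allI impI rA rB)
        show "A 0 = \<one>" "Z 0 = \<one>" using \<gamma> by (simp_all add: A_def Z_def g_def)
        show "real (len (B 0)) \<le> \<kappa>" using T(1) by (simp add: B_def g_def word_dist_def)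
        show "Z i \<in> carrier G" for i using g car by (simp add: Z_def)
        show "wd (Z i) (Z j) = \<bar>real i - real j\<bar>" if "i \<le> T" "j \<le> T" for i j
          using g car that by (simp add: Z_def wd_left_mult ray_wd[OF \<alpha>(1)] of_nat_diff)
        show "2 * real j - 2 \<le> wd (A j) (B j)" for j
        proof (cases j)
          case 0
          then show ?thesis using wd_nonneg[of "A j" "B j"] by simp
        next
          case (Suc i)
          then show ?thesis using T(2)[rule_format, of "T + j"] g car by (simp add: A_def B_def wd_left_mult)
        qed
        show "2 * real j \<le> wd (Z j) (A j)" if "j \<le> T" for j
          using g car that by (simp add: Z_def A_def wd_left_mult ray_wd[OF \<alpha>(1)] of_nat_diff)
        show "2 * real j \<le> wd (Z j) (B j)" if "j \<le> T" for j
        proof -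
          \<comment> \<open>The word lengths \<open>T - j\<close> and \<open>T + j\<close> of the
            untranslated points already differ by \<open>2 * j\<close>.\<close>
          have "wd (Z j) (B j) = wd (\<alpha> (T - j)) (\<beta> (T + j))" using g car by (simp add: Z_def B_def wd_left_mult)
          then show ?thesis
            using len_diff_le_wd[OF car(1)[of "T - j"] car(2)[of "T + j"]] that
            by (simp add: ray_len[OF \<alpha>] ray_len[OF \<beta>] of_nat_diff)
        qed
      qed
      have eA: "endpt A = endpt (\<lambda>n. g \<otimes> \<alpha> n)" "endpt B = endpt (\<lambda>n. g \<otimes> \<beta> n)"
        unfolding A_def[abs_def] B_def[abs_def]
        using endpt_shift[OF ray_translate[OF \<alpha>(1) g], of T] endpt_shift[OF ray_translate[OF \<beta>(1) g], of T] by auto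
      let ?y = "rep g e + rep g f"
      \<comment> \<open>The segment ends at \<open>g\<close>, the inverse of the separation point,
        whose attracting space of dimension \<open>d - r\<close> is the repelling space of the
        separation point.\<close>
      have ZT: "Z T = g" using g \<alpha>(2) by (simp add: Z_def)
      have y: "\<epsilon> * norm ?y \<le> norm (?y - oproj (att ?d g) ?y)"
        using tr[OF conf True, of "rep g e" "rep g f"] rep_xi_mem[OF \<alpha>(1) g e] rep_xi_mem[OF \<beta>(1) g f]
        unfolding eA ZT by blast
      define h where "h = inv_into UNIV (rep g)"
      have h: "h \<in> \<rho> ?\<gamma>" using rep_inv[OF g rep_mem[OF g]] \<gamma> by (simp add: h_def g_def)
      have lh: "linear h" "bij h" using rep_linear[OF \<gamma> h] rep_bij[OF \<gamma> h] by auto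
      have hy: "h ?y = ?v"
        using bij_rep[OF g] linear_rep[OF g] by (simp add: h_def bij_is_inj flip: linear_add)
      have hi: "inv_into UNIV h = rep g" unfolding h_def by (rule inv_inv_eq[OF bij_rep[OF g]])
      have r1: "1 \<le> r" using r by simp
      have "sigma r h * norm (?y - oproj (att ?d g) ?y) \<le> norm ?v"
        using norm_diff_axes_span_inv_le[OF lh r1 r(2), of ?y] unfolding hi hy att_def .
      moreover have sr: "0 < sigma r h" using r by (intro sigma_pos lh) auto
      ultimately have ny: "sigma r h * (\<epsilon> * norm ?y) \<le> norm ?v" using y by (meson less_imp_le mult_left_mono order_trans)
      have sr1: "0 < sigma (r + 1) h" using r by (intro sigma_pos lh) auto
      have rat: "sigma (r + 1) h / sigma r h \<le> c' * exp (- \<mu>' * real T)"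
        using ratio_rep_r[OF \<gamma> h] ray_len[OF \<alpha>, of T] by simp
      have "norm (?v - oproj (att r ?\<gamma>) ?v) \<le> sigma (r + 1) h * norm ?y"
        using norm_diff_axes_span_le[OF lh r1 r(2), of ?y] axes_span_rep[OF \<gamma> h r1] r unfolding hy by simp
      also have "\<dots> = (sigma (r + 1) h / sigma r h) * (sigma r h * (\<epsilon> * norm ?y)) / \<epsilon>"
        using sr eps by simp
      also have "\<dots> \<le> (c' * exp (- \<mu>' * real T)) * norm ?v / \<epsilon>"
        using eps sr sr1 c' by (intro divide_right_mono mult_mono rat ny) auto
      finally have 1: "norm (?v - oproj (att r ?\<gamma>) ?v) \<le> c' / \<epsilon> * exp (- \<mu>' * real T) * norm ?v" by simp
      have "dist (oproj (att r ?\<gamma>)) (oproj (R.xi (endpt \<alpha>))) \<le> C0 * exp (- \<mu>' * (real T + 0))"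
        by (rule C0(2)) (use car ray_len[OF \<alpha>] ray_step[OF \<alpha>(1)] R.xi_ray(3)[OF \<alpha>(1)] in auto)
      then have 2: "norm ((oproj (att r ?\<gamma>) - oproj (R.xi (endpt \<alpha>))) ?v) \<le> C0 * exp (- \<mu>' * real T) * norm ?v"
        using norm_blinfun[of "oproj (att r ?\<gamma>) - oproj (R.xi (endpt \<alpha>))" ?v] mult_right_mono[OF _ norm_ge_zero[of ?v]]
        by (fastforce simp: dist_norm intro: order_trans)
      have "?v - oproj (R.xi (endpt \<alpha>)) ?v = (?v - oproj (att r ?\<gamma>) ?v) + (oproj (att r ?\<gamma>) - oproj (R.xi (endpt \<alpha>))) ?v"
        by (simp add: minus_blinfun.rep_eq)
      then have "norm (?v - oproj (R.xi (endpt \<alpha>)) ?v)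
          \<le> c' / \<epsilon> * exp (- \<mu>' * real T) * norm ?v + C0 * exp (- \<mu>' * real T) * norm ?v"
        by (simp only: order_trans[OF norm_triangle_ineq add_mono[OF 1 2]])
      also have "\<dots> = (c' / \<epsilon> + C0) * (exp (- \<mu>' * real T) * norm ?v)" by (simp add: algebra_simps)
      also have "\<dots> \<le> C * (exp (- \<mu>' * real T) * norm ?v)"
        by (intro mult_right_mono) (auto simp: C_def)
      finally show ?thesis by (simp add: mult.assoc)
    qed
  qed
qed

end

section \<open>Spheres and invariance of domain\<close>

lemma orthonormal_seq_exists: "\<exists>e :: nat \<Rightarrow> 'v::euclidean_space. orthonormal_seq DIM('v) e"
proof -
  obtain v u s where "svd (\<lambda>x::'v. x) v u s"
    using svd_exists[of "\<lambda>x::'v. x"] by (auto simp: linear_ident)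
  then show ?thesis using svdD(2) by blast
qed

text \<open>\<open>nsphere\<close> consists of sequences of reals. It is carried to the unit sphere
  of an \<open>r\<close>-dimensional subspace of the ambient space, seen as the relative frontier of
  a convex set, the form to which invariance of domain applies.\<close>

lemma nsphere_model:
  fixes Y :: "'p topology"
  assumes hom: "Y homeomorphic_space nsphere (r - 1)" and r: "1 \<le> r" "r \<le> DIM('v::euclidean_space)"
  obtains U :: "'v::euclidean_space set" where "bounded U" "convex U" "aff_dim U = int r" "compact (rel_frontier U)"
    "Y homeomorphic_space top_of_set (rel_frontier U)" "\<exists>a b. a \<in> rel_frontier U \<and> b \<in> rel_frontier U \<and> a \<noteq> b"
proof -
  obtain e :: "nat \<Rightarrow> 'v" where e: "orthonormal_seq DIM('v) e" using orthonormal_seq_exists by blast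
  have sub: "{..<r} \<subseteq> {..<DIM('v)}" using r by auto
  define L where "L = span (e ` {..<r})"
  have L: "subspace L" by (simp add: L_def)
  have dL: "dim L = r" unfolding L_def using dim_span_orthonormal_seq[OF e sub] by simp
  have aL: "affine L" using L by (rule subspace_imp_affine)
  define U where "U = cball 0 1 \<inter> L"
  have int: "interior (cball (0::'v) 1) \<inter> L \<noteq> {}" proof -
    have "(0::'v) \<in> interior (cball (0::'v) 1) \<inter> L" using subspace_0[OF L] by (simp add: interior_cball)
    then show ?thesis by blast
  qed
  have fr: "rel_frontier U = sphere 0 1 \<inter> L"
    unfolding U_def using convex_affine_rel_frontier_Int[OF convex_cball aL int] by (simp add: frontier_cball)
  have sq: "{..r - 1} = {..<r}" using r by auto
  define F where "F x = (\<Sum>i<r. x i *\<^sub>R e i)" for x :: "nat \<Rightarrow> real"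
  define F' where "F' y i = (if i < r then y \<bullet> e i else 0)" for y i
  have top: "topspace (nsphere (r - 1)) = {x. (\<Sum>i<r. (x i)\<^sup>2) = 1 \<and> (\<forall>i\<ge>r. x i = 0)}"
  proof -
    have "(i > r - 1) = (i \<ge> r)" for i using r by auto
    then show ?thesis unfolding nsphere sq by auto
  qed
  have FF': "F (F' y) = y" if "y \<in> L" for y
  proof -
    have "y = (\<Sum>i<DIM('v). (y \<bullet> e i) *\<^sub>R e i)" by (rule orthonormal_seq_expansion[OF e])
    also have "\<dots> = (\<Sum>i<r. (y \<bullet> e i) *\<^sub>R e i)"
      using that span_orthonormal_seq_iff[OF e sub, of y] sub by (intro sum.mono_neutral_right) (auto simp: L_def)
    finally show ?thesis by (simp add: F_def F'_def)
  qed
  have F'F: "F' (F x) = x" if "\<forall>i\<ge>r. x i = 0" for x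
  proof
    fix i show "F' (F x) i = x i"
      using that inner_sum_orthonormal_seq[OF e sub, of i x] r by (auto simp: F'_def F_def)
  qed
  have nF: "(norm (F x))\<^sup>2 = (\<Sum>i<r. (x i)\<^sup>2)" for x
    unfolding F_def by (rule norm_sum_orthonormal_seq[OF e sub])
  have FL: "F x \<in> L" for x unfolding F_def L_def by (intro span_sum span_scale span_base) auto
  have hm: "homeomorphic_maps (nsphere (r - 1)) (top_of_set (rel_frontier U)) F F'"
    unfolding homeomorphic_maps_def
  proof (intro conjI ballI)
    show "continuous_map (nsphere (r - 1)) (top_of_set (rel_frontier U)) F"
      unfolding continuous_map_in_subtopology
    proof
      show "continuous_map (nsphere (r - 1)) euclidean F"
      proof -
        have "continuous_map (nsphere (r - 1)) euclidean (\<lambda>x. x i *\<^sub>R e i)" for i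
        proof -
          have "continuous_map euclideanreal euclidean (\<lambda>t. t *\<^sub>R e i)" by (simp add: continuous_intros)
          from continuous_map_compose[OF continuous_map_nsphere_projection this] show ?thesis by (simp add: o_def)
        qed
        then show ?thesis unfolding F_def by (intro continuous_map_sum) auto
      qed
      show "F \<in> topspace (nsphere (r - 1)) \<rightarrow> rel_frontier U"
      proof
        fix x assume "x \<in> topspace (nsphere (r - 1))"
        then have "(norm (F x))\<^sup>2 = 1\<^sup>2" unfolding nF top by simp
        then have "norm (F x) = 1" by (rule power2_eq_imp_eq) auto
        then show "F x \<in> rel_frontier U" unfolding fr using FL by simp
      qed
    qed
    show "continuous_map (top_of_set (rel_frontier U)) (nsphere (r - 1)) F'"
      unfolding nsphere continuous_map_in_subtopology
    proof
      show "continuous_map (top_of_set (rel_frontier U)) (powertop_real UNIV) F'"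
        unfolding continuous_map_componentwise_UNIV
      proof
        fix i
        show "continuous_map (top_of_set (rel_frontier U)) euclideanreal (\<lambda>y. F' y i)"
          by (cases "i < r") (auto simp: F'_def intro!: continuous_intros)
      qed
      show "F' \<in> topspace (top_of_set (rel_frontier U)) \<rightarrow> {x. (\<Sum>i\<le>r - 1. (x i)\<^sup>2) = 1 \<and> (\<forall>i>r - 1. x i = 0)}"
      proof
        fix y assume "y \<in> topspace (top_of_set (rel_frontier U))"
        then have y: "norm y = 1" "y \<in> L" by (auto simp: fr)
        have "(\<Sum>i<r. (F' y i)\<^sup>2) = 1" using nF[of "F' y"] FF'[OF y(2)] y(1) by simp
        then show "F' y \<in> {x. (\<Sum>i\<le>r - 1. (x i)\<^sup>2) = 1 \<and> (\<forall>i>r - 1. x i = 0)}"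
          unfolding sq by (auto simp: F'_def)
      qed
    qed
    show "F' (F x) = x" if "x \<in> topspace (nsphere (r - 1))" for x
      using that unfolding top by (intro F'F) auto
    show "F (F' y) = y" if "y \<in> topspace (top_of_set (rel_frontier U))" for y
      using that by (intro FF') (auto simp: fr)
  qed
  show ?thesis
  proof (rule that)
    show "bounded U" "convex U" unfolding U_def using aL by (auto simp: bounded_Int convex_Int affine_imp_convex)
    have "aff_dim U = aff_dim L"
      unfolding U_def using int L by (subst Int_commute, intro aff_dim_convex_Int_nonempty_interior) (auto simp: subspace_imp_convex)
    then show "aff_dim U = int r" by (simp add: aff_dim_subspace[OF L] dL)
    show "compact (rel_frontier U)" unfolding fr using L by (simp add: compact_Int_closed closed_subspace)
    show "Y homeomorphic_space top_of_set (rel_frontier U)"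
      using homeomorphic_space_trans[OF hom] hm unfolding homeomorphic_space_def by blast
    have "norm (e 0) = 1" "e 0 \<in> L" using orthonormal_seqD[OF e, of 0 0] r by (auto simp: norm_eq_1 L_def intro!: span_base)
    moreover then have "- e 0 \<in> L" using subspace_neg[OF L] by auto
    moreover have "e 0 \<noteq> - e 0"
      using \<open>norm (e 0) = 1\<close> unfolding eq_neg_iff_add_eq_0 scaleR_2[symmetric] by auto
    ultimately show "\<exists>a b. a \<in> rel_frontier U \<and> b \<in> rel_frontier U \<and> a \<noteq> b"
      unfolding fr by (intro exI[of _ "e 0"] exI[of _ "- e 0"]) auto
  qed
qed

lemma invariance_of_domain_nsphere:
  fixes Y :: "'p topology" and h :: "'p \<Rightarrow> 'v::euclidean_space"
  assumes hom: "Y homeomorphic_space nsphere (r - 1)" and r: "1 \<le> r" "r \<le> DIM('v)"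
    and O: "openin Y O'" and h: "continuous_map (subtopology Y O') euclidean h" "inj_on h O'"
    and L: "subspace L" "dim L < r" "h ` O' \<subseteq> L"
  shows "openin (top_of_set L) (h ` O')"
proof -
  obtain U :: "'v set" where U: "bounded U" "convex U" "aff_dim U = int r"
    and XU: "Y homeomorphic_space top_of_set (rel_frontier U)"
    using nsphere_model[OF hom r] by metis
  obtain k k' where kk: "homeomorphic_maps Y (top_of_set (rel_frontier U)) k k'"
    using XU unfolding homeomorphic_space_def by blast
  then have k: "homeomorphic_map Y (top_of_set (rel_frontier U)) k" using homeomorphic_maps_map by blast
  have OX: "O' \<subseteq> topspace Y" using O by (rule openin_subset)
  have k'k: "k' (k x) = x" if "x \<in> O'" for x using kk that OX by (auto simp: homeomorphic_maps_def)
  let ?W = "k ` O'"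
  have W: "openin (top_of_set (rel_frontier U)) ?W" using homeomorphic_map_openness[OF k OX] O by simp
  have k'W: "k' ` ?W = O'" using k'k by force
  have "openin (top_of_set L) ((h \<circ> k') ` ?W)"
  proof (rule invariance_of_domain_sphere_affine_set_gen[OF _ _ _ U(1,2) subspace_imp_affine[OF L(1)] _ W])
    have ck: "continuous_map (top_of_set (rel_frontier U)) Y k'" using kk by (simp add: homeomorphic_maps_def)
    have "continuous_map (subtopology (top_of_set (rel_frontier U)) ?W) (subtopology Y O') k'"
      by (rule continuous_map_into_subtopology[OF continuous_map_from_subtopology[OF ck]]) (use k'W in auto)
    then have "continuous_map (subtopology (top_of_set (rel_frontier U)) ?W) euclidean (h \<circ> k')"
      by (rule continuous_map_compose[OF _ h(1)])
    moreover have "subtopology (top_of_set (rel_frontier U)) ?W = top_of_set ?W"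
      using openin_subset[OF W] by (simp add: subtopology_subtopology inf.absorb_iff2)
    ultimately show "continuous_on ?W (h \<circ> k')" by simp
    show "inj_on (h \<circ> k') ?W" using h(2) k'k by (auto simp: inj_on_def)
    show "h \<circ> k' \<in> ?W \<rightarrow> L" using L(3) k'k by auto
    show "aff_dim L < aff_dim U" using L by (simp add: aff_dim_subspace U(3))
  qed
  moreover have "(h \<circ> k') ` ?W = h ` O'" using k'W by (metis image_comp)
  ultimately show ?thesis by simp
qed

text \<open>An isolated point would be open and closed, hence by connectedness the whole space, but
  the model sphere has two points. Connectedness is where \<open>2 \<le> r\<close> enters.\<close>

lemma homeomorphic_nsphere_properties:
  fixes Y :: "'p topology"
  assumes hom: "Y homeomorphic_space nsphere (r - 1)" and r: "2 \<le> r" "r \<le> DIM('v::euclidean_space)"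
  shows "compact_space Y" "Hausdorff_space Y" "\<And>x. \<not> openin Y {x}"
proof -
  have r1: "1 \<le> r" using r by simp
  obtain U :: "'v set" where U: "bounded U" "convex U" "aff_dim U = int r" "compact (rel_frontier U)"
    and XU: "Y homeomorphic_space top_of_set (rel_frontier U)"
    and two: "\<exists>a b. a \<in> rel_frontier U \<and> b \<in> rel_frontier U \<and> a \<noteq> b"
    using nsphere_model[OF hom r1 r(2)] by blast
  show "compact_space Y"
    using homeomorphic_compact_space[OF XU] U(4) by (simp add: compact_space_subtopology)
  show H: "Hausdorff_space Y"
    using homeomorphic_Hausdorff_space[OF XU] by (simp add: Hausdorff_space_subtopology)
  have conn: "connected_space Y"
  proof -
    have "connectedin euclidean (rel_frontier U)" using connected_sphere_gen[OF U(2,1)] U(3) r by simp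
    then show ?thesis unfolding homeomorphic_connected_space[OF XU] connectedin_def by simp
  qed
  show "\<not> openin Y {x}" for x
  proof
    assume x: "openin Y {x}"
    then have "x \<in> topspace Y" using openin_subset by blast
    then have "closedin Y {x}" using H by (simp add: closedin_Hausdorff_singleton)
    then have "topspace Y = {x}" using conn x unfolding connected_space_clopen_in by blast
    moreover obtain k where "homeomorphic_map Y (top_of_set (rel_frontier U)) k"
      using XU homeomorphic_space by blast
    then have "k ` topspace Y = rel_frontier U" by (simp add: homeomorphic_imp_surjective_map)
    ultimately have "rel_frontier U = {k x}" by simp
    then show False using two by simp
  qed
qed

section \<open>Topology of the boundary\<close>

context word_metric
begin

abbreviation bdry :: "(nat \<Rightarrow> 'g) set topology" where "bdry \<equiv> gromov_boundary G S"

lemma topspace_based_rays: "topspace (based_rays G S) = {\<gamma>. ray \<gamma> \<and> \<gamma> 0 = \<one>}"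
  by (auto simp: based_rays_def geodesic_ray_def)

text \<open>Boundary points are ends of rays with any start, whereas the topology is a quotient of
  rays from the identity. A point missed by all these rays has empty preimage and forms an open
  singleton.\<close>

lemma based_ray_exists_of_not_isolated:
  assumes "\<not> openin bdry {x}" "x \<in> boundary_points G S"
  shows "\<exists>\<gamma>. ray \<gamma> \<and> \<gamma> 0 = \<one> \<and> endpt \<gamma> = x"
proof (rule ccontr)
  assume "\<not> ?thesis"
  then have empty: "{\<gamma> \<in> topspace (based_rays G S). endpt \<gamma> \<in> {x}} = {}" by (auto simp: topspace_based_rays)
  have "openin bdry {x}" unfolding openin_gromov_boundary empty using assms(2) by simp
  then show False using assms(1) by simp
qed

lemma openin_cylinder: "openin (based_rays G S) {\<gamma> \<in> topspace (based_rays G S). \<forall>j\<le>J. \<gamma> j = \<beta> j}"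
proof -
  have "openin (based_rays G S) {\<gamma> \<in> topspace (based_rays G S). \<gamma> j = \<beta> j}" for j
  proof -
    have "continuous_map (based_rays G S) (discrete_topology (carrier G)) (\<lambda>\<gamma>. \<gamma> j)"
      unfolding based_rays_def by (intro continuous_map_from_subtopology continuous_map_product_projection) simp
    then have "openin (based_rays G S) {\<gamma> \<in> topspace (based_rays G S). \<gamma> j \<in> {\<beta> j} \<inter> carrier G}"
      by (rule openin_continuous_map_preimage) simp
    moreover have "{\<gamma> \<in> topspace (based_rays G S). \<gamma> j \<in> {\<beta> j} \<inter> carrier G} = {\<gamma> \<in> topspace (based_rays G S). \<gamma> j = \<beta> j}"
      using ray_carrier by (fastforce simp: topspace_based_rays)
    ultimately show ?thesis by simp
  qed
  then have "openin (based_rays G S) (\<Inter>j\<in>{..J}. {\<gamma> \<in> topspace (based_rays G S). \<gamma> j = \<beta> j})"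
    by (intro openin_INT2) auto
  moreover have "(\<Inter>j\<in>{..J}. {\<gamma> \<in> topspace (based_rays G S). \<gamma> j = \<beta> j}) = {\<gamma> \<in> topspace (based_rays G S). \<forall>j\<le>J. \<gamma> j = \<beta> j}"
    by auto
  ultimately show ?thesis by simp
qed

text \<open>A ray from the identity has word length \<open>n\<close> at time \<open>n\<close>, so
  these rays lie in a product of finite balls; they form a closed set since each defining condition
  involves finitely many indices.\<close>

lemma compact_based_rays: "compact_space (based_rays G S)"
proof -
  let ?P = "product_topology (\<lambda>_::nat. discrete_topology (carrier G)) UNIV"
  let ?R = "{\<gamma>. ray \<gamma> \<and> \<gamma> 0 = \<one>}"
  let ?B = "PiE UNIV (\<lambda>n::nat. {g \<in> carrier G. len g \<le> n})"
  have "compactin ?P ?B"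
    unfolding compactin_PiE by (auto simp: compactin_discrete_topology finite_len_le)
  moreover have "?R \<subseteq> ?B" by (auto simp: ray_carrier ray_len)
  moreover have "closedin ?P ?R"
    unfolding closedin_def
  proof
    show "?R \<subseteq> topspace ?P" by (auto simp: ray_carrier)
    show "openin ?P (topspace ?P - ?R)"
    proof (subst openin_subopen, intro ballI)
      fix \<gamma> assume \<gamma>: "\<gamma> \<in> topspace ?P - ?R"
      then have car: "\<gamma> n \<in> carrier G" for n by auto
      have cyl: "openin ?P {\<gamma>' \<in> topspace ?P. \<gamma>' m = \<gamma> m}" for m
      proof -
        have "continuous_map ?P (discrete_topology (carrier G)) (\<lambda>\<gamma>. \<gamma> m)"
          by (intro continuous_map_product_projection) simp
        then have "openin ?P {\<gamma>' \<in> topspace ?P. \<gamma>' m \<in> {\<gamma> m}}"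
          by (rule openin_continuous_map_preimage) (simp add: car)
        then show ?thesis by simp
      qed
      obtain m n where mn: "\<gamma> 0 \<noteq> \<one> \<or> wd (\<gamma> m) (\<gamma> n) \<noteq> \<bar>real m - real n\<bar>"
        using \<gamma> car by (auto simp: geodesic_ray_def)
      let ?T = "{\<gamma>' \<in> topspace ?P. \<gamma>' 0 = \<gamma> 0} \<inter> {\<gamma>' \<in> topspace ?P. \<gamma>' m = \<gamma> m} \<inter> {\<gamma>' \<in> topspace ?P. \<gamma>' n = \<gamma> n}"
      have "openin ?P ?T" by (intro openin_Int cyl)
      moreover have "\<gamma> \<in> ?T" using \<gamma> by simp
      moreover have "?T \<subseteq> topspace ?P - ?R"
      proof
        fix x assume x: "x \<in> ?T"
        have "x \<notin> ?R"
        proof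
          assume "x \<in> ?R"
          then have "x 0 = \<one>" "wd (x m) (x n) = \<bar>real m - real n\<bar>" by (auto simp: ray_wd)
          then show False using mn x by auto
        qed
        then show "x \<in> topspace ?P - ?R" using x by blast
      qed
      ultimately show "\<exists>T. openin ?P T \<and> \<gamma> \<in> T \<and> T \<subseteq> topspace ?P - ?R" by blast
    qed
  qed
  ultimately have "compactin ?P ?R" by (rule closed_compactin)
  then show ?thesis unfolding based_rays_def by (rule compact_space_subtopology)
qed

lemma continuous_map_endpt: "continuous_map (based_rays G S) bdry endpt"
  unfolding continuous_map_def
  by (auto simp: topspace_gromov_boundary topspace_based_rays endpt_boundary openin_gromov_boundary)

text \<open>As a continuous map from a compact to a Hausdorff space, \<open>endpt\<close> is closed,
  so removing the ends of all rays outside the cylinders around rays to \<open>x\<close> leaves an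
  open set. The ray \<open>\<alpha>'\<close> depends on \<open>\<alpha>\<close>, since several rays
  from the identity may end at \<open>x\<close>.\<close>

lemma boundary_neighbourhood:
  assumes H: "Hausdorff_space bdry" and x: "x \<in> boundary_points G S"
  obtains W where "openin bdry W" "x \<in> W"
    "\<And>\<alpha>. ray \<alpha> \<Longrightarrow> \<alpha> 0 = \<one> \<Longrightarrow> endpt \<alpha> \<in> W \<Longrightarrow>
      \<exists>\<alpha>'. ray \<alpha>' \<and> \<alpha>' 0 = \<one> \<and> endpt \<alpha>' = x \<and> (\<forall>j\<le>J. \<alpha> j = \<alpha>' j)"
proof -
  let ?Y = "based_rays G S"
  let ?A = "{\<alpha>' \<in> topspace ?Y. endpt \<alpha>' = x}"
  define F where "F = (\<Union>\<alpha>'\<in>?A. {\<alpha> \<in> topspace ?Y. \<forall>j\<le>J. \<alpha> j = \<alpha>' j})"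
  have F: "openin ?Y F" unfolding F_def by (intro openin_Union) (auto simp: openin_cylinder)
  have "closed_map ?Y bdry endpt"
    by (rule continuous_imp_closed_map_gen[OF compact_based_rays Hausdorff_imp_kc_space[OF H] continuous_map_endpt])
  moreover have "closedin ?Y (topspace ?Y - F)" by (intro closedin_diff closedin_topspace F)
  ultimately have cl: "closedin bdry (endpt ` (topspace ?Y - F))" unfolding closed_map_def by blast
  let ?W = "topspace bdry - endpt ` (topspace ?Y - F)"
  show ?thesis
  proof (rule that)
    show "openin bdry ?W" by (intro openin_diff openin_topspace cl)
    have "\<alpha> \<in> F" if "\<alpha> \<in> topspace ?Y" "endpt \<alpha> = x" for \<alpha> using that by (auto simp: F_def)
    then show "x \<in> ?W" using x by (auto simp: topspace_gromov_boundary)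
    fix \<alpha> assume a: "ray \<alpha>" "\<alpha> 0 = \<one>" "endpt \<alpha> \<in> ?W"
    then have "\<alpha> \<in> F" by (auto simp: topspace_based_rays)
    then show "\<exists>\<alpha>'. ray \<alpha>' \<and> \<alpha>' 0 = \<one> \<and> endpt \<alpha>' = x \<and> (\<forall>j\<le>J. \<alpha> j = \<alpha>' j)"
      by (auto simp: F_def topspace_based_rays)
  qed
qed

end

text \<open>Rays from the identity converge at a uniform rate, so two limits are close when their
  rays pass through the same point at a late time \<open>J\<close>.\<close>

lemma (in anosov_rep) xi_neighbourhood:
  assumes H: "Hausdorff_space bdry" and x: "x \<in> boundary_points G S" and e: "0 < e"
    and ex: "\<And>y. y \<in> boundary_points G S \<Longrightarrow> \<exists>\<gamma>. ray \<gamma> \<and> \<gamma> 0 = \<one> \<and> endpt \<gamma> = y"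
  obtains W where "openin bdry W" "x \<in> W" "\<And>y. y \<in> W \<Longrightarrow> dist (oproj (xi y)) (oproj (xi x)) < e"
proof -
  obtain C where C: "0 < C"
    "\<And>w i t P. (\<And>j. i \<le> j \<Longrightarrow> w j \<in> carrier G \<and> real j + t \<le> real (len (w j))) \<Longrightarrow>
      (\<And>j. i \<le> j \<Longrightarrow> wd (w j) (w (Suc j)) \<le> 1) \<Longrightarrow> (\<lambda>n. oproj (att p (w n))) \<longlonglongrightarrow> P \<Longrightarrow>
      dist (oproj (att p (w i))) P \<le> C * exp (- \<mu> * (real i + t))"
    using xi_path_dist by metis
  have d: "dist (oproj (att p (w j))) (oproj (xi (endpt w))) \<le> C * exp (- \<mu> * (real j + 0))"
    if "ray w" "w 0 = \<one>" for w j
    by (rule C(2)) (use that ray_carrier ray_step xi_ray(3) ray_len[OF that] in auto)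
  have "\<forall>\<^sub>F j in sequentially. C * exp (- \<mu> * (real j + 0)) < e / 2"
    using e by (intro order_tendstoD(2)[OF exp_decay]) simp
  then obtain J where J: "C * exp (- \<mu> * (real J + 0)) < e / 2" by (auto simp: eventually_sequentially)
  obtain W where W: "openin bdry W" "x \<in> W"
    "\<And>\<alpha>. ray \<alpha> \<Longrightarrow> \<alpha> 0 = \<one> \<Longrightarrow> endpt \<alpha> \<in> W \<Longrightarrow>
      \<exists>\<alpha>'. ray \<alpha>' \<and> \<alpha>' 0 = \<one> \<and> endpt \<alpha>' = x \<and> (\<forall>j\<le>J. \<alpha> j = \<alpha>' j)"
    by (rule boundary_neighbourhood[OF H x]) (rule that)
  show ?thesis
  proof (rule that[OF W(1,2)])
    fix y assume y: "y \<in> W"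
    then have "y \<in> boundary_points G S" using openin_subset[OF W(1)] by (auto simp: topspace_gromov_boundary)
    then obtain \<alpha> where \<alpha>: "ray \<alpha>" "\<alpha> 0 = \<one>" "endpt \<alpha> = y" using ex by blast
    then obtain \<alpha>' where \<alpha>': "ray \<alpha>'" "\<alpha>' 0 = \<one>" "endpt \<alpha>' = x" "\<alpha> J = \<alpha>' J" using W(3)[of \<alpha>] y by auto
    show "dist (oproj (xi y)) (oproj (xi x)) < e"
      using d[OF \<alpha>(1,2), of J] d[OF \<alpha>'(1,2), of J] J \<alpha>(3) \<alpha>'(3,4)
        dist_triangle3[of "oproj (xi y)" "oproj (xi x)" "oproj (att p (\<alpha> J))"] by simp
  qed
qed

section \<open>The limit map on a spherical boundary\<close>

locale sphere_hyperconvex = hyperconvex_rep G S \<rho> c \<mu> r c' \<mu>'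
  for G :: "('g, 'b) monoid_scheme" (structure) and S
    and \<rho> :: "'g \<Rightarrow> ('v::euclidean_space \<Rightarrow> 'v) set" and c \<mu> r c' \<mu>' +
  assumes sphere: "gromov_boundary G S homeomorphic_space nsphere (r - 1)"
begin

lemma compact_bdry: "compact_space bdry" and Hausdorff_bdry: "Hausdorff_space bdry"
  using homeomorphic_nsphere_properties[OF sphere r(1) less_imp_le[OF r(2)]] by auto

lemma continuous_map_xi: "continuous_map bdry euclidean (\<lambda>x. oproj (xi x))"
  unfolding continuous_map_def
proof (intro conjI allI impI)
  fix V :: "('v \<Rightarrow>\<^sub>L 'v) set" assume "openin euclidean V"
  then have V: "open V" by simp
  show "openin bdry {x \<in> topspace bdry. oproj (xi x) \<in> V}"
  proof (subst openin_subopen, intro ballI)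
    fix x assume x: "x \<in> {x \<in> topspace bdry. oproj (xi x) \<in> V}"
    then obtain e where e: "0 < e" "\<And>P. dist P (oproj (xi x)) < e \<Longrightarrow> P \<in> V" using V by (auto simp: open_dist)
    have "x \<in> boundary_points G S" using x by (simp add: topspace_gromov_boundary)
    then obtain W where W: "openin bdry W" "x \<in> W" "\<And>y. y \<in> W \<Longrightarrow> dist (oproj (xi y)) (oproj (xi x)) < e"
      by (rule xi_neighbourhood[OF Hausdorff_bdry _ e(1)]) (rule based_ray_exists, assumption, rule that)
    then show "\<exists>T. openin bdry T \<and> x \<in> T \<and> T \<subseteq> {x \<in> topspace bdry. oproj (xi x) \<in> V}"
      using e(2) openin_subset[OF W(1)] by (intro exI[of _ W]) auto
  qed
qed simp

text \<open>The points off \<open>W\<close> form a compact set whose image is closed and, by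
  injectivity, misses the image of \<open>x\<close>.\<close>

lemma xi_embedding:
  assumes W: "openin bdry W" "x \<in> W"
  obtains \<eta> where "0 < \<eta>" "\<And>y. y \<in> boundary_points G S \<Longrightarrow> dist (oproj (xi y)) (oproj (xi x)) < \<eta> \<Longrightarrow> y \<in> W"
proof -
  have x: "x \<in> boundary_points G S" using W(2) openin_subset[OF W(1)] by (auto simp: topspace_gromov_boundary)
  let ?K = "topspace bdry - W"
  have "compactin bdry ?K" by (intro closedin_compact_space compact_bdry closedin_diff closedin_topspace W(1))
  then have "compactin euclidean ((\<lambda>x. oproj (xi x)) ` ?K)" by (rule image_compactin[OF _ continuous_map_xi])
  then have cl: "closed ((\<lambda>x. oproj (xi x)) ` ?K)" by (simp add: compact_imp_closed)
  have "oproj (xi x) \<notin> (\<lambda>x. oproj (xi x)) ` ?K"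
  proof
    assume "oproj (xi x) \<in> (\<lambda>x. oproj (xi x)) ` ?K"
    then obtain y where y: "y \<in> boundary_points G S" "y \<notin> W" "oproj (xi x) = oproj (xi y)"
      by (auto simp: topspace_gromov_boundary)
    then have "xi x = xi y" using oproj_inject[OF subspace_xi[OF x] subspace_xi[OF y(1)]] by simp
    then show False using xi_inj[OF x y(1)] y(2) W(2) by auto
  qed
  from separate_point_closed[OF cl this]
  obtain \<eta> where eta: "0 < \<eta>" "\<forall>P\<in>(\<lambda>x. oproj (xi x)) ` ?K. \<eta> \<le> dist (oproj (xi x)) P"
    by (elim exE conjE)
  show ?thesis
  proof (rule that[OF eta(1)])
    fix y assume "y \<in> boundary_points G S" "dist (oproj (xi y)) (oproj (xi x)) < \<eta>"
    then show "y \<in> W" using eta(2) by (force simp: topspace_gromov_boundary dist_commute)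
  qed
qed

text \<open>Up to time \<open>J\<close> the rays to \<open>y\<close> and \<open>z\<close> coincide
  with rays to \<open>x\<close>, which stay within \<open>\<kappa>\<close> of each other. Hence they
  separate at some \<open>T \<ge> J\<close>, and \<open>secant_decay\<close> costs half of
  \<open>\<epsilon>\<close>. The other half replaces the limit space at \<open>y\<close> by the one
  at \<open>x\<close>.\<close>

lemma secant_neighbourhood:
  assumes x: "x \<in> boundary_points G S" and eps: "0 < \<epsilon>"
  obtains W where "openin bdry W" "x \<in> W"
    "\<And>y z e f. y \<in> W \<Longrightarrow> z \<in> W \<Longrightarrow> y \<noteq> z \<Longrightarrow> e \<in> xi y \<Longrightarrow> f \<in> xi z \<Longrightarrow>
      norm ((e + f) - oproj (R.xi x) (e + f)) \<le> \<epsilon> * norm (e + f)"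
proof -
  obtain \<kappa> where k: "0 \<le> \<kappa>"
    "\<And>\<alpha> \<beta> m. ray \<alpha> \<Longrightarrow> ray \<beta> \<Longrightarrow> \<alpha> 0 = \<one> \<Longrightarrow> \<beta> 0 = \<one> \<Longrightarrow> endpt \<alpha> = endpt \<beta> \<Longrightarrow> wd (\<alpha> m) (\<beta> m) \<le> \<kappa>"
    "\<And>\<alpha> \<beta>. ray \<alpha> \<Longrightarrow> ray \<beta> \<Longrightarrow> \<alpha> 0 = \<one> \<Longrightarrow> \<beta> 0 = \<one> \<Longrightarrow> endpt \<alpha> \<noteq> endpt \<beta> \<Longrightarrow>
      \<exists>T. (\<forall>m\<le>T. wd (\<alpha> m) (\<beta> m) \<le> \<kappa>) \<and> \<kappa> < wd (\<alpha> (Suc T)) (\<beta> (Suc T)) \<and>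
        (\<forall>n>T. 2 * (real n - real T - 1) \<le> wd (\<alpha> n) (\<beta> n))"
    by (rule rays_separation) (rule that)
  obtain C where C: "0 < C" "\<And>\<alpha> \<beta> T e f. ray \<alpha> \<Longrightarrow> \<alpha> 0 = \<one> \<Longrightarrow> ray \<beta> \<Longrightarrow> \<beta> 0 = \<one> \<Longrightarrow>
    wd (\<alpha> T) (\<beta> T) \<le> \<kappa> \<Longrightarrow> \<forall>n>T. 2 * (real n - real T - 1) \<le> wd (\<alpha> n) (\<beta> n) \<Longrightarrow>
    e \<in> xi (endpt \<alpha>) \<Longrightarrow> f \<in> xi (endpt \<beta>) \<Longrightarrow>
    norm ((e + f) - oproj (R.xi (endpt \<alpha>)) (e + f)) \<le> C * exp (- \<mu>' * real T) * norm (e + f)"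
    by (rule secant_decay[of \<kappa>]) (rule that)
  have "\<forall>\<^sub>F j in sequentially. C * exp (- \<mu>' * (real j + 0)) < \<epsilon> / 2"
    using eps by (intro order_tendstoD(2)[OF R.exp_decay]) simp
  then obtain J where J: "C * exp (- \<mu>' * real J) < \<epsilon> / 2" by (auto simp: eventually_sequentially)
  obtain W1 where W1: "openin bdry W1" "x \<in> W1"
    "\<And>\<alpha>. ray \<alpha> \<Longrightarrow> \<alpha> 0 = \<one> \<Longrightarrow> endpt \<alpha> \<in> W1 \<Longrightarrow>
      \<exists>\<alpha>'. ray \<alpha>' \<and> \<alpha>' 0 = \<one> \<and> endpt \<alpha>' = x \<and> (\<forall>j\<le>J. \<alpha> j = \<alpha>' j)"
    by (rule boundary_neighbourhood[OF Hausdorff_bdry x]) (rule that)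
  have "0 < \<epsilon> / 2" using eps by simp
  then obtain W2 where W2: "openin bdry W2" "x \<in> W2"
    "\<And>y. y \<in> W2 \<Longrightarrow> dist (oproj (R.xi y)) (oproj (R.xi x)) < \<epsilon> / 2"
    by (rule R.xi_neighbourhood[OF Hausdorff_bdry x]) (rule based_ray_exists, assumption, rule that)
  show ?thesis
  proof (rule that[of "W1 \<inter> W2"])
    show "openin bdry (W1 \<inter> W2)" "x \<in> W1 \<inter> W2" using W1 W2 by auto
    fix y z e f assume yz: "y \<in> W1 \<inter> W2" "z \<in> W1 \<inter> W2" "y \<noteq> z" and e: "e \<in> xi y" and f: "f \<in> xi z"
    let ?v = "e + f"
    have "y \<in> boundary_points G S" "z \<in> boundary_points G S"
      using yz openin_subset[OF W1(1)] by (auto simp: topspace_gromov_boundary)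
    then obtain \<alpha> \<beta> where \<alpha>: "ray \<alpha>" "\<alpha> 0 = \<one>" "endpt \<alpha> = y" and \<beta>: "ray \<beta>" "\<beta> 0 = \<one>" "endpt \<beta> = z"
      using based_ray_exists[of y] based_ray_exists[of z] by blast
    obtain \<alpha>' where \<alpha>': "ray \<alpha>'" "\<alpha>' 0 = \<one>" "endpt \<alpha>' = x" "\<And>j. j \<le> J \<Longrightarrow> \<alpha> j = \<alpha>' j" using W1(3)[OF \<alpha>(1,2)] \<alpha>(3) yz by auto
    obtain \<beta>' where \<beta>': "ray \<beta>'" "\<beta>' 0 = \<one>" "endpt \<beta>' = x" "\<And>j. j \<le> J \<Longrightarrow> \<beta> j = \<beta>' j" using W1(3)[OF \<beta>(1,2)] \<beta>(3) yz by auto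
    obtain T where T: "\<And>m. m \<le> T \<Longrightarrow> wd (\<alpha> m) (\<beta> m) \<le> \<kappa>" "\<kappa> < wd (\<alpha> (Suc T)) (\<beta> (Suc T))"
      "\<forall>n>T. 2 * (real n - real T - 1) \<le> wd (\<alpha> n) (\<beta> n)"
      using k(3)[OF \<alpha>(1) \<beta>(1) \<alpha>(2) \<beta>(2)] \<alpha>(3) \<beta>(3) yz(3) by blast
    have "J \<le> T"
    proof (rule ccontr)
      assume "\<not> J \<le> T"
      then have "Suc T \<le> J" by simp
      then have "wd (\<alpha> (Suc T)) (\<beta> (Suc T)) \<le> \<kappa>"
        using k(2)[OF \<alpha>'(1) \<beta>'(1) \<alpha>'(2) \<beta>'(2), of "Suc T"] \<alpha>'(3,4) \<beta>'(3,4) by simp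
      then show False using T(2) by simp
    qed
    then have "C * exp (- \<mu>' * real T) \<le> C * exp (- \<mu>' * real J)"
      using C(1) mu' by (intro mult_left_mono) auto
    then have "C * exp (- \<mu>' * real T) * norm ?v \<le> \<epsilon> / 2 * norm ?v" using J by (intro mult_right_mono) auto
    moreover have "norm (?v - oproj (R.xi y) ?v) \<le> C * exp (- \<mu>' * real T) * norm ?v"
      using C(2)[OF \<alpha>(1,2) \<beta>(1,2) T(1)[OF order_refl] T(3)] e f unfolding \<alpha>(3) \<beta>(3) by blast
    moreover have "norm ((oproj (R.xi y) - oproj (R.xi x)) ?v) \<le> \<epsilon> / 2 * norm ?v"
    proof (rule order_trans[OF norm_blinfun mult_right_mono])
      show "norm (oproj (R.xi y) - oproj (R.xi x)) \<le> \<epsilon> / 2" using W2(3)[of y] yz by (simp add: dist_norm)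
    qed simp
    moreover have "?v - oproj (R.xi x) ?v = (?v - oproj (R.xi y) ?v) + (oproj (R.xi y) - oproj (R.xi x)) ?v"
      by (simp add: minus_blinfun.rep_eq)
    then have "norm (?v - oproj (R.xi x) ?v) \<le> norm (?v - oproj (R.xi y) ?v) + norm ((oproj (R.xi y) - oproj (R.xi x)) ?v)"
      by (simp only: norm_triangle_ineq)
    ultimately show "norm (?v - oproj (R.xi x) ?v) \<le> \<epsilon> * norm ?v" by linarith
  qed
qed

end

section \<open>A criterion for \<open>C\<^sup>1\<close> submanifolds\<close>

text \<open>Any two points near \<open>q\<close> are compared, not only points with
  \<open>q\<close>; with a constant below \<open>1\<close> this makes the projection to
  \<open>L\<close> injective near \<open>q\<close>. That \<open>N\<close> fills all directions of
  \<open>L\<close> is not part of the notion; it comes from invariance of domain.\<close>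

definition strict_tangent :: "'v::euclidean_space set \<Rightarrow> 'v \<Rightarrow> 'v set \<Rightarrow> bool" where
  "strict_tangent N q L \<longleftrightarrow> subspace L \<and>
     (\<forall>\<epsilon>>0. \<exists>\<delta>>0. \<forall>y\<in>N. \<forall>z\<in>N. dist y q < \<delta> \<longrightarrow> dist z q < \<delta> \<longrightarrow>
        norm ((y - z) - oproj L (y - z)) \<le> \<epsilon> * norm (y - z))"

lemma strict_tangentD:
  assumes "strict_tangent N q L" "0 < \<epsilon>"
  obtains \<delta> where "0 < \<delta>" "\<And>y z. y \<in> N \<Longrightarrow> z \<in> N \<Longrightarrow> dist y q < \<delta> \<Longrightarrow> dist z q < \<delta> \<Longrightarrow>
    norm ((y - z) - oproj L (y - z)) \<le> \<epsilon> * norm (y - z)"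
  using assms unfolding strict_tangent_def by metis

lemma dist_le_small: "0 \<le> a \<Longrightarrow> 0 < e \<Longrightarrow> \<exists>t>0::real. t * a < e"
  by (rule exI[of _ "e / (a + 1)"]) (auto simp: divide_less_eq field_simps)

locale graph_over_subspace =
  fixes N L D :: "'v::euclidean_space set" and f :: "'v \<Rightarrow> 'v"
  assumes L: "subspace L" and D: "openin (top_of_set L) D"
    and fN: "u \<in> D \<Longrightarrow> f u \<in> N" and pf: "u \<in> D \<Longrightarrow> oproj L (f u) = u"
    and lip: "u \<in> D \<Longrightarrow> w \<in> D \<Longrightarrow> norm (f u - f w) \<le> 2 * norm (u - w)"
begin

lemma D_sub: "D \<subseteq> L" using openin_imp_subset[OF D] .

lemma D_ball:
  assumes "u \<in> D" obtains d where "0 < d" "\<And>w. w \<in> L \<Longrightarrow> norm (w - u) < d \<Longrightarrow> w \<in> D"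
  using D assms unfolding openin_contains_ball by (auto simp: dist_norm norm_minus_commute subset_iff)

text \<open>Strict differentiability along \<open>D\<close>. Factoring \<open>F\<close> through the
  projection fixes it off \<open>L\<close>, so that operator norms of differences are controlled by
  vectors of \<open>L\<close>.\<close>

definition strict_deriv :: "'v \<Rightarrow> ('v \<Rightarrow>\<^sub>L 'v) \<Rightarrow> bool" where
  "strict_deriv u F \<longleftrightarrow> (\<forall>x. F x = F (oproj L x)) \<and> (\<forall>w\<in>L. oproj L (F w) = w) \<and>
     (\<forall>\<epsilon>>0. \<exists>\<delta>>0. \<forall>u1\<in>D. \<forall>u2\<in>D. norm (u1 - u) < \<delta> \<longrightarrow> norm (u2 - u) < \<delta> \<longrightarrow>
        norm (f u1 - f u2 - F (u1 - u2)) \<le> \<epsilon> * norm (u1 - u2))"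

lemma strict_derivE:
  assumes "strict_deriv u F" "0 < \<epsilon>"
  obtains \<delta> where "0 < \<delta>" "\<And>u1 u2. u1 \<in> D \<Longrightarrow> u2 \<in> D \<Longrightarrow> norm (u1 - u) < \<delta> \<Longrightarrow> norm (u2 - u) < \<delta> \<Longrightarrow>
    norm (f u1 - f u2 - F (u1 - u2)) \<le> \<epsilon> * norm (u1 - u2)"
  using assms unfolding strict_deriv_def by metis

lemma strict_tangent_param:
  assumes u: "u \<in> D" and tan: "strict_tangent N (f u) L'" and eps: "0 < \<epsilon>"
  obtains \<delta> where "0 < \<delta>" "\<And>u1 u2. u1 \<in> D \<Longrightarrow> u2 \<in> D \<Longrightarrow> norm (u1 - u) < \<delta> \<Longrightarrow> norm (u2 - u) < \<delta> \<Longrightarrow>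
    norm ((f u1 - f u2) - oproj L' (f u1 - f u2)) \<le> \<epsilon> * norm (u1 - u2)"
proof -
  have "0 < \<epsilon> / 2" using eps by simp
  then obtain \<delta> where d: "0 < \<delta>" "\<And>y z. y \<in> N \<Longrightarrow> z \<in> N \<Longrightarrow> dist y (f u) < \<delta> \<Longrightarrow> dist z (f u) < \<delta> \<Longrightarrow>
      norm ((y - z) - oproj L' (y - z)) \<le> \<epsilon> / 2 * norm (y - z)"
    by (rule strict_tangentD[OF tan]) (rule that)
  show ?thesis
  proof (rule that[of "\<delta> / 2"])
    fix u1 u2 assume 1: "u1 \<in> D" "u2 \<in> D" "norm (u1 - u) < \<delta> / 2" "norm (u2 - u) < \<delta> / 2"
    have "norm (f u1 - f u2 - oproj L' (f u1 - f u2)) \<le> \<epsilon> / 2 * norm (f u1 - f u2)"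
      using 1 lip[OF 1(1) u] lip[OF 1(2) u] by (intro d(2) fN) (auto simp: dist_norm)
    also have "\<dots> \<le> \<epsilon> / 2 * (2 * norm (u1 - u2))" using lip[OF 1(1,2)] eps by (intro mult_left_mono) auto
    finally show "norm (f u1 - f u2 - oproj L' (f u1 - f u2)) \<le> \<epsilon> * norm (u1 - u2)" by simp
  qed (use d in simp)
qed

text \<open>Since \<open>D\<close> is open in \<open>L\<close>, every direction of \<open>L\<close>
  is, up to scale, the projection of a short secant at \<open>f u\<close>. The secant is nearly in
  \<open>L'\<close>, so the direction is approximated by projections of vectors of
  \<open>L'\<close>, which form a closed set.\<close>

lemma oproj_tangent_onto:
  assumes u: "u \<in> D" and tan: "strict_tangent N (f u) L'"
  shows "L \<subseteq> oproj L ` L'"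
proof
  have L': "subspace L'" using tan by (simp add: strict_tangent_def)
  have lin: "linear (blinfun_apply (oproj L))" by (rule bounded_linear.linear[OF blinfun.bounded_linear_right])
  have cl: "closed (oproj L ` L')" using lin L' by (intro closed_subspace linear_subspace_image)
  fix w assume w: "w \<in> L"
  have "\<exists>x\<in>oproj L ` L'. dist x w < \<epsilon>" if eps: "0 < \<epsilon>" for \<epsilon>
  proof -
    define \<epsilon>' where "\<epsilon>' = \<epsilon> / (norm w + 1)"
    have eps': "0 < \<epsilon>'" "\<epsilon>' * norm w < \<epsilon>" using eps by (auto simp: \<epsilon>'_def field_simps add_pos_nonneg)
    obtain d where d: "0 < d" "\<And>w. w \<in> L \<Longrightarrow> norm (w - u) < d \<Longrightarrow> w \<in> D" using D_ball[OF u] by blast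
    obtain \<delta> where \<delta>: "0 < \<delta>" "\<And>u1 u2. u1 \<in> D \<Longrightarrow> u2 \<in> D \<Longrightarrow> norm (u1 - u) < \<delta> \<Longrightarrow> norm (u2 - u) < \<delta> \<Longrightarrow>
        norm ((f u1 - f u2) - oproj L' (f u1 - f u2)) \<le> \<epsilon>' * norm (u1 - u2)"
      by (rule strict_tangent_param[OF u tan eps'(1)]) (rule that)
    obtain t where t: "0 < t" "t * norm w < min d \<delta>" using dist_le_small[of "norm w" "min d \<delta>"] d \<delta> by auto
    let ?u = "u + t *\<^sub>R w"
    have "?u \<in> L" using D_sub u w L by (auto intro: subspace_add subspace_scale)
    then have uD: "?u \<in> D" using t by (intro d(2)) auto
    let ?v = "f ?u - f u"
    have v: "norm (?v - oproj L' ?v) \<le> \<epsilon>' * (t * norm w)" using \<delta>(2)[OF uD u] t \<delta>(1) by simp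
    have pv: "oproj L ?v = t *\<^sub>R w" using pf[OF uD] pf[OF u] by (simp add: blinfun.diff_right)
    let ?x = "oproj L ((1 / t) *\<^sub>R oproj L' ?v)"
    have "?x - w = (1 / t) *\<^sub>R (oproj L (oproj L' ?v) - t *\<^sub>R w)" using t by (simp add: blinfun.scaleR_right scaleR_diff_right)
    also have "\<dots> = (1 / t) *\<^sub>R oproj L (oproj L' ?v - ?v)"
      using blinfun.diff_right[of "oproj L" "oproj L' ?v" ?v] unfolding pv by (rule arg_cong[OF sym])
    finally have "norm (?x - w) = (1 / t) * norm (oproj L (oproj L' ?v - ?v))" using t by simp
    also have "\<dots> \<le> (1 / t) * norm (?v - oproj L' ?v)"
      using norm_oproj_le[OF L, of "oproj L' ?v - ?v"] t by (intro mult_left_mono) (auto simp: norm_minus_commute)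
    also have "\<dots> \<le> (1 / t) * (\<epsilon>' * (t * norm w))" using v t by (intro mult_left_mono) auto
    also have "\<dots> < \<epsilon>" using t eps' by simp
    finally have "dist ?x w < \<epsilon>" by (simp add: dist_norm)
    moreover have "?x \<in> oproj L ` L'" using oproj_mem[OF L'] L' by (intro imageI subspace_scale)
    ultimately show ?thesis by blast
  qed
  then have "w \<in> closure (oproj L ` L')" unfolding closure_approachable by blast
  then show "w \<in> oproj L ` L'" using closure_closed[OF cl] by simp
qed

text \<open>Equal dimensions make the projection of \<open>L'\<close> to \<open>L\<close> bijective;
  its inverse, composed with the projection to \<open>L\<close>, is the derivative.\<close>

lemma strict_deriv_exists:
  assumes u: "u \<in> D" and tan: "strict_tangent N (f u) L'" and dim: "dim L' = dim L"
  obtains F where "strict_deriv u F" "\<And>w. F w \<in> L'"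
proof -
  have L': "subspace L'" using tan by (simp add: strict_tangent_def)
  have lin: "linear (blinfun_apply (oproj L))" by (rule bounded_linear.linear[OF blinfun.bounded_linear_right])
  have "oproj L ` L' \<subseteq> L" using oproj_mem[OF L] by auto
  then have im: "oproj L ` L' = L" using oproj_tangent_onto[OF u tan] by blast
  obtain g where g: "range g \<subseteq> L'" "linear g" "\<And>w. w \<in> L \<Longrightarrow> oproj L (g w) = w"
    using linear_exists_right_inverse_on[OF lin L'] unfolding im by auto
  have inj: "inj_on g L" using g(3) by (metis inj_onI)
  have "g ` L = L'"
  proof (rule subspace_dim_equal[OF linear_subspace_image[OF g(2) L] L'])
    show "g ` L \<subseteq> L'" using g(1) by auto
    show "dim L' \<le> dim (g ` L)" using dim_image_eq[OF g(2), of L] inj L dim by (simp add: span_eq_iff[THEN iffD2])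
  qed
  then have gl: "g (oproj L x) = x" if "x \<in> L'" for x using that g(3) by force
  have bg: "bounded_linear (\<lambda>x. g (oproj L x))"
    using linear_compose[OF lin g(2)] by (simp add: o_def linear_conv_bounded_linear)
  define F where "F = Blinfun (\<lambda>x. g (oproj L x))"
  have F: "F x = g (oproj L x)" for x by (simp add: F_def bounded_linear_Blinfun_apply bg)
  have "strict_deriv u F" unfolding strict_deriv_def
  proof (intro conjI allI impI ballI)
    show "F x = F (oproj L x)" for x by (simp add: F oproj_idem[OF L])
    show "oproj L (F w) = w" if "w \<in> L" for w using that g(3) by (simp add: F oproj_id[OF L])
    fix \<epsilon> :: real assume eps: "0 < \<epsilon>"
    define \<epsilon>' where "\<epsilon>' = \<epsilon> / (1 + norm F)"
    have eps': "0 < \<epsilon>'" "(1 + norm F) * \<epsilon>' = \<epsilon>" using eps by (auto simp: \<epsilon>'_def add_pos_nonneg add_nonneg_eq_0_iff)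
    obtain \<delta> where \<delta>: "0 < \<delta>" "\<And>u1 u2. u1 \<in> D \<Longrightarrow> u2 \<in> D \<Longrightarrow> norm (u1 - u) < \<delta> \<Longrightarrow> norm (u2 - u) < \<delta> \<Longrightarrow>
        norm ((f u1 - f u2) - oproj L' (f u1 - f u2)) \<le> \<epsilon>' * norm (u1 - u2)"
      by (rule strict_tangent_param[OF u tan eps'(1)]) (rule that)
    have "norm (f u1 - f u2 - F (u1 - u2)) \<le> \<epsilon> * norm (u1 - u2)"
      if 1: "u1 \<in> D" "u2 \<in> D" "norm (u1 - u) < \<delta>" "norm (u2 - u) < \<delta>" for u1 u2
    proof -
      let ?v = "f u1 - f u2" let ?r = "?v - oproj L' ?v"
      have "oproj L u1 = u1" "oproj L u2 = u2" using 1 D_sub oproj_id[OF L] by auto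
      \<comment> \<open>\<open>F\<close> sees only projections to \<open>L\<close>, and those of
        \<open>u1 - u2\<close> and of the secant agree. On vectors of \<open>L'\<close> it is the
        identity, so only the small remainder \<open>?r\<close> contributes to the error.\<close>
      then have "F (u1 - u2) = F ?v" using pf[OF 1(1)] pf[OF 1(2)] by (simp add: F blinfun.diff_right)
      also have "\<dots> = F (oproj L' ?v) + F ?r" by (simp add: blinfun.diff_right)
      also have "F (oproj L' ?v) = oproj L' ?v" unfolding F by (rule gl[OF oproj_mem[OF L']])
      finally have "?v - F (u1 - u2) = ?r - F ?r" by simp
      then have "norm (?v - F (u1 - u2)) \<le> norm ?r + norm (F ?r)" by (simp only: norm_triangle_ineq4)
      also have "\<dots> \<le> norm ?r + norm F * norm ?r" using norm_blinfun by (intro add_left_mono)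
      also have "\<dots> = (1 + norm F) * norm ?r" by (simp add: algebra_simps)
      also have "\<dots> \<le> (1 + norm F) * (\<epsilon>' * norm (u1 - u2))" by (intro mult_left_mono \<delta>(2) 1) simp
      also have "\<dots> = \<epsilon> * norm (u1 - u2)" using eps'(2) by (simp only: mult.assoc[symmetric])
      finally show ?thesis .
    qed
    then show "\<exists>\<delta>>0. \<forall>u1\<in>D. \<forall>u2\<in>D. norm (u1 - u) < \<delta> \<longrightarrow> norm (u2 - u) < \<delta> \<longrightarrow>
        norm (f u1 - f u2 - F (u1 - u2)) \<le> \<epsilon> * norm (u1 - u2)" using \<delta>(1) by blast
  qed
  moreover have "F w \<in> L'" for w using g(1) by (auto simp: F)
  ultimately show ?thesis by (rule that)
qed

lemma strict_deriv_has_derivative: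
  assumes u: "u \<in> D" and F: "strict_deriv u F"
  shows "(f has_derivative F) (at u within L)"
  unfolding has_derivative_within_alt
proof (intro conjI allI impI)
  show "bounded_linear F" by (rule blinfun.bounded_linear_right)
  fix e :: real assume e: "0 < e"
  obtain \<delta> where \<delta>: "0 < \<delta>" "\<And>u1 u2. u1 \<in> D \<Longrightarrow> u2 \<in> D \<Longrightarrow> norm (u1 - u) < \<delta> \<Longrightarrow> norm (u2 - u) < \<delta> \<Longrightarrow>
      norm (f u1 - f u2 - F (u1 - u2)) \<le> e * norm (u1 - u2)"
    by (rule strict_derivE[OF F e]) (rule that)
  obtain d where d: "0 < d" "\<And>w. w \<in> L \<Longrightarrow> norm (w - u) < d \<Longrightarrow> w \<in> D" using D_ball[OF u] by blast
  show "\<exists>d>0. \<forall>y\<in>L. norm (y - u) < d \<longrightarrow> norm (f y - f u - F (y - u)) \<le> e * norm (y - u)"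
    using d \<delta> u by (intro exI[of _ "min d \<delta>"]) auto
qed

lemma strict_deriv_inj:
  assumes "strict_deriv u F" shows "inj_on F L"
  using assms unfolding strict_deriv_def by (metis inj_onI)

text \<open>Strictness at \<open>u\<close> also bounds difference quotients based at nearby points
  \<open>u'\<close>. For a small increment at \<open>u'\<close> both \<open>F u\<close> and
  \<open>F u'\<close> approximate the same secant, which compares them in every direction of
  \<open>L\<close>.\<close>

lemma strict_deriv_continuous:
  assumes F: "\<And>u. u \<in> D \<Longrightarrow> strict_deriv u (F u)"
  shows "continuous_on D F"
  unfolding continuous_on_iff
proof (intro ballI allI impI)
  fix u and e :: real assume u: "u \<in> D" and e: "0 < e"
  then have e3: "0 < e / 3" by simp
  obtain \<delta> where \<delta>: "0 < \<delta>" "\<And>u1 u2. u1 \<in> D \<Longrightarrow> u2 \<in> D \<Longrightarrow> norm (u1 - u) < \<delta> \<Longrightarrow> norm (u2 - u) < \<delta> \<Longrightarrow>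
      norm (f u1 - f u2 - F u (u1 - u2)) \<le> e / 3 * norm (u1 - u2)"
    by (rule strict_derivE[OF F[OF u] e3]) (rule that)
  have "dist (F u') (F u) < e" if u': "u' \<in> D" "dist u' u < \<delta>" for u'
  proof -
    have "norm ((F u' - F u) x) \<le> 2 * (e / 3) * norm x" for x
    proof -
      let ?w = "oproj L x"
      have w: "?w \<in> L" by (rule oproj_mem[OF L])
      obtain \<delta>' where \<delta>': "0 < \<delta>'" "\<And>u1 u2. u1 \<in> D \<Longrightarrow> u2 \<in> D \<Longrightarrow> norm (u1 - u') < \<delta>' \<Longrightarrow> norm (u2 - u') < \<delta>' \<Longrightarrow>
          norm (f u1 - f u2 - F u' (u1 - u2)) \<le> e / 3 * norm (u1 - u2)"
        by (rule strict_derivE[OF F[OF u'(1)] e3]) (rule that)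
      obtain d where d: "0 < d" "\<And>w. w \<in> L \<Longrightarrow> norm (w - u') < d \<Longrightarrow> w \<in> D" using D_ball[OF u'(1)] by blast
      have pos: "0 < min (min d \<delta>') (\<delta> - norm (u' - u))" using d(1) \<delta>'(1) u'(2) by (simp add: dist_norm)
      obtain t where t: "0 < t" "t * norm ?w < min (min d \<delta>') (\<delta> - norm (u' - u))"
        using dist_le_small[OF norm_ge_zero pos] by blast
      let ?u = "u' + t *\<^sub>R ?w"
      have "?u \<in> L" using D_sub u'(1) w L by (auto intro: subspace_add subspace_scale)
      then have uD: "?u \<in> D" using t by (intro d(2)) auto
      have near: "norm (?u - u) < \<delta>"
        using norm_triangle_ineq[of "u' - u" "t *\<^sub>R ?w"] t by (simp add: algebra_simps)
      have 1: "norm (f ?u - f u' - F u' (t *\<^sub>R ?w)) \<le> e / 3 * (t * norm ?w)"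
        using \<delta>'(2)[OF uD u'(1)] t \<delta>'(1) by simp
      have 2: "norm (f ?u - f u' - F u (t *\<^sub>R ?w)) \<le> e / 3 * (t * norm ?w)"
        using \<delta>(2)[OF uD u'(1) near] u'(2) t by (simp add: dist_norm)
      have "t *\<^sub>R ((F u' - F u) ?w) = (f ?u - f u' - F u (t *\<^sub>R ?w)) - (f ?u - f u' - F u' (t *\<^sub>R ?w))"
        by (simp add: blinfun.scaleR_right minus_blinfun.rep_eq scaleR_diff_right)
      then have "norm (t *\<^sub>R ((F u' - F u) ?w)) \<le> e / 3 * (t * norm ?w) + e / 3 * (t * norm ?w)"
        by (simp only: order_trans[OF norm_triangle_ineq4 add_mono[OF 2 1]])
      then have "t * norm ((F u' - F u) ?w) \<le> t * (2 * (e / 3) * norm ?w)" using t(1) by (simp add: algebra_simps)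
      then have "norm ((F u' - F u) ?w) \<le> 2 * (e / 3) * norm ?w" using t(1) by (simp only: mult_le_cancel_left_pos)
      also have "\<dots> \<le> 2 * (e / 3) * norm x" using e by (intro mult_left_mono norm_oproj_le L) auto
      also have "(F u' - F u) ?w = (F u' - F u) x"
      proof -
        have "F u' x = F u' ?w" "F u x = F u ?w" using F[OF u'(1)] F[OF u] unfolding strict_deriv_def by blast+
        then show ?thesis by (simp add: minus_blinfun.rep_eq)
      qed
      finally show ?thesis .
    qed
    then have "norm (F u' - F u) \<le> 2 * (e / 3)" using e by (intro norm_blinfun_bound) auto
    then show ?thesis using e by (simp add: dist_norm)
  qed
  then show "\<exists>d>0. \<forall>u'\<in>D. dist u' u < d \<longrightarrow> dist (F u') (F u) < e" using \<delta>(1) by blast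
qed

end

text \<open>The hypothesis \<open>inv\<close> is invariance of domain for \<open>N\<close>. Secants
  of slope at most \<open>1/2\<close> make the projection near \<open>q\<close> injective with
  inverse of Lipschitz constant \<open>2\<close>, and \<open>inv\<close> makes its image open. The
  last conclusion, on the derivative at the base point, serves to prescribe velocities of
  curves.\<close>

lemma strict_tangent_parametrisation:
  fixes N :: "'v::euclidean_space set"
  assumes q: "q \<in> N" and tan: "strict_tangent N q L"
    and tans: "\<And>q'. q' \<in> N \<Longrightarrow> \<exists>L'. strict_tangent N q' L' \<and> dim L' = dim L"
    and inv: "\<And>O' h. openin (top_of_set N) O' \<Longrightarrow> continuous_on O' h \<Longrightarrow> inj_on h O' \<Longrightarrow> h ` O' \<subseteq> L \<Longrightarrow>
      openin (top_of_set L) (h ` O')"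
  obtains D f f' where "openin (top_of_set L) D" "openin (top_of_set N) (f ` D)" "f ` D \<subseteq> N"
    "homeomorphism D (f ` D) f (oproj L)" "oproj L q \<in> D" "f (oproj L q) = q"
    "\<And>u. u \<in> D \<Longrightarrow> (f has_derivative blinfun_apply (f' u)) (at u within L)"
    "\<And>u. u \<in> D \<Longrightarrow> inj_on (blinfun_apply (f' u)) L" "continuous_on D f'"
    "\<And>w. w \<in> L \<Longrightarrow> f' (oproj L q) w = w"
proof -
  have L: "subspace L" using tan by (simp add: strict_tangent_def)
  have half: "(0::real) < 1/2" by simp
  obtain \<delta> where \<delta>: "0 < \<delta>" "\<And>y z. y \<in> N \<Longrightarrow> z \<in> N \<Longrightarrow> dist y q < \<delta> \<Longrightarrow> dist z q < \<delta> \<Longrightarrow>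
      norm ((y - z) - oproj L (y - z)) \<le> 1/2 * norm (y - z)"
    by (rule strict_tangentD[OF tan half]) (rule that)
  define O' where "O' = N \<inter> ball q \<delta>"
  define D where "D = oproj L ` O'"
  have ON: "O' \<subseteq> N" by (auto simp: O'_def)
  have lip: "norm (y - z) \<le> 2 * norm (oproj L y - oproj L z)" if "y \<in> O'" "z \<in> O'" for y z
  proof -
    have "norm ((y - z) - oproj L (y - z)) \<le> 1/2 * norm (y - z)"
      using that by (intro \<delta>(2)) (auto simp: O'_def dist_commute)
    moreover have "norm (y - z) \<le> norm ((y - z) - oproj L (y - z)) + norm (oproj L (y - z))"
      by (metis diff_add_cancel norm_triangle_ineq)
    ultimately show ?thesis by (simp add: blinfun.diff_right)
  qed
  have inj: "inj_on (oproj L) O'" using lip by (intro inj_onI) fastforce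
  define f where "f = inv_into O' (oproj L)"
  have fO: "f u \<in> O'" and pf: "oproj L (f u) = u" if "u \<in> D" for u
    using that unfolding D_def f_def by (auto intro: inv_into_into f_inv_into_f)
  have fp: "f (oproj L y) = y" if "y \<in> O'" for y unfolding f_def using inj that by simp
  have fD: "f ` D = O'" using fO fp unfolding D_def by force
  have opO: "openin (top_of_set N) O'" unfolding O'_def by (rule openin_open_Int) simp
  have cont: "continuous_on O' (oproj L)" by (intro continuous_intros)
  have opD: "openin (top_of_set L) D"
    unfolding D_def using oproj_mem[OF L] by (intro inv[OF opO cont inj]) auto
  have lipf: "norm (f u - f w) \<le> 2 * norm (u - w)" if "u \<in> D" "w \<in> D" for u w
    using lip[OF fO fO] pf that by metis
  interpret graph_over_subspace N L D f
    by unfold_locales (use L opD fO ON pf lipf in auto)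
  have qO: "q \<in> O'" using q \<delta>(1) by (simp add: O'_def)
  then have qD: "oproj L q \<in> D" "f (oproj L q) = q" using fp by (auto simp: D_def)
  \<comment> \<open>At the base point the tangent space is \<open>L\<close> itself: the derivative
    takes values in \<open>L\<close> and is a section of the projection, hence the identity on
    \<open>L\<close>.\<close>
  have ex: "\<exists>F. strict_deriv u F \<and> (u = oproj L q \<longrightarrow> (\<forall>w\<in>L. F w = w))" if u: "u \<in> D" for u
  proof (cases "u = oproj L q")
    case True
    have "strict_tangent N (f u) L" using tan qD True by simp
    then obtain F where F: "strict_deriv u F" "\<And>w. F w \<in> L" using strict_deriv_exists[OF u] by blast
    have "F w = w" if "w \<in> L" for w
      using F that unfolding strict_deriv_def by (metis oproj_id[OF L])
    then show ?thesis using F by blast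
  next
    case False
    obtain L' where "strict_tangent N (f u) L'" "dim L' = dim L" using tans[of "f u"] fO[OF u] ON by blast
    then obtain F where "strict_deriv u F" using strict_deriv_exists[OF u] by blast
    then show ?thesis using False by blast
  qed
  define f' where "f' u = (SOME F. strict_deriv u F \<and> (u = oproj L q \<longrightarrow> (\<forall>w\<in>L. F w = w)))" for u
  have f': "strict_deriv u (f' u) \<and> (u = oproj L q \<longrightarrow> (\<forall>w\<in>L. f' u w = w))" if "u \<in> D" for u
    unfolding f'_def by (rule someI_ex[OF ex[OF that]])
  have "continuous_on D f"
  proof (rule continuous_onI)
    fix u and e :: real assume "u \<in> D" "0 < e"
    then show "\<exists>d>0. \<forall>u'\<in>D. dist u' u < d \<longrightarrow> dist (f u') (f u) \<le> e"
      using lipf[OF _ \<open>u \<in> D\<close>] by (intro exI[of _ "e / 2"]) (fastforce simp: dist_norm)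
  qed
  then have hom: "homeomorphism D (f ` D) f (oproj L)"
    unfolding homeomorphism_def fD using cont pf fp fD by (auto simp: D_def)
  show ?thesis
  proof (rule that[OF opD _ _ hom qD])
    show "openin (top_of_set N) (f ` D)" "f ` D \<subseteq> N" using opO ON fD by auto
    show "(f has_derivative blinfun_apply (f' u)) (at u within L)" if "u \<in> D" for u
      using strict_deriv_has_derivative[OF that] f'[OF that] by blast
    show "inj_on (blinfun_apply (f' u)) L" if "u \<in> D" for u using strict_deriv_inj f'[OF that] by blast
    show "continuous_on D f'" using f' by (intro strict_deriv_continuous) blast
    show "f' (oproj L q) w = w" if "w \<in> L" for w using f'[OF qD(1)] that by blast
  qed
qed

lemma C1_submanifold_criterion:
  fixes N :: "'v::euclidean_space set"
  assumes tan: "\<And>q. q \<in> N \<Longrightarrow> \<exists>L. strict_tangent N q L \<and> dim L = m"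
    and inv: "\<And>O' h (L :: 'v set). subspace L \<Longrightarrow> dim L = m \<Longrightarrow> openin (top_of_set N) O' \<Longrightarrow> continuous_on O' h \<Longrightarrow>
      inj_on h O' \<Longrightarrow> h ` O' \<subseteq> L \<Longrightarrow> openin (top_of_set L) (h ` O')"
  shows "C1_submanifold_euclidean m N"
  unfolding C1_submanifold_euclidean_def
proof
  fix q assume q: "q \<in> N"
  then obtain L where L: "strict_tangent N q L" "dim L = m" using tan by blast
  have sL: "subspace L" using L by (simp add: strict_tangent_def)
  obtain D f f' where Df: "openin (top_of_set L) D" "openin (top_of_set N) (f ` D)" "f ` D \<subseteq> N"
    "homeomorphism D (f ` D) f (oproj L)" "oproj L q \<in> D" "f (oproj L q) = q"
    "\<And>u. u \<in> D \<Longrightarrow> (f has_derivative blinfun_apply (f' u)) (at u within L)"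
    "\<And>u. u \<in> D \<Longrightarrow> inj_on (blinfun_apply (f' u)) L" "continuous_on D f'"
  proof (rule strict_tangent_parametrisation[OF q L(1)])
    show "\<exists>L'. strict_tangent N q' L' \<and> dim L' = dim L" if "q' \<in> N" for q' using tan[OF that] L(2) by simp
    show "openin (top_of_set L) (h ` O')"
      if "openin (top_of_set N) O'" "continuous_on O' h" "inj_on h O'" "h ` O' \<subseteq> L" for O' h
      by (rule inv[OF sL L(2) that])
  qed (rule that)
  have "C1_immersion_on L D f" unfolding C1_immersion_on_def using Df(7-9) by blast
  moreover have "q \<in> f ` D" using Df(5,6) by force
  ultimately show "\<exists>L D f f_inv. subspace L \<and> dim L = m \<and> openin (top_of_set L) D \<and>
        C1_immersion_on L D f \<and> homeomorphism D (f ` D) f f_inv \<and>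
        q \<in> f ` D \<and> openin (top_of_set N) (f ` D)"
    using sL L(2) Df(1,2,4) by blast
qed

section \<open>Affine charts and tangent spaces of projective sets\<close>

lemma grassmannian_1_span: "v \<noteq> 0 \<Longrightarrow> span {v} \<in> grassmannian 1"
  by (auto simp: grassmannian_def dim_span)

lemma grassmannian_1E:
  assumes "l \<in> grassmannian 1" obtains v where "v \<noteq> 0" "l = span {v}" "v \<in> l"
proof -
  have l: "subspace l" "dim l = 1" using assms by (auto simp: grassmannian_def)
  then obtain e where e: "e \<in> l" "norm e = 1" using unit_vector_in_line by blast
  have "e \<noteq> 0" using e(2) by auto
  then show ?thesis using that line_eq_span[OF l e(1)] e(1) by blast
qed

lemma proj_space_UNIV: "proj_space UNIV = grassmannian 1"
  by (auto simp: proj_space_def)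

lemma span_chart_domain_iff: "v \<noteq> 0 \<Longrightarrow> span {v} \<in> chart_domain a \<longleftrightarrow> a \<bullet> v \<noteq> 0"
proof -
  assume v: "v \<noteq> 0"
  have "(\<exists>x\<in>span {v}. a \<bullet> x \<noteq> 0) \<longleftrightarrow> a \<bullet> v \<noteq> 0" by (auto simp: span_singleton)
  then show ?thesis unfolding chart_domain_def proj_space_UNIV using grassmannian_1_span[OF v] by blast
qed

lemma affine_chart_span: "a \<bullet> v \<noteq> 0 \<Longrightarrow> affine_chart a (span {v}) = (1 / (a \<bullet> v)) *\<^sub>R v"
  unfolding affine_chart_def by (rule the_equality) (auto simp: span_singleton field_simps)

lemma affine_chart_mem:
  assumes "l \<in> chart_domain a"
  shows "affine_chart a l \<in> l" "a \<bullet> affine_chart a l = 1" "span {affine_chart a l} = l"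
proof -
  have l: "l \<in> grassmannian 1" using assms by (simp add: chart_domain_def proj_space_UNIV)
  obtain v where v: "v \<noteq> 0" "l = span {v}" using grassmannian_1E[OF l] by blast
  have av: "a \<bullet> v \<noteq> 0" using assms v by (simp add: span_chart_domain_iff)
  have ch: "affine_chart a l = (1 / (a \<bullet> v)) *\<^sub>R v" unfolding v(2) by (rule affine_chart_span[OF av])
  then show m: "affine_chart a l \<in> l" using v by (simp add: span_base span_scale)
  show 1: "a \<bullet> affine_chart a l = 1" using ch av by simp
  then have "affine_chart a l \<noteq> 0" by auto
  then show "span {affine_chart a l} = l" using line_eq_span[of l] l m by (simp add: grassmannian_def)
qed

text \<open>When nonzero, the projection of \<open>a\<close> generates the line; this expresses the
  chart and its domain as continuous data of the projection.\<close>

lemma affine_chart_oproj: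
  assumes l: "l \<in> grassmannian 1"
  shows "l \<in> chart_domain a \<longleftrightarrow> a \<bullet> oproj l a \<noteq> 0"
    "a \<bullet> oproj l a \<noteq> 0 \<Longrightarrow> affine_chart a l = (1 / (a \<bullet> oproj l a)) *\<^sub>R oproj l a"
proof -
  have s: "subspace l" "dim l = 1" using l by (auto simp: grassmannian_def)
  obtain e where e: "e \<in> l" "norm e = 1" using unit_vector_in_line[OF s] by blast
  then have e0: "e \<noteq> 0" by auto
  have le: "l = span {e}" by (rule line_eq_span[OF s e(1) e0])
  have P: "oproj l a = (a \<bullet> e) *\<^sub>R e" by (rule oproj_line[OF s e])
  show iff: "l \<in> chart_domain a \<longleftrightarrow> a \<bullet> oproj l a \<noteq> 0"
    unfolding P using span_chart_domain_iff[OF e0, of a] le by simp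
  assume "a \<bullet> oproj l a \<noteq> 0"
  then have "a \<bullet> e \<noteq> 0" by (simp add: P)
  then show "affine_chart a l = (1 / (a \<bullet> oproj l a)) *\<^sub>R oproj l a"
    unfolding P using affine_chart_span[of a e] le by simp
qed

lemma dist_oproj_span_le:
  fixes v w :: "'v::euclidean_space"
  assumes "v \<noteq> 0" "w \<noteq> 0"
  shows "dist (oproj (span {v})) (oproj (span {w})) \<le> 4 * (norm (v - w) / norm v)"
proof (rule gap_le_of_one_sided)
  show "dim (span {v}) = dim (span {w})" using assms by (simp add: dim_span)
  fix x assume "x \<in> span {v}"
  then obtain t where x: "x = t *\<^sub>R v" by (auto simp: span_singleton)
  have "norm (x - oproj (span {w}) x) \<le> norm (x - t *\<^sub>R w)"
    by (rule norm_diff_oproj_le) (auto intro: span_base span_scale)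
  also have "x - t *\<^sub>R w = t *\<^sub>R (v - w)" by (simp add: x scaleR_diff_right)
  also have "norm \<dots> = norm (v - w) / norm v * norm x" using assms by (simp add: x)
  finally show "norm (x - oproj (span {w}) x) \<le> norm (v - w) / norm v * norm x" .
qed auto

text \<open>The coordinates, in all charts, of the velocity at time \<open>0\<close> of \<open>span {F t}\<close> with
  \<open>F 0 = p\<close> and \<open>F' 0 = v\<close>.\<close>

definition velocity_field :: "'v::euclidean_space \<Rightarrow> 'v \<Rightarrow> 'v \<Rightarrow> 'v" where
  "velocity_field p v = (\<lambda>b. if b \<bullet> p \<noteq> 0 then (1 / (b \<bullet> p)) *\<^sub>R v - ((b \<bullet> v) / (b \<bullet> p)\<^sup>2) *\<^sub>R p else 0)"

text \<open>A differentiable lift \<open>F\<close> of the curve reads in the chart \<open>b\<close>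
  as \<open>F\<close> divided by \<open>b \<bullet> F\<close>. By the quotient rule the velocity
  depends only on \<open>F 0\<close> and \<open>F' 0\<close>, so that one lift gives the velocities
  in all charts.\<close>

lemma chart_curve:
  fixes F :: "real \<Rightarrow> 'v::euclidean_space"
  assumes F: "\<And>t. t \<in> {-e<..<e} \<Longrightarrow> (F has_vector_derivative F' t) (at t)" "continuous_on {-e<..<e} F'"
    and e: "0 < e" and c: "\<And>t. t \<in> {-e<..<e} \<Longrightarrow> F t \<noteq> 0 \<and> c t = span {F t}" and b: "c 0 \<in> chart_domain b"
  obtains e' where "0 < e'" "e' \<le> e" "\<And>t. t \<in> {-e'<..<e'} \<Longrightarrow> c t \<in> chart_domain b"
    "(affine_chart b \<circ> c) C1_differentiable_on {-e'<..<e'}"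
    "((affine_chart b \<circ> c) has_vector_derivative velocity_field (F 0) (F' 0) b) (at 0)"
proof -
  have contF: "continuous_on {-e<..<e} F"
    by (intro continuous_at_imp_continuous_on ballI has_vector_derivative_continuous[OF F(1)])
  have b0: "b \<bullet> F 0 \<noteq> 0" using b c[of 0] e by (simp add: span_chart_domain_iff)
  have "isCont (\<lambda>t. b \<bullet> F t) 0"
    using F(1)[of 0] e by (intro continuous_intros has_vector_derivative_continuous) auto
  then have "\<forall>\<^sub>F t in at 0. b \<bullet> F t \<noteq> 0"
    using b0 by (intro tendsto_imp_eventually_ne[of "\<lambda>t. b \<bullet> F t" "b \<bullet> F 0"]) (simp_all add: isCont_def)
  then obtain d where d: "0 < d" "\<And>t. t \<noteq> 0 \<Longrightarrow> dist t 0 < d \<Longrightarrow> b \<bullet> F t \<noteq> 0"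
    by (auto simp: eventually_at)
  define e' where "e' = min d e"
  have e': "0 < e'" "e' \<le> e" using d(1) e by (auto simp: e'_def)
  have sub: "{-e'<..<e'} \<subseteq> {-e<..<e}" using e' by auto
  have bF: "b \<bullet> F t \<noteq> 0" if "t \<in> {-e'<..<e'}" for t
  proof (cases "t = 0")
    case False
    have "\<bar>t\<bar> < d" using that by (auto simp: e'_def min_def split: if_splits)
    then show ?thesis using d(2)[of t] False by (simp add: dist_real_def)
  qed (use b0 in simp)
  have ch: "(affine_chart b \<circ> c) t = (1 / (b \<bullet> F t)) *\<^sub>R F t" if "t \<in> {-e'<..<e'}" for t
    using c[of t] that sub affine_chart_span[OF bF[OF that]] by auto
  define H where "H t = (1 / (b \<bullet> F t)) *\<^sub>R F' t - ((b \<bullet> F' t) / (b \<bullet> F t)\<^sup>2) *\<^sub>R F t" for t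
  have H: "((affine_chart b \<circ> c) has_vector_derivative H t) (at t)" if t: "t \<in> {-e'<..<e'}" for t
  proof (rule has_vector_derivative_transform_within_open)
    have Ft: "(F has_vector_derivative F' t) (at t)" using F(1) t sub by blast
    have "((\<lambda>t. b \<bullet> F t) has_vector_derivative b \<bullet> F' t) (at t)"
      by (rule bounded_linear.has_vector_derivative[OF bounded_linear_inner_right Ft])
    then have "((\<lambda>t. b \<bullet> F t) has_field_derivative b \<bullet> F' t) (at t)"
      by (simp add: has_real_derivative_iff_has_vector_derivative)
    then have "((\<lambda>t. 1 / (b \<bullet> F t)) has_field_derivative - (b \<bullet> F' t) / (b \<bullet> F t)\<^sup>2) (at t)"
      using bF[OF t] by (auto intro!: derivative_eq_intros simp: power2_eq_square)
    then have "((\<lambda>t. (1 / (b \<bullet> F t)) *\<^sub>R F t) has_vector_derivative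
        ((1 / (b \<bullet> F t)) *\<^sub>R F' t + (- (b \<bullet> F' t) / (b \<bullet> F t)\<^sup>2) *\<^sub>R F t)) (at t)"
      by (rule has_vector_derivative_scaleR[OF _ Ft])
    then show "((\<lambda>t. (1 / (b \<bullet> F t)) *\<^sub>R F t) has_vector_derivative H t) (at t)"
      by (simp add: H_def)
    show "(1 / (b \<bullet> F x)) *\<^sub>R F x = (affine_chart b \<circ> c) x" if "x \<in> {-e'<..<e'}" for x
      using ch[OF that] by simp
  qed (use t in auto)
  show ?thesis
  proof (rule that[OF e'])
    show "c t \<in> chart_domain b" if "t \<in> {-e'<..<e'}" for t
      using c[of t] that sub bF[OF that] by (auto simp: span_chart_domain_iff)
    have "continuous_on {-e'<..<e'} H"
      unfolding H_def using bF
      by (intro continuous_intros continuous_on_subset[OF F(2) sub] continuous_on_subset[OF contF sub]) auto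
    then show "(affine_chart b \<circ> c) C1_differentiable_on {-e'<..<e'}"
      unfolding C1_differentiable_on_def using H by blast
    show "((affine_chart b \<circ> c) has_vector_derivative velocity_field (F 0) (F' 0) b) (at 0)"
      using H[of 0] e' b0 by (simp add: H_def velocity_field_def)
  qed
qed

lemma curve_velocity_span:
  fixes F :: "real \<Rightarrow> 'v::euclidean_space"
  assumes F: "\<And>t. t \<in> {-e<..<e} \<Longrightarrow> (F has_vector_derivative F' t) (at t)" "continuous_on {-e<..<e} F'"
    and e: "0 < e" and c: "\<And>t. t \<in> {-e<..<e} \<Longrightarrow> F t \<noteq> 0 \<and> c t = span {F t}"
  shows "curve_velocity c = velocity_field (F 0) (F' 0)"
    "(\<And>t. t \<in> {-e<..<e} \<Longrightarrow> c t \<in> M) \<Longrightarrow> C1_curve_in M c"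
proof -
  show "curve_velocity c = velocity_field (F 0) (F' 0)"
  proof
    fix b
    show "curve_velocity c b = velocity_field (F 0) (F' 0) b"
    proof (cases "c 0 \<in> chart_domain b")
      case True
      have "((affine_chart b \<circ> c) has_vector_derivative velocity_field (F 0) (F' 0) b) (at 0)"
        by (rule chart_curve[OF F e c True])
      then show ?thesis using True by (simp add: curve_velocity_def vector_derivative_at)
    next
      case False
      then have "b \<bullet> F 0 = 0" using c[of 0] e by (auto simp: span_chart_domain_iff)
      then show ?thesis using False by (simp add: curve_velocity_def velocity_field_def)
    qed
  qed
  assume M: "\<And>t. t \<in> {-e<..<e} \<Longrightarrow> c t \<in> M"
  show "C1_curve_in M c" unfolding C1_curve_in_def
  proof (intro conjI allI impI)
    show "c 0 \<in> M" using M[of 0] e by simp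
    fix b assume b: "c 0 \<in> chart_domain b"
    obtain e' where e': "0 < e'" "e' \<le> e" "\<And>t. t \<in> {-e'<..<e'} \<Longrightarrow> c t \<in> chart_domain b"
      "(affine_chart b \<circ> c) C1_differentiable_on {-e'<..<e'}"
      by (rule chart_curve[OF F e c b]) (assumption+, rule that)
    have "c ` {-e'<..<e'} \<subseteq> M \<inter> chart_domain b"
    proof (rule image_subsetI)
      fix t assume t: "t \<in> {-e'<..<e'}"
      then have "t \<in> {-e<..<e}" using e'(2) by simp
      then show "c t \<in> M \<inter> chart_domain b" using M e'(3)[OF t] by blast
    qed
    then show "\<exists>e>0. c ` {-e<..<e} \<subseteq> M \<inter> chart_domain b \<and> (affine_chart b \<circ> c) C1_differentiable_on {-e<..<e}"
      using e'(1,4) by blast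
  qed
qed

lemma C1_curve_in_chart:
  fixes M :: "'v::euclidean_space set set"
  assumes c: "C1_curve_in M c" and b: "c 0 \<in> chart_domain a"
  obtains e F F' where "0 < e" "\<And>t. t \<in> {-e<..<e} \<Longrightarrow> (F has_vector_derivative F' t) (at t)"
    "\<And>t. t \<in> {-e<..<e} \<Longrightarrow> c t \<in> M \<inter> chart_domain a \<and> F t = affine_chart a (c t)"
    "curve_velocity c = velocity_field (F 0) (F' 0)"
proof -
  obtain e where e: "0 < e" "c ` {-e<..<e} \<subseteq> M \<inter> chart_domain a" "(affine_chart a \<circ> c) C1_differentiable_on {-e<..<e}"
    using c b unfolding C1_curve_in_def by blast
  then obtain F' where F': "\<And>t. t \<in> {-e<..<e} \<Longrightarrow> ((affine_chart a \<circ> c) has_vector_derivative F' t) (at t)"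
    "continuous_on {-e<..<e} F'" unfolding C1_differentiable_on_def by blast
  have ch: "(affine_chart a \<circ> c) t \<noteq> 0 \<and> c t = span {(affine_chart a \<circ> c) t}" if "t \<in> {-e<..<e}" for t
    using e(2) that affine_chart_mem(2,3)[of "c t" a] by fastforce
  show ?thesis
  proof (rule that[OF e(1) F'(1)])
    show "c t \<in> M \<inter> chart_domain a \<and> (affine_chart a \<circ> c) t = affine_chart a (c t)" if "t \<in> {-e<..<e}" for t
      using e(2) that by auto
    show "curve_velocity c = velocity_field ((affine_chart a \<circ> c) 0) (F' 0)"
      by (rule curve_velocity_span(1)[OF F' e(1) ch])
  qed
qed

text \<open>The difference quotients lie in \<open>L\<close> up to an error that is small relative
  to their size, and this passes to the limit.\<close>

lemma vector_derivative_in_subspace: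
  fixes F :: "real \<Rightarrow> 'v::euclidean_space"
  assumes F: "(F has_vector_derivative v) (at 0)" and L: "subspace L"
    and near: "\<And>\<epsilon>. 0 < \<epsilon> \<Longrightarrow> \<exists>\<delta>>0. \<forall>t. \<bar>t\<bar> < \<delta> \<longrightarrow> norm ((F t - F 0) - oproj L (F t - F 0)) \<le> \<epsilon> * norm (F t - F 0)"
  shows "v \<in> L"
proof -
  let ?q = "\<lambda>t. (1 / t) *\<^sub>R (F t - F 0)"
  have lim: "(?q \<longlongrightarrow> v) (at 0)"
  proof (rule Lim_transform_eventually)
    have "((\<lambda>t. norm (F t - F 0 - t *\<^sub>R v) / norm t) \<longlongrightarrow> 0) (at 0)"
      using F by (simp add: has_vector_derivative_def has_derivative_at)
    then have "((\<lambda>t. (F t - F 0 - t *\<^sub>R v) /\<^sub>R norm t) \<longlongrightarrow> 0) (at 0)"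
      by (intro tendsto_norm_zero_cancel[where 'b = 'v]) (simp add: divide_inverse mult.commute)
    \<comment> \<open>The derivative is given by quotients with \<open>norm t\<close>; the factor
      \<open>sgn t\<close> restores the signed quotient.\<close>
    then have "((\<lambda>t. sgn t *\<^sub>R ((F t - F 0 - t *\<^sub>R v) /\<^sub>R norm t)) \<longlongrightarrow> 0) (at 0)"
      by (rule Lim_null_comparison[rotated, OF tendsto_norm_zero]) (auto simp: sgn_if)
    then show "((\<lambda>t. v + sgn t *\<^sub>R ((F t - F 0 - t *\<^sub>R v) /\<^sub>R norm t)) \<longlongrightarrow> v) (at 0)"
      using tendsto_add[OF tendsto_const, of _ 0] by force
    have "v + sgn t *\<^sub>R ((F t - F 0 - t *\<^sub>R v) /\<^sub>R norm t) = ?q t" if "t \<noteq> 0" for t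
      using that by (auto simp: sgn_if scaleR_diff_right divide_inverse)
    then show "\<forall>\<^sub>F t in at 0. v + sgn t *\<^sub>R ((F t - F 0 - t *\<^sub>R v) /\<^sub>R norm t) = ?q t"
      by (auto simp: eventually_at intro!: exI[of _ 1])
  qed
  have le: "norm (v - oproj L v) \<le> \<epsilon> * norm v" if eps: "0 < \<epsilon>" for \<epsilon>
  proof (rule tendsto_le)
    show "((\<lambda>t. \<epsilon> * norm (?q t)) \<longlongrightarrow> \<epsilon> * norm v) (at 0)"
      "((\<lambda>t. norm (?q t - oproj L (?q t))) \<longlongrightarrow> norm (v - oproj L v)) (at 0)"
      by (intro tendsto_intros lim)+
    obtain \<delta> where \<delta>: "0 < \<delta>" "\<And>t. \<bar>t\<bar> < \<delta> \<Longrightarrow> norm ((F t - F 0) - oproj L (F t - F 0)) \<le> \<epsilon> * norm (F t - F 0)"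
      using near[OF eps] by blast
    have "norm (?q t - oproj L (?q t)) \<le> \<epsilon> * norm (?q t)" if "\<bar>t\<bar> < \<delta>" for t
    proof -
      have "?q t - oproj L (?q t) = (1 / t) *\<^sub>R ((F t - F 0) - oproj L (F t - F 0))"
        unfolding blinfun.scaleR_right scaleR_diff_right[of _ _ "oproj L (F t - F 0)"] ..
      then have "norm (?q t - oproj L (?q t)) = \<bar>1 / t\<bar> * norm ((F t - F 0) - oproj L (F t - F 0))"
        by (simp only: norm_scaleR)
      also have "\<dots> \<le> \<bar>1 / t\<bar> * (\<epsilon> * norm (F t - F 0))" by (intro mult_left_mono \<delta>(2) that) simp
      finally show ?thesis by (simp add: mult_ac)
    qed
    then show "\<forall>\<^sub>F t in at 0. norm (?q t - oproj L (?q t)) \<le> \<epsilon> * norm (?q t)"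
      using \<delta>(1) by (auto simp: eventually_at dist_real_def intro!: exI[of _ \<delta>])
  qed simp
  have "norm (v - oproj L v) = 0"
  proof (rule ccontr)
    assume "norm (v - oproj L v) \<noteq> 0"
    then have pos: "0 < norm (v - oproj L v)" by simp
    \<comment> \<open>This choice of \<open>\<epsilon>\<close> makes
      \<open>\<epsilon> * norm v\<close> at most half of the supposedly positive distance.\<close>
    then have "norm (v - oproj L v) \<le> norm (v - oproj L v) / (2 * (norm v + 1)) * norm v"
      by (intro le) (simp add: add_nonneg_pos)
    also have "\<dots> \<le> norm (v - oproj L v) * (norm v / (2 * (norm v + 1)))" by simp
    also have "\<dots> \<le> norm (v - oproj L v) * (1 / 2)"
      by (intro mult_left_mono) (auto simp: divide_simps add_nonneg_pos)
    finally show False using pos by simp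
  qed
  then show ?thesis using oproj_fixed_iff[OF L, of v] by simp
qed

section \<open>The limit set as a submanifold\<close>

lemma dim_Int_hyperplane:
  fixes W :: "'v::euclidean_space set"
  assumes W: "subspace W" and p: "p \<in> W" "a \<bullet> p = 1"
  shows "subspace (W \<inter> {v. a \<bullet> v = 0})" "Suc (dim (W \<inter> {v. a \<bullet> v = 0})) = dim W"
proof -
  let ?L = "W \<inter> {v. a \<bullet> v = 0}"
  show L: "subspace ?L" using W by (intro subspace_inter subspace_hyperplane)
  have "insert p ?L \<subseteq> W" using p by auto
  moreover have "W \<subseteq> span (insert p ?L)"
  proof
    fix w assume w: "w \<in> W"
    have "w - (a \<bullet> w) *\<^sub>R p \<in> ?L" using w p W by (simp add: subspace_diff subspace_scale inner_diff_right)
    then have "w - (a \<bullet> w) *\<^sub>R p \<in> span (insert p ?L)" by (intro span_base) simp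
    moreover have "(a \<bullet> w) *\<^sub>R p \<in> span (insert p ?L)" by (intro span_scale span_base) simp
    ultimately have "(w - (a \<bullet> w) *\<^sub>R p) + (a \<bullet> w) *\<^sub>R p \<in> span (insert p ?L)" by (rule span_add)
    then show "w \<in> span (insert p ?L)" by simp
  qed
  ultimately have "dim W = dim (insert p ?L)"
    using dim_subset[of "insert p ?L" W] dim_subset[of W "span (insert p ?L)"] by simp
  also have "\<dots> = Suc (dim ?L)"
    using p(2) L by (subst dim_insert) (auto simp: span_eq_iff[THEN iffD2])
  finally show "Suc (dim ?L) = dim W" by simp
qed

text \<open>The projection of \<open>w\<close> to \<open>W\<close> may leave the hyperplane;
  subtracting a multiple of \<open>p\<close> brings it back. Up to sign the multiple is
  \<open>a \<bullet> (w - oproj W w)\<close>, small with the distance to \<open>W\<close>.\<close>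

lemma norm_diff_oproj_hyperplane_le:
  fixes W :: "'v::euclidean_space set"
  assumes W: "subspace W" and p: "p \<in> W" "a \<bullet> p = 1" and w: "a \<bullet> w = 0"
  shows "norm (w - oproj (W \<inter> {v. a \<bullet> v = 0}) w) \<le> (1 + norm a * norm p) * norm (w - oproj W w)"
proof -
  let ?P = "oproj W w" and ?L = "W \<inter> {v. a \<bullet> v = 0}"
  let ?x = "?P - (a \<bullet> ?P) *\<^sub>R p"
  have x: "?x \<in> ?L" using oproj_mem[OF W] p W by (simp add: subspace_diff subspace_scale inner_diff_right)
  have "norm (w - oproj ?L w) \<le> norm (w - ?x)"
    by (rule norm_diff_oproj_le[OF dim_Int_hyperplane(1)[OF W p] x])
  also have "\<dots> \<le> norm (w - ?P) + \<bar>a \<bullet> ?P\<bar> * norm p"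
    using norm_triangle_ineq[of "w - ?P" "(a \<bullet> ?P) *\<^sub>R p"] by (simp add: algebra_simps)
  also have "\<bar>a \<bullet> ?P\<bar> = \<bar>a \<bullet> (w - ?P)\<bar>" using w by (simp add: inner_diff_right)
  also have "\<bar>a \<bullet> (w - ?P)\<bar> * norm p \<le> (norm a * norm (w - ?P)) * norm p"
    by (intro mult_right_mono Cauchy_Schwarz_ineq2) simp
  finally show ?thesis by (simp add: algebra_simps)
qed

section \<open>The limit set in affine charts\<close>

context sphere_hyperconvex
begin

abbreviation limit_set :: "'v set set" where "limit_set \<equiv> xi ` boundary_points G S"

definition chart_points :: "'v \<Rightarrow> 'v set" where
  "chart_points a = affine_chart a ` (limit_set \<inter> chart_domain a)"

lemma xi_line: "x \<in> boundary_points G S \<Longrightarrow> xi x \<in> grassmannian 1"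
  by (rule xi_grassmannian)

lemma xi_subset_R: "x \<in> boundary_points G S \<Longrightarrow> xi x \<subseteq> R.xi x"
  by (rule boundary_map_mono[OF anosov_rep_axioms R.anosov_rep_axioms]) (use r in auto)

lemma chart_pointsE:
  assumes "q \<in> chart_points a"
  obtains x where "x \<in> boundary_points G S" "xi x \<in> chart_domain a" "q = affine_chart a (xi x)"
  using assms by (auto simp: chart_points_def)

text \<open>In the chart of \<open>a\<close> the projectivised limit \<open>r\<close>-space is an
  affine subspace, and this is its direction space.\<close>

definition tangent_at :: "'v \<Rightarrow> (nat \<Rightarrow> 'g) set \<Rightarrow> 'v set" where
  "tangent_at a x = R.xi x \<inter> {v. a \<bullet> v = 0}"

context
  fixes a :: 'v and x
  assumes x: "x \<in> boundary_points G S" and dom: "xi x \<in> chart_domain a"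
begin

abbreviation (input) "q \<equiv> affine_chart a (xi x)"

lemma base_point: "q \<in> xi x" "q \<in> R.xi x" "a \<bullet> q = 1" "q \<noteq> 0" "span {q} = xi x" "q \<in> chart_points a"
  using affine_chart_mem[OF dom] xi_subset_R[OF x] x dom by (auto simp: chart_points_def)

lemma tangent_at: "subspace (tangent_at a x)" "dim (tangent_at a x) = r - 1"
  using dim_Int_hyperplane[OF R.subspace_xi[OF x] base_point(2,3)] R.dim_xi[OF x]
  by (auto simp: tangent_at_def)

text \<open>The secant of two chart points \<open>y\<close> and \<open>z\<close> is
  \<open>e + f\<close> with \<open>e = y\<close> and \<open>f = - z\<close> in two limit lines. The
  factor \<open>B\<close> pays for passing from the limit \<open>r\<close>-space to its intersection
  with the hyperplane.\<close>

lemma strict_tangent_chart_points: "strict_tangent (chart_points a) q (tangent_at a x)"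
  unfolding strict_tangent_def
proof (intro conjI allI impI tangent_at)
  fix \<epsilon> :: real assume eps: "0 < \<epsilon>"
  define B where "B = 1 + norm a * norm q"
  have B: "0 < B" by (simp add: B_def add_pos_nonneg)
  have "0 < \<epsilon> / B" using eps B by simp
  then obtain W where W: "openin bdry W" "x \<in> W"
    "\<And>y z e f. y \<in> W \<Longrightarrow> z \<in> W \<Longrightarrow> y \<noteq> z \<Longrightarrow> e \<in> xi y \<Longrightarrow> f \<in> xi z \<Longrightarrow>
      norm ((e + f) - oproj (R.xi x) (e + f)) \<le> \<epsilon> / B * norm (e + f)"
    by (rule secant_neighbourhood[OF x]) (rule that)
  obtain \<eta> where eta: "0 < \<eta>" "\<And>y. y \<in> boundary_points G S \<Longrightarrow> dist (oproj (xi y)) (oproj (xi x)) < \<eta> \<Longrightarrow> y \<in> W"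
    by (rule xi_embedding[OF W(1,2)]) (rule that)
  \<comment> \<open>Closeness in the chart must imply closeness on the boundary:
    \<open>4 / norm q\<close> is the loss from vectors to lines, and \<open>\<eta>\<close> comes
    from the embedding property.\<close>
  define \<delta> where "\<delta> = \<eta> * norm q / 4"
  have nq: "0 < norm q" using base_point(4) by simp
  have near: "\<exists>y'. y' \<in> W \<and> y \<in> xi y' \<and> y = affine_chart a (xi y') \<and> a \<bullet> y = 1"
    if y: "y \<in> chart_points a" "dist y q < \<delta>" for y
  proof -
    obtain y' where y': "y' \<in> boundary_points G S" "xi y' \<in> chart_domain a" "y = affine_chart a (xi y')"
      using chart_pointsE[OF y(1)] by blast
    note m = affine_chart_mem[OF y'(2)]
    have "y \<noteq> 0" using m(2) y'(3) by auto
    then have "dist (oproj (span {q})) (oproj (span {y})) \<le> 4 * (norm (q - y) / norm q)"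
      by (rule dist_oproj_span_le[OF base_point(4)])
    also have "\<dots> < \<eta>" using y(2) nq by (simp add: \<delta>_def dist_norm norm_minus_commute field_simps)
    finally have "dist (oproj (xi y')) (oproj (xi x)) < \<eta>"
      using m(3) base_point(5) y'(3) by (simp add: dist_commute)
    then show ?thesis using eta(2)[OF y'(1)] m y'(3) by blast
  qed
  have "norm ((y - z) - oproj (tangent_at a x) (y - z)) \<le> \<epsilon> * norm (y - z)"
    if yz: "y \<in> chart_points a" "z \<in> chart_points a" "dist y q < \<delta>" "dist z q < \<delta>" for y z
  proof -
    obtain y' where y': "y' \<in> W" "y \<in> xi y'" "y = affine_chart a (xi y')" "a \<bullet> y = 1" using near[OF yz(1,3)] by blast
    obtain z' where z': "z' \<in> W" "z \<in> xi z'" "z = affine_chart a (xi z')" "a \<bullet> z = 1" using near[OF yz(2,4)] by blast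
    show ?thesis
    proof (cases "y' = z'")
      case True
      then show ?thesis using y'(3) z'(3) by simp
    next
      case False
      have zb: "z' \<in> boundary_points G S" using z'(1) openin_subset[OF W(1)] by (auto simp: topspace_gromov_boundary)
      have "- z \<in> xi z'" using subspace_neg[OF subspace_xi[OF zb] z'(2)] .
      then have 1: "norm ((y - z) - oproj (R.xi x) (y - z)) \<le> \<epsilon> / B * norm (y - z)"
        using W(3)[OF y'(1) z'(1) False y'(2), of "- z"] by simp
      have "norm ((y - z) - oproj (tangent_at a x) (y - z)) \<le> B * norm ((y - z) - oproj (R.xi x) (y - z))"
        unfolding tangent_at_def B_def
        by (rule norm_diff_oproj_hyperplane_le[OF R.subspace_xi[OF x] base_point(2,3)])
          (simp add: inner_diff_right y'(4) z'(4))
      also have "\<dots> \<le> B * (\<epsilon> / B * norm (y - z))" using B by (intro mult_left_mono 1) auto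
      finally show ?thesis using B by simp
    qed
  qed
  moreover have "0 < \<delta>" using eta(1) nq by (simp add: \<delta>_def)
  ultimately show "\<exists>\<delta>>0. \<forall>y\<in>chart_points a. \<forall>z\<in>chart_points a. dist y q < \<delta> \<longrightarrow> dist z q < \<delta> \<longrightarrow>
      norm ((y - z) - oproj (tangent_at a x) (y - z)) \<le> \<epsilon> * norm (y - z)" by blast
qed

end

text \<open>An open set of chart points is the injective continuous image of an open part
  \<open>O''\<close> of the boundary sphere, so \<open>h\<close> composed with this map falls under
  invariance of domain on the sphere.\<close>

lemma chart_points_invariance_of_domain:
  fixes h :: "'v \<Rightarrow> 'v"
  assumes O: "openin (top_of_set (chart_points a)) O'" and h: "continuous_on O' h" "inj_on h O'"
    and L: "subspace L" "dim L = r - 1" "h ` O' \<subseteq> L"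
  shows "openin (top_of_set L) (h ` O')"
proof -
  let ?U = "{x \<in> topspace bdry. oproj (xi x) \<in> {P :: 'v \<Rightarrow>\<^sub>L 'v. a \<bullet> P a \<noteq> 0}}"
  let ?f = "\<lambda>x. affine_chart a (xi x)"
  have "open {P :: 'v \<Rightarrow>\<^sub>L 'v. a \<bullet> P a \<noteq> 0}"
    by (intro open_Collect_neq continuous_intros)
  then have U: "openin bdry ?U" by (intro openin_continuous_map_preimage[OF continuous_map_xi]) simp
  have dom: "x \<in> ?U \<longleftrightarrow> x \<in> boundary_points G S \<and> xi x \<in> chart_domain a" for x
    using affine_chart_oproj(1)[OF xi_line, of x a] by (auto simp: topspace_gromov_boundary)
  have cf: "continuous_map (subtopology bdry ?U) euclidean ?f"
  proof (rule continuous_map_eq)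
    have "continuous_on {P :: 'v \<Rightarrow>\<^sub>L 'v. a \<bullet> P a \<noteq> 0} (\<lambda>P :: 'v \<Rightarrow>\<^sub>L 'v. (1 / (a \<bullet> P a)) *\<^sub>R P a)"
      by (intro continuous_intros) auto
    then have "continuous_map (top_of_set {P :: 'v \<Rightarrow>\<^sub>L 'v. a \<bullet> P a \<noteq> 0}) euclidean (\<lambda>P :: 'v \<Rightarrow>\<^sub>L 'v. (1 / (a \<bullet> P a)) *\<^sub>R P a)"
      by simp
    moreover have "continuous_map (subtopology bdry ?U) (top_of_set {P :: 'v \<Rightarrow>\<^sub>L 'v. a \<bullet> P a \<noteq> 0}) (\<lambda>x. oproj (xi x))"
      by (rule continuous_map_into_subtopology[OF continuous_map_from_subtopology[OF continuous_map_xi]]) auto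
    ultimately show "continuous_map (subtopology bdry ?U) euclidean ((\<lambda>P :: 'v \<Rightarrow>\<^sub>L 'v. (1 / (a \<bullet> P a)) *\<^sub>R P a) \<circ> (\<lambda>x. oproj (xi x)))"
      by (rule continuous_map_compose[rotated])
    fix x assume "x \<in> topspace (subtopology bdry ?U)"
    then have "x \<in> boundary_points G S" "a \<bullet> oproj (xi x) a \<noteq> 0" by (auto simp: topspace_gromov_boundary)
    then show "((\<lambda>P :: 'v \<Rightarrow>\<^sub>L 'v. (1 / (a \<bullet> P a)) *\<^sub>R P a) \<circ> (\<lambda>x. oproj (xi x))) x = ?f x"
      using affine_chart_oproj(2)[OF xi_line] by simp
  qed
  obtain T where T: "open T" "O' = chart_points a \<inter> T" using O by (auto simp: openin_open)
  define O'' where "O'' = {x \<in> topspace (subtopology bdry ?U). ?f x \<in> T}"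
  have "openin (subtopology bdry ?U) O''"
    unfolding O''_def by (intro openin_continuous_map_preimage[OF cf]) (use T in simp)
  then have O'': "openin bdry O''" "O'' \<subseteq> ?U"
    using openin_trans_full[OF _ U] by (simp, auto simp: O''_def)
  have memO'': "x \<in> O'' \<longleftrightarrow> x \<in> ?U \<and> ?f x \<in> T" for x by (auto simp: O''_def)
  have im: "?f ` O'' = O'"
  proof (intro equalityI subsetI)
    fix y assume "y \<in> ?f ` O''"
    then obtain x where x: "x \<in> O''" "y = ?f x" by blast
    then have "x \<in> boundary_points G S" "xi x \<in> chart_domain a" "?f x \<in> T" using dom memO'' by blast+
    then show "y \<in> O'" unfolding T(2) chart_points_def x(2) by blast
  next
    fix y assume "y \<in> O'"
    then have y: "y \<in> chart_points a" "y \<in> T" using T(2) by auto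
    obtain x where x: "x \<in> boundary_points G S" "xi x \<in> chart_domain a" "y = ?f x"
      using y(1) by (rule chart_pointsE)
    then have "x \<in> O''" using y(2) memO''[of x] dom[of x] by blast
    then show "y \<in> ?f ` O''" using x(3) by blast
  qed
  have cf': "continuous_map (subtopology bdry O'') (top_of_set O') ?f"
  proof (rule continuous_map_into_subtopology)
    have "subtopology bdry O'' = subtopology (subtopology bdry ?U) O''"
      using O''(2) by (simp add: subtopology_subtopology inf.absorb2)
    then show "continuous_map (subtopology bdry O'') euclidean ?f" using continuous_map_from_subtopology[OF cf] by simp
  qed (use im in auto)
  have ch: "continuous_map (top_of_set O') euclidean h" using h(1) by simp
  have "openin (top_of_set L) ((h \<circ> ?f) ` O'')"
  proof (rule invariance_of_domain_nsphere[OF sphere _ _ O''(1)])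
    show "1 \<le> r" "r \<le> DIM('v)" using r by auto
    show "continuous_map (subtopology bdry O'') euclidean (h \<circ> ?f)" by (rule continuous_map_compose[OF cf' ch])
    show "inj_on (h \<circ> ?f) O''"
    proof (rule comp_inj_on)
      show "inj_on ?f O''"
      proof (rule inj_onI)
        fix x y assume xy: "x \<in> O''" "y \<in> O''" "?f x = ?f y"
        then have d: "x \<in> boundary_points G S" "xi x \<in> chart_domain a" "y \<in> boundary_points G S" "xi y \<in> chart_domain a"
          using dom memO'' by blast+
        then have "xi x = xi y" using affine_chart_mem(3) xy(3) by metis
        then show "x = y" using xi_inj d by blast
      qed
      show "inj_on h (?f ` O'')" unfolding im by (rule h(2))
    qed
    show "subspace L" "dim L < r" using L r by auto
    show "(h \<circ> ?f) ` O'' \<subseteq> L" using L(3) im by auto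
  qed
  then show ?thesis using im by (metis image_comp)
qed

lemma C1_submanifold_limit_set: "C1_submanifold_proj limit_set"
  unfolding C1_submanifold_proj_def
proof (intro conjI exI allI)
  show "limit_set \<subseteq> proj_space UNIV" using xi_line by (auto simp: proj_space_UNIV)
  fix a
  show "C1_submanifold_euclidean (r - 1) (affine_chart a ` (limit_set \<inter> chart_domain a))"
    unfolding chart_points_def[symmetric]
  proof (rule C1_submanifold_criterion)
    fix q assume "q \<in> chart_points a"
    then obtain x where x: "x \<in> boundary_points G S" "xi x \<in> chart_domain a" "q = affine_chart a (xi x)"
      by (rule chart_pointsE)
    then show "\<exists>L. strict_tangent (chart_points a) q L \<and> dim L = r - 1"
      using strict_tangent_chart_points[OF x(1,2)] tangent_at(2)[OF x(1,2)] by blast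
  qed (rule chart_points_invariance_of_domain)
qed

section \<open>Tangent spaces in a chart\<close>

context
  fixes x and a :: 'v
  assumes x: "x \<in> boundary_points G S" and dom: "xi x \<in> chart_domain a"
begin

text \<open>A curve in the limit set has secants nearly in \<open>tangent_at a x\<close>, hence also
  its derivative there. Conversely, a segment in direction \<open>v\<close> through the projected
  base point is lifted by the parametrisation, whose derivative at that point fixes
  \<open>v\<close>.\<close>

lemma tangent_space_limit_set:
  "tangent_space limit_set (xi x) = velocity_field (affine_chart a (xi x)) ` tangent_at a x"
proof (intro equalityI subsetI)
  let ?q = "affine_chart a (xi x)"
  note st = strict_tangent_chart_points[OF x dom]
  fix V assume "V \<in> tangent_space limit_set (xi x)"
  then obtain c where c: "C1_curve_in limit_set c" "c 0 = xi x" "V = curve_velocity c"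
    by (auto simp: tangent_space_def)
  then have "c 0 \<in> chart_domain a" using dom by simp
  then obtain e F F' where F: "0 < e" "\<And>t. t \<in> {-e<..<e} \<Longrightarrow> (F has_vector_derivative F' t) (at t)"
    "\<And>t. t \<in> {-e<..<e} \<Longrightarrow> c t \<in> limit_set \<inter> chart_domain a \<and> F t = affine_chart a (c t)"
    "curve_velocity c = velocity_field (F 0) (F' 0)"
    by (rule C1_curve_in_chart[OF c(1)]) (rule that)
  have F0: "F 0 = ?q" using F(1) F(3)[of 0] c(2) by simp
  have FN: "F t \<in> chart_points a" if "t \<in> {-e<..<e}" for t using F(3)[OF that] by (auto simp: chart_points_def)
  have d0: "(F has_vector_derivative F' 0) (at 0)" using F(1,2) by simp
  have "F' 0 \<in> tangent_at a x"
  proof (rule vector_derivative_in_subspace[OF d0 tangent_at(1)[OF x dom]])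
    fix \<epsilon> :: real assume "0 < \<epsilon>"
    then obtain \<delta> where \<delta>: "0 < \<delta>" "\<And>y z. y \<in> chart_points a \<Longrightarrow> z \<in> chart_points a \<Longrightarrow> dist y ?q < \<delta> \<Longrightarrow> dist z ?q < \<delta> \<Longrightarrow>
        norm ((y - z) - oproj (tangent_at a x) (y - z)) \<le> \<epsilon> * norm (y - z)"
      by (rule strict_tangentD[OF st]) (rule that)
    have "isCont F 0" by (rule has_vector_derivative_continuous[OF d0])
    then obtain d where d: "0 < d" "\<And>t. dist t 0 < d \<Longrightarrow> dist (F t) (F 0) < \<delta>"
      using \<delta>(1) unfolding continuous_at_eps_delta by (auto simp: dist_real_def dist_norm)
    have "norm ((F t - F 0) - oproj (tangent_at a x) (F t - F 0)) \<le> \<epsilon> * norm (F t - F 0)" if "\<bar>t\<bar> < min e d" for t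
    proof (rule \<delta>(2)[OF FN FN])
      have "\<bar>t\<bar> < e" "dist t 0 < d" using that by (auto simp: dist_real_def)
      then show "t \<in> {-e<..<e}" "dist (F t) ?q < \<delta>" using d(2)[of t] F0 by auto
      show "0 \<in> {-e<..<e}" "dist (F 0) ?q < \<delta>" using F(1) \<delta>(1) F0 by auto
    qed
    then show "\<exists>\<delta>>0. \<forall>t. \<bar>t\<bar> < \<delta> \<longrightarrow> norm ((F t - F 0) - oproj (tangent_at a x) (F t - F 0)) \<le> \<epsilon> * norm (F t - F 0)"
      using F(1) d(1) by (intro exI[of _ "min e d"]) auto
  qed
  then show "V \<in> velocity_field ?q ` tangent_at a x" using c(3) F(4) F0 by simp
next
  let ?q = "affine_chart a (xi x)"
  let ?L = "tangent_at a x"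
  have L: "subspace ?L" "dim ?L = r - 1" using tangent_at[OF x dom] by auto
  note bp = base_point[OF x dom]
  fix V assume "V \<in> velocity_field ?q ` ?L"
  then obtain v where v: "v \<in> ?L" "V = velocity_field ?q v" by blast
  obtain D f f' where Df: "openin (top_of_set ?L) D" "openin (top_of_set (chart_points a)) (f ` D)" "f ` D \<subseteq> chart_points a"
    "homeomorphism D (f ` D) f (oproj ?L)" "oproj ?L ?q \<in> D" "f (oproj ?L ?q) = ?q"
    "\<And>u. u \<in> D \<Longrightarrow> (f has_derivative blinfun_apply (f' u)) (at u within ?L)"
    "\<And>u. u \<in> D \<Longrightarrow> inj_on (blinfun_apply (f' u)) ?L" "continuous_on D f'"
    "\<And>w. w \<in> ?L \<Longrightarrow> f' (oproj ?L ?q) w = w"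
  proof (rule strict_tangent_parametrisation[OF bp(6) strict_tangent_chart_points[OF x dom]])
    fix q' assume "q' \<in> chart_points a"
    then obtain y where y: "y \<in> boundary_points G S" "xi y \<in> chart_domain a" "q' = affine_chart a (xi y)"
      by (rule chart_pointsE)
    show "\<exists>L'. strict_tangent (chart_points a) q' L' \<and> dim L' = dim ?L"
      using strict_tangent_chart_points[OF y(1,2)] tangent_at(2)[OF y(1,2)] y(3) L(2) by (intro exI[of _ "tangent_at a y"]) simp
  next
    fix O' and h :: "'v \<Rightarrow> 'v"
    assume "openin (top_of_set (chart_points a)) O'" "continuous_on O' h" "inj_on h O'" "h ` O' \<subseteq> ?L"
    then show "openin (top_of_set ?L) (h ` O')" using L by (intro chart_points_invariance_of_domain)
  qed (rule that)
  define u where "u t = oproj ?L ?q + t *\<^sub>R v" for t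
  have uL: "u t \<in> ?L" for t unfolding u_def using v(1) L(1) by (intro subspace_add subspace_scale oproj_mem)
  obtain d where d: "0 < d" "\<And>w. w \<in> ?L \<Longrightarrow> dist w (oproj ?L ?q) < d \<Longrightarrow> w \<in> D"
    using Df(1,5) unfolding openin_contains_ball by (auto simp: dist_commute subset_iff)
  obtain e where e: "0 < e" "e * norm v < d" using dist_le_small[OF norm_ge_zero d(1)] by blast
  have uD: "u t \<in> D" if "t \<in> {-e<..<e}" for t
  proof (rule d(2)[OF uL])
    have "\<bar>t\<bar> * norm v \<le> e * norm v" using that by (intro mult_right_mono) auto
    then show "dist (u t) (oproj ?L ?q) < d" using e(2) by (simp add: u_def dist_norm)
  qed
  define F where "F = f \<circ> u"
  have du: "(u has_derivative (\<lambda>t. t *\<^sub>R v)) (at t)" for t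
    unfolding u_def by (auto intro!: derivative_eq_intros)
  have dF: "(F has_vector_derivative f' (u t) v) (at t)" if t: "t \<in> {-e<..<e}" for t
  proof -
    have "(f has_derivative blinfun_apply (f' (u t))) (at (u t) within range u)"
      using uL by (intro has_derivative_subset[OF Df(7)[OF uD[OF t]]]) auto
    from diff_chain_within[OF du this]
    have "(F has_derivative (\<lambda>s. f' (u t) (s *\<^sub>R v))) (at t)" by (simp add: F_def o_def)
    then show ?thesis by (simp add: has_vector_derivative_def blinfun.scaleR_right)
  qed
  have cu: "continuous_on {-e<..<e} u" unfolding u_def by (intro continuous_intros)
  have cF': "continuous_on {-e<..<e} (\<lambda>t. f' (u t) v)"
    using uD by (intro continuous_intros continuous_on_compose2[OF Df(9) cu]) auto
  have FN: "F t \<in> chart_points a" if "t \<in> {-e<..<e}" for t using Df(3) uD[OF that] by (auto simp: F_def)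
  have FM: "F t \<noteq> 0 \<and> span {F t} \<in> limit_set" if t: "t \<in> {-e<..<e}" for t
  proof -
    obtain y where y: "y \<in> boundary_points G S" "xi y \<in> chart_domain a" "F t = affine_chart a (xi y)"
      using chart_pointsE[OF FN[OF t]] by blast
    have "a \<bullet> F t = 1" "span {F t} = xi y" unfolding y(3) by (rule affine_chart_mem[OF y(2)])+
    then show ?thesis using y(1) by auto
  qed
  let ?c = "\<lambda>t. span {F t}"
  have ne: "F t \<noteq> 0 \<and> ?c t = span {F t}" if "t \<in> {-e<..<e}" for t using FM[OF that] by simp
  have F0: "F 0 = ?q" "f' (u 0) v = v" using Df(6) Df(10)[OF v(1)] by (auto simp: F_def u_def)
  have "C1_curve_in limit_set ?c" by (rule curve_velocity_span(2)[OF dF cF' e(1) ne]) (use FM in auto)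
  moreover have "curve_velocity ?c = velocity_field ?q v"
    using curve_velocity_span(1)[OF dF cF' e(1) ne] F0 by simp
  moreover have "?c 0 = xi x" using F0(1) bp(5) by simp
  ultimately show "V \<in> tangent_space limit_set (xi x)"
    unfolding tangent_space_def v(2) by (intro CollectI exI[of _ ?c]) simp
qed

text \<open>In the chart the projective subspace is affine: differences of curve points lie exactly
  in its direction space, and straight lines realise all directions.\<close>

lemma tangent_space_proj_R:
  "tangent_space (proj_space (R.xi x)) (xi x) = velocity_field (affine_chart a (xi x)) ` tangent_at a x"
proof (intro equalityI subsetI)
  let ?q = "affine_chart a (xi x)"
  note bp = base_point[OF x dom] and L = tangent_at(1)[OF x dom]
  fix V assume "V \<in> tangent_space (proj_space (R.xi x)) (xi x)"
  then obtain c where c: "C1_curve_in (proj_space (R.xi x)) c" "c 0 = xi x" "V = curve_velocity c"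
    by (auto simp: tangent_space_def)
  then have "c 0 \<in> chart_domain a" using dom by simp
  then obtain e F F' where F: "0 < e" "\<And>t. t \<in> {-e<..<e} \<Longrightarrow> (F has_vector_derivative F' t) (at t)"
    "\<And>t. t \<in> {-e<..<e} \<Longrightarrow> c t \<in> proj_space (R.xi x) \<inter> chart_domain a \<and> F t = affine_chart a (c t)"
    "curve_velocity c = velocity_field (F 0) (F' 0)"
    by (rule C1_curve_in_chart[OF c(1)]) (rule that)
  have F0: "F 0 = ?q" using F(1) F(3)[of 0] c(2) by simp
  have FL: "F t - F 0 \<in> tangent_at a x" if t: "t \<in> {-e<..<e}" for t
  proof -
    have "F t \<in> R.xi x" "a \<bullet> F t = 1"
      using F(3)[OF t] affine_chart_mem(1,2)[of "c t" a] by (auto simp: proj_space_def)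
    then show ?thesis
      using bp(2,3) subspace_diff[OF R.subspace_xi[OF x]] by (simp add: tangent_at_def F0 inner_diff_right)
  qed
  have d0: "(F has_vector_derivative F' 0) (at 0)" using F(1,2) by simp
  have "F' 0 \<in> tangent_at a x"
  proof (rule vector_derivative_in_subspace[OF d0 L])
    fix \<epsilon> :: real assume "0 < \<epsilon>"
    have "norm ((F t - F 0) - oproj (tangent_at a x) (F t - F 0)) \<le> \<epsilon> * norm (F t - F 0)" if "\<bar>t\<bar> < e" for t
    proof -
      have "t \<in> {-e<..<e}" using that by auto
      then have "oproj (tangent_at a x) (F t - F 0) = F t - F 0" by (intro oproj_id[OF L] FL)
      then show ?thesis using \<open>0 < \<epsilon>\<close> by simp
    qed
    then show "\<exists>\<delta>>0. \<forall>t. \<bar>t\<bar> < \<delta> \<longrightarrow> norm ((F t - F 0) - oproj (tangent_at a x) (F t - F 0)) \<le> \<epsilon> * norm (F t - F 0)"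
      using F(1) by blast
  qed
  then show "V \<in> velocity_field ?q ` tangent_at a x" using c(3) F(4) F0 by simp
next
  let ?q = "affine_chart a (xi x)"
  note bp = base_point[OF x dom]
  fix V assume "V \<in> velocity_field ?q ` tangent_at a x"
  then obtain v where v: "v \<in> R.xi x" "a \<bullet> v = 0" "V = velocity_field ?q v" by (auto simp: tangent_at_def)
  define F where "F t = ?q + t *\<^sub>R v" for t :: real
  have dF: "(F has_vector_derivative v) (at t)" for t
    unfolding F_def by (auto intro!: derivative_eq_intros)
  have aF: "a \<bullet> F t = 1" for t using bp(3) v(2) by (simp add: F_def inner_add_right)
  let ?c = "\<lambda>t. span {F t}"
  have ne: "F t \<noteq> 0 \<and> ?c t = span {F t}" for t using aF[of t] by auto
  have FR: "F t \<in> R.xi x" for t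
    unfolding F_def using bp(2) v(1) R.subspace_xi[OF x] by (intro subspace_add subspace_scale)
  have cM: "?c t \<in> proj_space (R.xi x)" for t
    unfolding proj_space_def using grassmannian_1_span[of "F t"] ne[of t] FR[of t] span_minimal[of "{F t}"] R.subspace_xi[OF x]
    by blast
  have cc: "continuous_on {-1<..<1::real} (\<lambda>_. v)" by (rule continuous_on_const)
  have "C1_curve_in (proj_space (R.xi x)) ?c"
    by (rule curve_velocity_span(2)[OF dF cc zero_less_one ne cM])
  moreover have "curve_velocity ?c = velocity_field ?q v"
    using curve_velocity_span(1)[OF dF cc zero_less_one ne] by (simp add: F_def)
  moreover have "?c 0 = xi x" using bp(5) by (simp add: F_def)
  ultimately show "V \<in> tangent_space (proj_space (R.xi x)) (xi x)"
    unfolding tangent_space_def v(3) by (intro CollectI exI[of _ ?c]) simp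
qed

end

lemma tangent_space_eq:
  assumes x: "x \<in> boundary_points G S"
  shows "tangent_space limit_set (xi x) = tangent_space (proj_space (R.xi x)) (xi x)"
proof -
  \<comment> \<open>A generator of the limit line defines a chart around that line, since
    \<open>a \<bullet> a\<close> is nonzero.\<close>
  obtain a where a: "a \<noteq> 0" "xi x = span {a}" using grassmannian_1E[OF xi_line[OF x]] by blast
  then have "xi x \<in> chart_domain a" using span_chart_domain_iff[OF a(1)] by simp
  then show ?thesis using tangent_space_limit_set[OF x] tangent_space_proj_R[OF x] by simp
qed

end

theorem proposition7p4:
  fixes G :: "('g, 'b) monoid_scheme"
    and S :: "'g set"
    and \<rho> :: "'g \<Rightarrow> ('v::euclidean_space \<Rightarrow> 'v) set"
    and r :: nat
  assumes "group G"
    and "symmetric_generating_set G S"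
    and "word_hyperbolic G S"
    and "2 \<le> r" and "r \<le> DIM('v) - 1"
    and "gromov_boundary G S homeomorphic_space nsphere (r - 1)"
    and "\<rho> \<in> hom G (PGL :: ('v \<Rightarrow> 'v) set monoid)"
    and "hyperconvex G S \<rho> r"
  shows "C1_submanifold_proj (boundary_map \<rho> 1 ` boundary_points G S) \<and>
    (\<forall>x\<in>boundary_points G S.
       tangent_space (boundary_map \<rho> 1 ` boundary_points G S) (boundary_map \<rho> 1 x) =
       tangent_space (proj_space (boundary_map \<rho> r x)) (boundary_map \<rho> 1 x))"
proof -
  interpret word_metric G S
    using assms(1,2) by (simp add: word_metric_def word_metric_axioms_def)
  have rd: "r < DIM('v)" using assms(4,5) by linarith
  have anosov: "anosov G S \<rho> 1" "anosov G S \<rho> r"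
    and sums: "\<forall>x\<in>boundary_points G S. \<forall>y\<in>boundary_points G S. \<forall>z\<in>boundary_points G S.
        x \<noteq> y \<and> y \<noteq> z \<and> x \<noteq> z \<longrightarrow>
        {u + v |u v. u \<in> boundary_map \<rho> 1 x \<and> v \<in> boundary_map \<rho> 1 y}
          \<inter> boundary_map \<rho> (DIM('v) - r) z = {0}"
    using assms(8) unfolding hyperconvex_def by auto
  obtain c \<mu> where c: "0 < c" "0 < \<mu>" "\<forall>\<gamma>\<in>carrier G. \<forall>g\<in>\<rho> \<gamma>.
      sigma (1 + 1) g / sigma 1 g \<le> c * exp (- \<mu> * real (word_length G S \<gamma>))"
    using anosov(1) unfolding anosov_def by (elim exE conjE)
  obtain c' \<mu>' where c': "0 < c'" "0 < \<mu>'" "\<forall>\<gamma>\<in>carrier G. \<forall>g\<in>\<rho> \<gamma>.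
      sigma (r + 1) g / sigma r g \<le> c' * exp (- \<mu>' * real (word_length G S \<gamma>))"
    using anosov(2) unfolding anosov_def by (elim exE conjE)
  interpret sphere_hyperconvex G S \<rho> c \<mu> r c' \<mu>'
  proof unfold_locales
    show "word_hyperbolic G S" "\<rho> \<in> hom G PGL" "0 < c" "0 < \<mu>" "0 < c'" "0 < \<mu>'" "2 \<le> r" "r < DIM('v)"
      "gromov_boundary G S homeomorphic_space nsphere (r - 1)" "(1::nat) \<le> 1" "1 < DIM('v)"
      using assms c c' rd by auto
    show "sigma (1 + 1) g / sigma 1 g \<le> c * exp (- \<mu> * real (word_length G S \<gamma>))"
      "sigma (r + 1) g / sigma r g \<le> c' * exp (- \<mu>' * real (word_length G S \<gamma>))"
      if "\<gamma> \<in> carrier G" "g \<in> \<rho> \<gamma>" for \<gamma> g using c(3) c'(3) that by blast+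
    show "{u + v |u v. u \<in> boundary_map \<rho> 1 x \<and> v \<in> boundary_map \<rho> 1 y} \<inter> boundary_map \<rho> (DIM('v) - r) z = {0}"
      if "x \<in> boundary_points G S" "y \<in> boundary_points G S" "z \<in> boundary_points G S" "x \<noteq> y" "y \<noteq> z" "x \<noteq> z" for x y z
      using mp[OF bspec[OF bspec[OF bspec[OF sums that(1)] that(2)] that(3)]] that(4-6) by blast
    \<comment> \<open>A sphere of positive dimension has no isolated points, which provides the rays
      from the identity.\<close>
    show "\<exists>\<gamma>. geodesic_ray G S \<gamma> \<and> \<gamma> 0 = \<one>\<^bsub>G\<^esub> \<and> ray_endpoint G S \<gamma> = x" if "x \<in> boundary_points G S" for x
      using that homeomorphic_nsphere_properties(3)[OF assms(6,4) less_imp_le[OF rd]]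
      by (intro based_ray_exists_of_not_isolated)
  qed
  show ?thesis using C1_submanifold_limit_set tangent_space_eq by blast
qed

end
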